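(* Let $S$ be a discrete semigroup, let $E$ be a Banach space, and let $\pi$ be a JdLG-admissible representation of $S$ on $E$. Let $\xi\in E$. (i) $\xi\in E_r$ if and only if for any $\epsilon>0$ the set $\{s\in S:\|\xi-\pi_s\xi\|<\epsilon\}$ is IP$^*$. (ii) $\xi\in E_{\mathrm{aws}}$ if and only if for any weakly open neighborhood $U$ of $0$ in $E$ the set $\{s\in S:\pi_s\xi\in U\}$ is thickly syndetic. (iii) Assume that $S$ is cancellative and left reversible and let $\ell\in\mathbb{N}$ be arbitrary. Then $\xi\in E_r$ if and only if for any $\epsilon>0$ the set $\{s\in S:\|\xi-\pi_s\xi\|<\epsilon\}$ is $\Delta^{\ell*}$.
   Context: Banach spaces are complex. $\mathcal{L}(E)$ is the space of bounded linear operators on $E$; $\operatorname{cl}_\sigma$ denotes closure in the weak operator topology. A representation $\pi$ of a discrete semigroup $S$ on $E$ is a semigroup homomorphism $\pi:S\to\mathcal{L}(E)$, $s\mapsto\pi_s$ (with $\pi_e=\mathrm{Id}$ if $S$ has an identity $e$). It is JdLG-admissible if $\pi(S)$ is relatively compact in the weak operator topology and $\mathscr{S}:=\operatorname{cl}_\sigma(\pi(S))$ contains a unique minimal idempotent (an idempotent in the smallest two-sided ideal of $\mathscr{S}$). Equivalently, $\mathscr{S}$ is compact in the weak operator topology and $E_r=\{\xi:\forall u\in\mathscr{S}\ \exists v\in\mathscr{S},\ vu\xi=\xi\}$, $E_{\mathrm{aws}}=\{\xi:u\xi=0\text{ for some }u\in\mathscr{S}\}$ are closed $\mathscr{S}$-invariant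 subspaces with $E=E_r\oplus E_{\mathrm{aws}}$. Notions of largeness for $A\subseteq S$ (with $t^{-1}A=\{x\in S:tx\in A\}$): $A$ is an IP-set if there is a sequence $(s_n)_{n\ge1}$ in $S$ such that $\prod_{f\in F}s_f\in A$ (product in increasing order of indices) for every finite nonempty $F\subseteq\mathbb{N}$; $A$ is IP$^*$ if $A\cap B\ne\emptyset$ for every IP-set $B$. $A$ is piecewise syndetic if there is a finite nonempty $H\subseteq S$ such that the family $\{y^{-1}\bigcup_{h\in H}h^{-1}A:y\in S\}$ has the finite intersection property; $A$ is thickly syndetic if $A\cap B\neq\emptyset$ for every piecewise syndetic $B\subseteq S$. $S$ is cancellative if $ab=ac$ or $ba=ca$ implies $b=c$; left reversible if $rS\cap sS\ne\emptyset$ for all $r,s\in S$. A cancellative left reversible $S$ embeds in a group $G$ of right quotients: $S\subseteq G$ and each $g\in G$ is $st^{-1}$ with $s,t\in S$. $\beta S$, $\beta G$ denote the spaces of ultrafilters on $S$, $G$; $\beta S$ is identified with $\{p\in\beta G:S\in p\}$, and $S^*\subseteq\beta S$ is the set of nonprincipal ultrafilters. The product in $\beta G$ is given by $A\in qp$ iff $\{g\in G:g^{-1}A\in p\}\in q$ (so $q\mapsto qp$ is continuous), and $p^{-1}=\{A^{-1}:A\in p\}$. A set $A\subseteq S$ is $\Delta^{\ell*}$ if $A\in q$ for all $p_1,\dots,p_\ell\in S^*$ for which the product $q:=p_1^{-1}p_1\cdots p_\ell^{-1}p_\ell$ (computed in $\beta G$) belongs to $\beta S$. *)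

theory Defs
  imports "HOL-Analysis.Analysis" "HOL-Algebra.Group"
begin

section \<open>Complex Banach spaces\<close>

class complex_banach = banach +
  fixes scaleC :: "complex \<Rightarrow> 'a \<Rightarrow> 'a"  (infixr \<open>*\<^sub>C\<close> 75)
  assumes scaleC_add_right: "c *\<^sub>C (x + y) = c *\<^sub>C x + c *\<^sub>C y"
    and scaleC_add_left: "(c + d) *\<^sub>C x = c *\<^sub>C x + d *\<^sub>C x"
    and scaleC_scaleC: "c *\<^sub>C d *\<^sub>C x = (c * d) *\<^sub>C x"
    and scaleC_of_real: "complex_of_real r *\<^sub>C x = r *\<^sub>R x"
    and norm_scaleC: "norm (c *\<^sub>C x) = cmod c * norm x"

instantiation complex :: complex_banach
begin
definition scaleC_complex :: "complex \<Rightarrow> complex \<Rightarrow> complex"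
  where "scaleC_complex c x = c * x"
instance
  by standard (simp_all add: scaleC_complex_def algebra_simps norm_mult scaleR_conv_of_real)
end

definition clinear_functionals :: "('e::complex_banach \<Rightarrow> complex) set" where
  "clinear_functionals = {\<phi>. bounded_linear \<phi> \<and> (\<forall>c x. \<phi> (c *\<^sub>C x) = c * \<phi> x)}"

text \<open>The library type of bounded operators is real-linear, hence the restriction.\<close>
definition clinear_operators :: "('e::complex_banach \<Rightarrow>\<^sub>L 'e) set" where
  "clinear_operators = {T. \<forall>c x. blinfun_apply T (c *\<^sub>C x) = c *\<^sub>C blinfun_apply T x}"

definition weak_topology :: "'e::complex_banach topology" where
  "weak_topology =
     topology_generated_by {{x. \<phi> x \<in> U} | \<phi> U. \<phi> \<in> clinear_functionals \<and> open U}"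

definition weak_operator_topology :: "('e::complex_banach \<Rightarrow>\<^sub>L 'e) topology" where
  "weak_operator_topology =
     topology_generated_by
       {{T \<in> clinear_operators. \<phi> (blinfun_apply T x) \<in> U} | x \<phi> U. \<phi> \<in> clinear_functionals \<and> open U}"


section \<open>JdLG-admissible representations\<close>

definition representation :: "('s::semigroup_mult \<Rightarrow> ('e::complex_banach \<Rightarrow>\<^sub>L 'e)) \<Rightarrow> bool" where
  "representation \<pi> \<longleftrightarrow>
     range \<pi> \<subseteq> clinear_operators \<and>
     (\<forall>s t. \<pi> (s * t) = \<pi> s o\<^sub>L \<pi> t) \<and>
     (\<forall>e. (\<forall>s. e * s = s \<and> s * e = s) \<longrightarrow> \<pi> e = id_blinfun)"

definition enveloping_semigroup ::
    "('s \<Rightarrow> ('e::complex_banach \<Rightarrow>\<^sub>L 'e)) \<Rightarrow> ('e \<Rightarrow>\<^sub>L 'e) set" where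
  "enveloping_semigroup \<pi> = weak_operator_topology closure_of range \<pi>"

definition two_sided_ideal ::
    "('e::real_normed_vector \<Rightarrow>\<^sub>L 'e) set \<Rightarrow> ('e \<Rightarrow>\<^sub>L 'e) set \<Rightarrow> bool" where
  "two_sided_ideal \<S> I \<longleftrightarrow>
     I \<noteq> {} \<and> I \<subseteq> \<S> \<and> (\<forall>u\<in>\<S>. \<forall>v\<in>I. u o\<^sub>L v \<in> I \<and> v o\<^sub>L u \<in> I)"

definition smallest_ideal ::
    "('e::real_normed_vector \<Rightarrow>\<^sub>L 'e) set \<Rightarrow> ('e \<Rightarrow>\<^sub>L 'e) set \<Rightarrow> bool" where
  "smallest_ideal \<S> K \<longleftrightarrow> two_sided_ideal \<S> K \<and> (\<forall>I. two_sided_ideal \<S> I \<longrightarrow> K \<subseteq> I)"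

definition minimal_idempotent ::
    "('e::real_normed_vector \<Rightarrow>\<^sub>L 'e) set \<Rightarrow> ('e \<Rightarrow>\<^sub>L 'e) \<Rightarrow> bool" where
  "minimal_idempotent \<S> u \<longleftrightarrow> u o\<^sub>L u = u \<and> (\<exists>K. smallest_ideal \<S> K \<and> u \<in> K)"

definition JdLG_admissible :: "('s \<Rightarrow> ('e::complex_banach \<Rightarrow>\<^sub>L 'e)) \<Rightarrow> bool" where
  "JdLG_admissible \<pi> \<longleftrightarrow>
     compactin weak_operator_topology (enveloping_semigroup \<pi>) \<and>
     (\<exists>!u. minimal_idempotent (enveloping_semigroup \<pi>) u)"

definition E_r :: "('s \<Rightarrow> ('e::complex_banach \<Rightarrow>\<^sub>L 'e)) \<Rightarrow> 'e set" where
  "E_r \<pi> = {\<xi>. \<forall>u\<in>enveloping_semigroup \<pi>. \<exists>v\<in>enveloping_semigroup \<pi>. blinfun_apply v (blinfun_apply u \<xi>) = \<xi>}"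

definition E_aws :: "('s \<Rightarrow> ('e::complex_banach \<Rightarrow>\<^sub>L 'e)) \<Rightarrow> 'e set" where
  "E_aws \<pi> = {\<xi>. \<exists>u\<in>enveloping_semigroup \<pi>. blinfun_apply u \<xi> = 0}"


section \<open>Notions of largeness in a semigroup\<close>

text \<open>Product of a nonempty list; without an identity there is no value for the empty list.\<close>
fun list_product :: "'s::semigroup_mult list \<Rightarrow> 's" where
  "list_product [] = undefined"
| "list_product [s] = s"
| "list_product (s # t # ss) = s * list_product (t # ss)"

definition IP_set :: "'s::semigroup_mult set \<Rightarrow> bool" where
  "IP_set A \<longleftrightarrow>
     (\<exists>s :: nat \<Rightarrow> 's. \<forall>F. finite F \<and> F \<noteq> {} \<longrightarrow>
        list_product (map s (sorted_list_of_set F)) \<in> A)"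

definition IP_star :: "'s::semigroup_mult set \<Rightarrow> bool" where
  "IP_star A \<longleftrightarrow> (\<forall>B. IP_set B \<longrightarrow> A \<inter> B \<noteq> {})"

definition left_quotient :: "'s::semigroup_mult \<Rightarrow> 's set \<Rightarrow> 's set" where
  "left_quotient t A = {x. t * x \<in> A}"

definition piecewise_syndetic :: "'s::semigroup_mult set \<Rightarrow> bool" where
  "piecewise_syndetic A \<longleftrightarrow>
     (\<exists>H. finite H \<and> H \<noteq> {} \<and>
        (\<forall>\<F>. finite \<F> \<and> \<F> \<subseteq> range (\<lambda>y. left_quotient y (\<Union>h\<in>H. left_quotient h A))
           \<longrightarrow> \<Inter>\<F> \<noteq> {}))"

definition thickly_syndetic :: "'s::semigroup_mult set \<Rightarrow> bool" where
  "thickly_syndetic A \<longleftrightarrow> (\<forall>B. piecewise_syndetic B \<longrightarrow> A \<inter> B \<noteq> {})"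


section \<open>Groups of right quotients\<close>

definition cancellative :: "'s::semigroup_mult itself \<Rightarrow> bool" where
  "cancellative _ \<longleftrightarrow> (\<forall>a b c :: 's. a * b = a * c \<or> b * a = c * a \<longrightarrow> b = c)"

definition left_reversible :: "'s::semigroup_mult itself \<Rightarrow> bool" where
  "left_reversible _ \<longleftrightarrow> (\<forall>r s :: 's. range (\<lambda>x. r * x) \<inter> range (\<lambda>x. s * x) \<noteq> {})"

definition group_of_right_quotients :: "'g monoid \<Rightarrow> ('s::semigroup_mult \<Rightarrow> 'g) \<Rightarrow> bool" where
  "group_of_right_quotients G \<iota> \<longleftrightarrow>
     group G \<and> inj \<iota> \<and> range \<iota> \<subseteq> carrier G \<and>
     (\<forall>s t. \<iota> (s * t) = \<iota> s \<otimes>\<^bsub>G\<^esub> \<iota> t) \<and>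
     (\<forall>g\<in>carrier G. \<exists>s t. g = \<iota> s \<otimes>\<^bsub>G\<^esub> inv\<^bsub>G\<^esub> (\<iota> t))"

text \<open>Ore's theorem: a cancellative left reversible semigroup has a group of right quotients.
  The fraction \<open>a b\<^sup>-\<^sup>1\<close> is represented by the set of all pairs \<open>(u, v)\<close> with
  \<open>u v\<^sup>-\<^sup>1 = a b\<^sup>-\<^sup>1\<close>.\<close>

definition ore_fraction :: "'s::semigroup_mult \<Rightarrow> 's \<Rightarrow> ('s \<times> 's) set" where
  "ore_fraction a b = {(u, v). \<exists>x y. a * x = u * y \<and> b * x = v * y}"

definition ore_group :: "('s::semigroup_mult \<times> 's) set monoid" where
  "ore_group =
     \<lparr>carrier = {ore_fraction a b | a b. True},
      mult = (\<lambda>A B. {(u, w). \<exists>x v. (u * x, v) \<in> A \<and> (v, w * x) \<in> B}),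
      one = Id\<rparr>"

theorem ore_group_of_right_quotients:
  assumes canc: "cancellative TYPE('s::semigroup_mult)"
    and rev: "left_reversible TYPE('s)"
  shows "group_of_right_quotients ore_group (\<lambda>s :: 's. {(u, v). u = s * v})"
proof -
  let ?R = "ore_fraction :: 's \<Rightarrow> 's \<Rightarrow> ('s \<times> 's) set"
  let ?m = "mult (ore_group :: ('s \<times> 's) set monoid)"
  let ?i = "\<lambda>s :: 's. {(u, v). u = s * v}"
  have cl: "b = c" if "a * b = a * c" for a b c :: 's
    using canc that unfolding cancellative_def by blast
  have cr: "b = c" if "b * a = c * a" for a b c :: 's
    using canc that unfolding cancellative_def by blast
  have ex: "\<exists>x y. r * x = s * y" for r s :: 's
    using rev unfolding left_reversible_def by (metis Int_emptyI imageE)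
  have R: "(u, v) \<in> ?R a b \<longleftrightarrow> (\<exists>x y. a * x = u * y \<and> b * x = v * y)" for a b u v
    by (simp add: ore_fraction_def)
  have RE: "\<exists>x y. a * x = u * y \<and> b * x = v * y" if "(u, v) \<in> ?R a b" for a b u v
    using that R by simp
  have RI: "(u, v) \<in> ?R a b" if "a * x = u * y" "b * x = v * y" for a b u v x y
    unfolding R using that by blast
  have R_all: "b * z = v * w" if h1: "(u, v) \<in> ?R a b" and h2: "a * z = u * w" for a b u v z w
  proof -
    obtain x y where 1: "a * x = u * y" "b * x = v * y" using RE[OF h1] by blast
    obtain p q where 2: "z * p = x * q" using ex by blast
    have "u * (w * p) = u * (y * q)"
      by (metis 1(1) 2 mult.assoc h2)
    then have "w * p = y * q" using cl by blast
    then have "(b * z) * p = (v * w) * p" by (metis 1(2) 2 mult.assoc)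
    then show ?thesis using cr by blast
  qed
  have sym: "(a, b) \<in> ?R u v" if "(u, v) \<in> ?R a b" for a b u v
    using that by (metis RE RI)
  have trans: "(p, q) \<in> ?R a b" if h1: "(u, v) \<in> ?R a b" and h2: "(p, q) \<in> ?R u v" for a b u v p q
  proof -
    obtain x y where 1: "a * x = u * y" "b * x = v * y" using RE[OF h1] by blast
    obtain s t where 2: "u * s = p * t" "v * s = q * t" using RE[OF h2] by blast
    obtain m n where 3: "y * m = s * n" using ex by blast
    have "a * (x * m) = p * (t * n)" "b * (x * m) = q * (t * n)"
      by (metis 1 2 3 mult.assoc)+
    then show ?thesis by (rule RI)
  qed
  have R_eq: "?R u v = ?R a b" if "(u, v) \<in> ?R a b" for a b u v
  proof -
    have "z \<in> ?R u v \<longleftrightarrow> z \<in> ?R a b" for z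
      using that sym trans by (cases z) blast
    then show ?thesis by blast
  qed
  have expand: "?R (a * z) (b * z) = ?R a b" for a b z
    by (rule R_eq, rule RI[of _ "z * z" _ z]) (simp_all add: mult.assoc)
  have R_refl: "(a, b) \<in> ?R a b" for a b by (rule RI) (rule refl)+
  have m: "(u, w) \<in> ?m A B \<longleftrightarrow> (\<exists>x v. (u * x, v) \<in> A \<and> (v, w * x) \<in> B)" for u w A B
    by (simp add: ore_group_def)
  have mult: "?m (?R a b) (?R b d) = ?R a d" for a b d
  proof -
    have "(u, w) \<in> ?m (?R a b) (?R b d) \<longleftrightarrow> (u, w) \<in> ?R a d" for u w
    proof
      assume "(u, w) \<in> ?m (?R a b) (?R b d)"
      then obtain x v where 1: "(u * x, v) \<in> ?R a b" "(v, w * x) \<in> ?R b d" using m by blast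
      obtain p q where 2: "a * p = (u * x) * q" "b * p = v * q" using RE[OF 1(1)] by blast
      have "d * p = (w * x) * q" using R_all[OF 1(2) 2(2)] .
      then show "(u, w) \<in> ?R a d" using 2(1) RI by (metis mult.assoc)
    next
      assume "(u, w) \<in> ?R a d"
      then obtain x y where 1: "a * x = u * y" "d * x = w * y" using RE by blast
      have "(a * x, b * x) \<in> ?R a b" "(b * x, d * x) \<in> ?R b d"
        using R_refl expand by metis+
      then show "(u, w) \<in> ?m (?R a b) (?R b d)" using 1 m by metis
    qed
    then show ?thesis by auto
  qed
  have common: "\<exists>x y. ?R a b = ?R (a * x) (b * x) \<and> ?R c d = ?R (b * x) (d * y) \<and> b * x = c * y"
    for a b c d using ex[of b c] expand by metis
  have one: "?R a a = Id" for a
  proof -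
    have "(u, v) \<in> ?R a a \<longleftrightarrow> u = v" for u v
      using R ex cr by metis
    then show ?thesis by auto
  qed
  have inc: "?i s = ?R (s * c) c" for s c
  proof -
    have "(u, v) \<in> ?R (s * c) c \<longleftrightarrow> u = s * v" for u v
    proof
      assume "(u, v) \<in> ?R (s * c) c"
      then obtain x y where "(s * c) * x = u * y" "c * x = v * y" using RE by blast
      then have "u * y = (s * v) * y" by (metis mult.assoc)
      then show "u = s * v" using cr by blast
    next
      assume "u = s * v"
      moreover obtain x y where "c * x = v * y" using ex by blast
      ultimately show "(u, v) \<in> ?R (s * c) c" using RI by (metis mult.assoc)
    qed
    then show ?thesis by auto
  qed
  have carr: "carrier ore_group = {?R a b | a b. True}"
    and one_def: "\<one>\<^bsub>ore_group\<^esub> = (Id :: ('s \<times> 's) set)"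
    by (simp_all add: ore_group_def)
  have grp: "group (ore_group :: ('s \<times> 's) set monoid)"
  proof (rule groupI)
    fix A B :: "('s \<times> 's) set" assume "A \<in> carrier ore_group" "B \<in> carrier ore_group"
    then obtain a b c d where AB: "A = ?R a b" "B = ?R c d" unfolding carr by blast
    obtain x y where "A = ?R (a * x) (b * x)" "B = ?R (b * x) (d * y)"
      using common AB by blast
    then have "?m A B = ?R (a * x) (d * y)" using mult by simp
    then show "?m A B \<in> carrier ore_group" unfolding carr by blast
  next
    show "\<one>\<^bsub>ore_group\<^esub> \<in> carrier (ore_group :: ('s \<times> 's) set monoid)"
      unfolding carr one_def using one by blast
  next
    fix A B C :: "('s \<times> 's) set"
    assume "A \<in> carrier ore_group" "B \<in> carrier ore_group" "C \<in> carrier ore_group"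
    then obtain a b c d e f where ABC: "A = ?R a b" "B = ?R c d" "C = ?R e f"
      unfolding carr by blast
    obtain x y where AB: "A = ?R (a * x) (b * x)" "B = ?R (b * x) (d * y)"
      using common ABC by blast
    obtain z w where BC: "B = ?R (b * x * z) (d * y * z)" "C = ?R (d * y * z) (f * w)"
      using common AB ABC by blast
    have A: "A = ?R (a * x * z) (b * x * z)" using AB expand by simp
    have "?m (?m A B) C = ?R (a * x * z) (f * w)"
      by (subst A, subst BC(1), subst BC(2)) (simp only: mult)
    moreover have "?m A (?m B C) = ?R (a * x * z) (f * w)"
      by (subst A, subst BC(1), subst BC(2)) (simp only: mult)
    ultimately show "?m (?m A B) C = ?m A (?m B C)" by simp
  next
    fix A :: "('s \<times> 's) set" assume "A \<in> carrier ore_group"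
    then obtain a b where A: "A = ?R a b" unfolding carr by blast
    have "?m (?R a a) A = A" unfolding A by (rule mult)
    then show "?m \<one>\<^bsub>ore_group\<^esub> A = A" unfolding one_def one .
    have "?m (?R b a) A = ?R b b" unfolding A by (rule mult)
    then show "\<exists>B\<in>carrier ore_group. ?m B A = \<one>\<^bsub>ore_group\<^esub>"
      unfolding one_def one carr by blast
  qed
  interpret G: group "ore_group :: ('s \<times> 's) set monoid" by (rule grp)
  have in_carr: "?R a b \<in> carrier ore_group" for a b unfolding carr by blast
  have inv: "inv\<^bsub>ore_group\<^esub> (?R a b) = ?R b a" for a b
    by (rule G.inv_equality) (simp_all add: mult one one_def in_carr)
  have "inj ?i"
  proof (rule injI)
    fix s t assume "?i s = ?i t"
    then have "(s * s, s) \<in> ?i t" by blast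
    then show "s = t" using cr by simp
  qed
  moreover have "range ?i \<subseteq> carrier ore_group" 
  proof (rule image_subsetI)
    fix s :: 's
    show "?i s \<in> carrier ore_group" unfolding inc[of s s] by (rule in_carr)
  qed
  moreover have "?i (s * t) = ?m (?i s) (?i t)" for s t
  proof -
    have "?m (?i s) (?i t) = ?m (?R (s * (t * t)) (t * t)) (?R (t * t) t)"
      unfolding inc[of s "t * t"] inc[of t t] ..
    also have "\<dots> = ?R ((s * t) * t) t" unfolding mult by (simp only: mult.assoc)
    also have "\<dots> = ?i (s * t)" by (rule inc[symmetric])
    finally show ?thesis by simp
  qed
  moreover have "\<exists>s t. g = ?m (?i s) (inv\<^bsub>ore_group\<^esub> (?i t))"
    if g: "g \<in> carrier ore_group" for g
  proof -
    obtain a b where gab: "g = ?R a b" using g unfolding carr by blast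
    have "?m (?i a) (inv\<^bsub>ore_group\<^esub> (?i b)) = g"
      unfolding gab inc[of a b] inc[of b b] inv mult by (rule expand)
    then show ?thesis by (intro exI) (erule HOL.sym)
  qed
  ultimately show ?thesis
    unfolding group_of_right_quotients_def using grp by blast
qed


section \<open>Ultrafilters\<close>

definition ultrafilter :: "'x filter \<Rightarrow> bool" where
  "ultrafilter p \<longleftrightarrow> p \<noteq> bot \<and> (\<forall>P. eventually P p \<or> eventually (\<lambda>x. \<not> P x) p)"

text \<open>For \<open>X\<close> the carrier of \<open>G\<close> this is \<open>\<beta>G\<close>; for \<open>X\<close> the image of \<open>S\<close> in \<open>G\<close> it is \<open>\<beta>S\<close>,
  viewed inside \<open>\<beta>G\<close>. The relation \<open>A \<in> p\<close> is \<open>eventually (\<lambda>x. x \<in> A) p\<close>.\<close>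
definition ultrafilters_on :: "'x set \<Rightarrow> 'x filter set" where
  "ultrafilters_on X = {p. ultrafilter p \<and> eventually (\<lambda>x. x \<in> X) p}"

definition nonprincipal_ultrafilters_on :: "'x set \<Rightarrow> 'x filter set" where
  "nonprincipal_ultrafilters_on X = {p \<in> ultrafilters_on X. \<forall>x. p \<noteq> principal {x}}"

definition ultrafilter_mult :: "('g, 'm) monoid_scheme \<Rightarrow> 'g filter \<Rightarrow> 'g filter \<Rightarrow> 'g filter" where
  "ultrafilter_mult G q p = Abs_filter (\<lambda>P. \<forall>\<^sub>F g in q. \<forall>\<^sub>F x in p. P (g \<otimes>\<^bsub>G\<^esub> x))"

lemma eventually_ultrafilter_mult:
  "eventually P (ultrafilter_mult G q p) \<longleftrightarrow> (\<forall>\<^sub>F g in q. \<forall>\<^sub>F x in p. P (g \<otimes>\<^bsub>G\<^esub> x))"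
  unfolding ultrafilter_mult_def
proof (rule eventually_Abs_filter, rule is_filter.intro)
  fix P Q
  assume "\<forall>\<^sub>F g in q. \<forall>\<^sub>F x in p. P (g \<otimes>\<^bsub>G\<^esub> x)" "\<forall>\<^sub>F g in q. \<forall>\<^sub>F x in p. Q (g \<otimes>\<^bsub>G\<^esub> x)"
  then show "\<forall>\<^sub>F g in q. \<forall>\<^sub>F x in p. P (g \<otimes>\<^bsub>G\<^esub> x) \<and> Q (g \<otimes>\<^bsub>G\<^esub> x)"
    by eventually_elim (rule eventually_conj)
next
  fix P Q
  assume "\<forall>x. P x \<longrightarrow> Q x" "\<forall>\<^sub>F g in q. \<forall>\<^sub>F x in p. P (g \<otimes>\<^bsub>G\<^esub> x)"
  then show "\<forall>\<^sub>F g in q. \<forall>\<^sub>F x in p. Q (g \<otimes>\<^bsub>G\<^esub> x)"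
    by (auto elim!: eventually_mono)
qed simp

definition ultrafilter_inv :: "('g, 'm) monoid_scheme \<Rightarrow> 'g filter \<Rightarrow> 'g filter" where
  "ultrafilter_inv G p = filtermap (\<lambda>g. inv\<^bsub>G\<^esub> g) p"

text \<open>The product \<open>p\<^sub>1\<^sup>-\<^sup>1 p\<^sub>1 \<cdots> p\<^sub>l\<^sup>-\<^sup>1 p\<^sub>l\<close>; the principal ultrafilter at the identity of \<open>G\<close>
  is the identity of the semigroup \<open>\<beta>G\<close>.\<close>
fun difference_product :: "('g, 'm) monoid_scheme \<Rightarrow> 'g filter list \<Rightarrow> 'g filter" where
  "difference_product G [] = principal {\<one>\<^bsub>G\<^esub>}"
| "difference_product G (p # ps) =
     ultrafilter_mult G (ultrafilter_mult G (ultrafilter_inv G p) p) (difference_product G ps)"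

definition Delta_star :: "'g monoid \<Rightarrow> ('s::semigroup_mult \<Rightarrow> 'g) \<Rightarrow> nat \<Rightarrow> 's set \<Rightarrow> bool" where
  "Delta_star G \<iota> l A \<longleftrightarrow>
     (\<forall>ps. length ps = l \<and> set ps \<subseteq> nonprincipal_ultrafilters_on (range \<iota>) \<and>
           difference_product G ps \<in> ultrafilters_on (range \<iota>) \<longrightarrow>
        eventually (\<lambda>g. g \<in> \<iota> ` A) (difference_product G ps))"

end

theory Submission
  imports Defs
begin

text \<open>The compact semigroup \<open>\<S>\<close> has separately continuous multiplication. Ellis' theorem applied inside
  its smallest ideal, together with the uniqueness of the minimal idempotent \<open>e\<close>, shows that \<open>e\<close> is
  central and \<open>e\<S>\<close> is a group; hence \<open>E\<^sub>r\<close> is the range and \<open>E\<^sub>a\<^sub>w\<^sub>s\<close> the kernel of \<open>e\<close>. On an orbit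
  of this group inside \<open>E\<^sub>r\<close> the weak and the norm topology agree at every point, because weakly compact
  sets are fragmented by the norm and the group acts transitively. This turns the approximation of \<open>e\<close>
  by the operators \<open>\<pi>\<^sub>s\<close> into norm recurrence.

  The converse implications need, inside a given neighbourhood of \<open>e\<close>, an IP-set, a piecewise
  syndetic set, or a product \<open>p\<^sup>-\<^sup>1p \<cdots> p\<^sup>-\<^sup>1p\<close>; each is obtained from \<open>ee = e\<close> or from compactness
  of \<open>e\<S>\<close>.\<close>

section \<open>The Hahn-Banach theorem and uniform boundedness\<close>

text \<open>The return-time sets in (i) and (iii) are measured in norm, whereas compactness of the
  enveloping semigroup only gives weak information. Fragmentability bridges this gap, and only for
  vectors fixed by \<open>e\<close>. The converses avoid it by testing against one functional at a
  time. A second obstacle is that composition is only separately continuous in the weak operator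
  topology, so a limit is taken in one factor while the other is held fixed, never in both at once.
  In (iii) the operators \<open>\<pi> s\<close> need not be invertible, so \<pi> itself need not
  extend to the group of quotients; the operators composed with \<open>e\<close> are invertible, and
  they act on a vector fixed by \<open>e\<close> as \<pi> does up to \<open>e\<close>. The
  \<Delta>-condition speaks only of products that land in \<beta>S, so its converse has to
  manufacture an ultrafilter whose product does. For finite S there are no nonprincipal ultrafilters
  and the condition is vacuous; there \<open>e\<close> has to be the identity for algebraic reasons.
  Hahn-Banach is used for real functionals, while the weak topologies are generated by complex ones;
  each real functional is the real part of a complex one.\<close>

definition sublinear :: "('a::real_vector \<Rightarrow> real) \<Rightarrow> bool" where
  "sublinear p \<longleftrightarrow> (\<forall>x y. p (x + y) \<le> p x + p y) \<and> (\<forall>t x. 0 \<le> t \<longrightarrow> p (t *\<^sub>R x) = t * p x)"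

lemma sublinear_add: "sublinear p \<Longrightarrow> p (x + y) \<le> p x + p y"
  by (simp add: sublinear_def)

lemma sublinear_scale: "sublinear p \<Longrightarrow> 0 \<le> t \<Longrightarrow> p (t *\<^sub>R x) = t * p x"
  by (simp add: sublinear_def)

lemma sublinear_neg_le: "sublinear p \<Longrightarrow> - p (- x) \<le> p x"
  using sublinear_add[of p x "- x"] sublinear_scale[of p 0 0] by simp

text \<open>The witness is the infimum over t \<ge> 0 of
  \<open>p (x + t *\<^sub>R a) - t * p a\<close>, bounded below by \<open>- p (- x)\<close> through
  subadditivity. The choice t = 0 puts it below \<open>p\<close>, and t = 1 at \<open>- a\<close>
  gives the last claim. It serves twice: to fix the value at a prescribed point, and to make a
  minimal functional odd.\<close>

lemma sublinear_lower:
  assumes p: "sublinear p"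
  obtains q where "sublinear q" "\<And>x. q x \<le> p x" "q (- a) \<le> - p a"
proof
  define F where "F x t = p (x + t *\<^sub>R a) - t * p a" for x t
  define q where "q x = (INF t\<in>{0..}. F x t)" for x
  have lb: "- p (- x) \<le> F x t" if "0 \<le> t" for x t
  proof -
    have "p (t *\<^sub>R a) \<le> p (x + t *\<^sub>R a) + p (- x)"
      using sublinear_add[OF p, of "x + t *\<^sub>R a" "- x"] by simp
    then show ?thesis using sublinear_scale[OF p that, of a] by (simp add: F_def)
  qed
  have bdd: "bdd_below (F x ` {0..})" for x
    using lb by (intro bdd_belowI[of _ "- p (- x)"]) auto
  have qF: "q x \<le> F x t" if "0 \<le> t" for x t
    unfolding q_def using that by (intro cINF_lower bdd) auto
  have qI: "c \<le> q x" if "\<And>t. 0 \<le> t \<Longrightarrow> c \<le> F x t" for c x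
    unfolding q_def using that by (intro cINF_greatest) auto
  show le: "q x \<le> p x" for x using qF[of 0 x] by (simp add: F_def)
  show "q (- a) \<le> - p a"
    using qF[of 1 "- a"] sublinear_scale[OF p, of 0 0] by (simp add: F_def)
  have sub: "q (x + y) \<le> q x + q y" for x y
  proof -
    have "q (x + y) \<le> F x s + F y t" if "0 \<le> s" "0 \<le> t" for s t
    proof -
      have "F (x + y) (s + t) \<le> F x s + F y t"
        using sublinear_add[OF p, of "x + s *\<^sub>R a" "y + t *\<^sub>R a"]
        by (simp add: F_def algebra_simps)
      then show ?thesis using qF[of "s + t" "x + y"] that by simp
    qed
    then have "q (x + y) - F y t \<le> q x" if "0 \<le> t" for t
      using that by (intro qI) (simp add: diff_le_eq)
    then have "q (x + y) - q x \<le> q y"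
      by (intro qI) (simp add: diff_le_eq le_diff_eq add.commute)
    then show ?thesis by simp
  qed
  have sc1: "s * q x \<le> q (s *\<^sub>R x)" if "0 < s" for s x
  proof (rule qI)
    fix t :: real assume t: "0 \<le> t"
    have "F (s *\<^sub>R x) t = s * F x (t / s)"
      using sublinear_scale[OF p, of s "x + (t/s) *\<^sub>R a"] that
      by (simp add: F_def algebra_simps)
    then show "s * q x \<le> F (s *\<^sub>R x) t"
      using qF[of "t / s" x] that t by (simp add: mult_left_mono)
  qed
  have sc2: "q (s *\<^sub>R x) \<le> s * q x" if "0 < s" for s x
    using sc1[of "1/s" "s *\<^sub>R x"] that by (simp add: field_simps)
  have "q 0 = 0"
    using le[of 0] qI[of 0 0] lb[of _ 0] sublinear_scale[OF p, of 0 0] by force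
  then have "q (s *\<^sub>R x) = s * q x" if "0 \<le> s" for s x
    using sc1[of s x] sc2[of s x] that by (cases "s = 0") auto
  then show "sublinear q" using sub by (simp add: sublinear_def)
qed

text \<open>Zorn's lemma with pointwise infima of chains; the common lower bound
  \<open>- p (- x)\<close> keeps the infima finite.\<close>

lemma exists_minimal_sublinear:
  assumes p: "sublinear p"
  obtains f where "sublinear f" "\<And>x. f x \<le> p x"
    "\<And>q. sublinear q \<Longrightarrow> (\<And>x. q x \<le> f x) \<Longrightarrow> q = f"
proof -
  define A where "A = {q. sublinear q \<and> (\<forall>x. q x \<le> p x)}"
  \<comment> \<open>The order is reversed because Zorn's lemma delivers maximal elements.\<close>
  define P where "P = (\<lambda>(f::'a \<Rightarrow> real) g. \<forall>x. g x \<le> f x)"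
  have "\<exists>f\<in>A. \<forall>q\<in>A. P f q \<longrightarrow> q = f"
  proof (rule predicate_Zorn)
    show "partial_order_on A (relation_of P A)"
    proof (rule partial_order_on_relation_ofI)
      fix f g assume "P f g" "P g f"
      then show "f = g" unfolding P_def by (intro ext antisym) auto
    qed (auto simp: P_def intro: order_trans)
  next
    fix C assume C: "C \<in> Chains (relation_of P A)"
    show "\<exists>u\<in>A. \<forall>a\<in>C. P a u"
    proof (cases "C = {}")
      case True
      then show ?thesis using p by (auto simp: A_def)
    next
      case False
      have CA: "f \<in> A" if "f \<in> C" for f
        using C that unfolding Chains_def relation_of_def by auto
      have lin: "(\<forall>x. g x \<le> f x) \<or> (\<forall>x. f x \<le> g x)" if "f \<in> C" "g \<in> C" for f g
        using C that unfolding Chains_def relation_of_def P_def by auto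
      define u where "u x = (INF f\<in>C. f x)" for x
      have bdd: "bdd_below ((\<lambda>f. f x) ` C)" for x
      proof (rule bdd_belowI2[of _ "- p (- x)"])
        fix f assume "f \<in> C"
        then have "sublinear f" "f (- x) \<le> p (- x)" using CA by (auto simp: A_def)
        then show "- p (- x) \<le> f x" using sublinear_neg_le[of f x] by linarith
      qed
      have uf: "u x \<le> f x" if "f \<in> C" for f x
        unfolding u_def using that by (intro cINF_lower bdd)
      have uI: "c \<le> u x" if "\<And>f. f \<in> C \<Longrightarrow> c \<le> f x" for c x
        unfolding u_def using that False by (intro cINF_greatest)
      have sub: "u (x + y) \<le> u x + u y" for x y
      proof -
        have "u (x + y) \<le> f x + g y" if fg: "f \<in> C" "g \<in> C" for f g
        proof -
          \<comment> \<open>In a chain the smaller of \<open>f\<close> and \<open>g\<close> serves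
            at both points. This makes the infimum subadditive, which fails for arbitrary
            families.\<close>
          obtain h where h: "h \<in> C" "h x \<le> f x" "h y \<le> g y"
            using lin[OF fg] fg by (metis order_refl)
          then have "h (x + y) \<le> h x + h y" using CA[OF h(1)] sublinear_add[of h x y] by (simp add: A_def)
          then show ?thesis using uf[OF h(1), of "x + y"] h by linarith
        qed
        then have "u (x + y) - g y \<le> u x" if "g \<in> C" for g
          using that by (intro uI) (simp add: diff_le_eq)
        then have "u (x + y) - u x \<le> u y"
          by (intro uI) (simp add: diff_le_eq le_diff_eq add.commute)
        then show ?thesis by simp
      qed
      have sc: "s * u x \<le> u (s *\<^sub>R x)" if "0 \<le> s" for s x
      proof (rule uI)
        fix f assume f: "f \<in> C"
        then have "f (s *\<^sub>R x) = s * f x" using CA[OF f] sublinear_scale[of f s x] that by (simp add: A_def)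
        then show "s * u x \<le> f (s *\<^sub>R x)" using uf[OF f, of x] that by (simp add: mult_left_mono)
      qed
      have "u (s *\<^sub>R x) \<le> s * u x" if "0 < s" for s x
        using sc[of "1/s" "s *\<^sub>R x"] that by (simp add: field_simps)
      moreover have "u 0 \<le> 0"
      proof -
        obtain f where f: "f \<in> C" using False by blast
        then have "f 0 = 0" using CA[OF f] sublinear_scale[of f 0 0] by (auto simp: A_def)
        then show ?thesis using uf[OF f, of 0] by simp
      qed
      ultimately have "u (s *\<^sub>R x) = s * u x" if "0 \<le> s" for s x
        using sc[of s x] that sc[of 0 0] by (cases "s = 0") (auto intro: antisym)
      then have "sublinear u" using sub by (simp add: sublinear_def)
      moreover obtain f0 where f0: "f0 \<in> C" using False by blast
      have "u x \<le> p x" for x using uf[OF f0, of x] CA[OF f0] by (auto simp: A_def intro: order_trans)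
      ultimately have "u \<in> A" by (simp add: A_def)
      then show ?thesis using uf by (auto simp: P_def)
    qed
  qed
  then obtain f where f: "f \<in> A" "\<And>q. q \<in> A \<Longrightarrow> P f q \<Longrightarrow> q = f" by blast
  have "q = f" if "sublinear q" "\<And>x. q x \<le> f x" for q
    using f(1) that by (intro f(2)) (auto simp: A_def P_def intro: order_trans)
  then show ?thesis using f(1) that by (auto simp: A_def)
qed

text \<open>A minimal sublinear functional \<open>f\<close> is linear: for each \<open>x\<close>, a sublinear \<open>g \<le> f\<close> with
  \<open>g (- x) \<le> - f x\<close> must be \<open>f\<close> itself.\<close>

lemma Hahn_Banach_sublinear:
  assumes p: "sublinear (p :: 'a::real_vector \<Rightarrow> real)"
  obtains f where "linear f" "\<And>x. f x \<le> p x" "f a = p a"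
proof -
  obtain q where q: "sublinear q" "\<And>x. q x \<le> p x" "q (- a) \<le> - p a"
    using sublinear_lower[OF p] by blast
  obtain f where f: "sublinear f" "\<And>x. f x \<le> q x"
    and min: "\<And>q. sublinear q \<Longrightarrow> (\<And>x. q x \<le> f x) \<Longrightarrow> q = f"
    using exists_minimal_sublinear[OF q(1)] by blast
  have neg: "f (- x) = - f x" for x
  proof -
    obtain g where g: "sublinear g" "\<And>y. g y \<le> f y" "g (- x) \<le> - f x"
      using sublinear_lower[OF f(1)] by blast
    then have "g = f" by (intro min)
    then show ?thesis using g(3) sublinear_neg_le[OF f(1), of x] by simp
  qed
  have add: "f (x + y) = f x + f y" for x y
    using sublinear_add[OF f(1), of x y] sublinear_add[OF f(1), of "x + y" "- y"]
    by (simp add: neg)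
  have "f (t *\<^sub>R x) = t * f x" for t x
  proof (cases "0 \<le> t")
    case False
    then have "f ((- t) *\<^sub>R x) = (- t) * f x" by (intro sublinear_scale[OF f(1)]) simp
    then show ?thesis by (simp add: neg)
  qed (rule sublinear_scale[OF f(1)])
  then have lin: "linear f" using add by (intro linearI) simp_all
  show ?thesis
  proof (rule that[OF lin])
    show fp: "f x \<le> p x" for x using f(2) q(2) order_trans by blast
    show "f a = p a" using f(2)[of "- a"] q(3) fp[of a] by (simp add: neg)
  qed
qed

section \<open>Norming, separating and annihilating functionals\<close>

lemma bounded_linear_le_norm:
  assumes "linear (f :: 'a::real_normed_vector \<Rightarrow> real)" "\<And>x. f x \<le> norm x"
  shows "bounded_linear f" "\<And>x. \<bar>f x\<bar> \<le> norm x"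
proof -
  show le: "\<bar>f x\<bar> \<le> norm x" for x
    using assms(2)[of x] assms(2)[of "- x"] linear_neg[OF assms(1), of x] by auto
  show "bounded_linear f"
    using le assms(1) by (intro linear_conv_bounded_linear[THEN iffD1] bounded_linear_intro[of _ 1])
      (auto simp: linear_add linear_scale)
qed

lemma norming_functional:
  fixes a :: "'a::real_normed_vector"
  obtains f where "bounded_linear f" "\<And>x. \<bar>f x\<bar> \<le> norm x" "f a = norm a"
proof -
  have "sublinear (norm :: 'a \<Rightarrow> real)"
    by (simp add: sublinear_def norm_triangle_ineq)
  then obtain f where "linear f" "\<And>x. f x \<le> norm x" "f a = norm a"
    using Hahn_Banach_sublinear by blast
  then show ?thesis using that bounded_linear_le_norm by blast
qed

lemma functionals_separate:
  fixes x y :: "'a::real_normed_vector"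
  assumes "\<And>f :: 'a \<Rightarrow> real. bounded_linear f \<Longrightarrow> f x = f y"
  shows "x = y"
proof -
  obtain f :: "'a \<Rightarrow> real" where f: "bounded_linear f" "f (x - y) = norm (x - y)"
    using norming_functional by blast
  interpret bounded_linear f by (rule f(1))
  show ?thesis using f(2) assms[OF f(1)] by (simp add: diff)
qed

text \<open>The distance to \<open>V\<close> is itself sublinear and vanishes on \<open>V\<close>,
  so a linear functional dominated by it vanishes there too. Attaining the distance at
  \<open>a\<close>, it can be normalised because the distance of a point to a closed set not
  containing it is positive.\<close>

lemma functional_vanishing_on_subspace:
  fixes V :: "'a::real_normed_vector set"
  assumes V: "subspace V" "closed V" and a: "a \<notin> V"
  obtains f :: "'a \<Rightarrow> real" where "bounded_linear f" "\<And>x. x \<in> V \<Longrightarrow> f x = 0" "f a = 1"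
proof -
  have ne: "V \<noteq> {}" using subspace_0[OF V(1)] by blast
  have d_le: "infdist (x + y) V \<le> infdist x V + infdist y V" for x y
  proof (rule field_le_epsilon)
    fix e :: real assume e: "0 < e"
    have ex: "\<exists>v\<in>V. dist z v < infdist z V + e/2" for z
    proof -
      have "(INF v\<in>V. dist z v) < infdist z V + e/2" using e by (simp add: infdist_notempty[OF ne])
      then show ?thesis using cINF_less_iff[of V "dist z"] ne by (auto intro!: bdd_belowI2[of _ 0])
    qed
    obtain v w where vw: "v \<in> V" "dist x v < infdist x V + e/2" "w \<in> V" "dist y w < infdist y V + e/2"
      using ex by meson
    have "infdist (x + y) V \<le> dist (x + y) (v + w)"
      using vw subspace_add[OF V(1)] by (intro infdist_le) auto
    also have "\<dots> \<le> dist x v + dist y w" by (rule dist_triangle_add)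
    finally show "infdist (x + y) V \<le> infdist x V + infdist y V + e" using vw by simp
  qed
  have d_sc1: "t * infdist x V \<le> infdist (t *\<^sub>R x) V" if "0 < t" for t x
  proof -
    have "t * infdist x V \<le> dist (t *\<^sub>R x) v" if v: "v \<in> V" for v
    proof -
      have "infdist x V \<le> dist x ((1/t) *\<^sub>R v)"
        using v by (intro infdist_le subspace_scale[OF V(1)])
      then have "t * infdist x V \<le> t * dist x ((1/t) *\<^sub>R v)" using \<open>0 < t\<close> by simp
      also have "\<dots> = dist (t *\<^sub>R x) (t *\<^sub>R ((1/t) *\<^sub>R v))"
        using \<open>0 < t\<close> by (simp only: dist_norm norm_scaleR abs_of_pos flip: scaleR_right_diff_distrib)
      finally show ?thesis using \<open>0 < t\<close> by simp
    qed
    then show ?thesis by (simp add: infdist_notempty[OF ne] cINF_greatest[OF ne])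
  qed
  have d_sc2: "infdist (t *\<^sub>R x) V \<le> t * infdist x V" if "0 < t" for t x
    using d_sc1[of "1/t" "t *\<^sub>R x"] that by (simp add: field_simps)
  have "infdist (t *\<^sub>R x) V = t * infdist x V" if "0 \<le> t" for t x
    using d_sc1[of t x] d_sc2[of t x] that subspace_0[OF V(1)] by (cases "t = 0") auto
  then have "sublinear (\<lambda>x. infdist x V)" using d_le by (simp add: sublinear_def)
  then obtain f where f: "linear f" "\<And>x. f x \<le> infdist x V" "f a = infdist a V"
    using Hahn_Banach_sublinear by blast
  have "f x \<le> norm x" for x
    using f(2)[of x] infdist_le[OF subspace_0[OF V(1)], of x] by simp
  then have bl: "bounded_linear f" using bounded_linear_le_norm f(1) by blast
  have "f x = 0" if "x \<in> V" for x
    using f(2)[of x] f(2)[of "- x"] that subspace_neg[OF V(1) that]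
    by (simp add: linear_neg[OF f(1)])
  moreover have "infdist a V > 0" using infdist_pos_not_in_closed[OF V(2) ne a] .
  ultimately show ?thesis
    using bl f(3) by (intro that[of "\<lambda>x. f x / infdist a V"]) (auto intro: bounded_linear_divide bounded_linear_compose[of "\<lambda>x. x / infdist a V" f])
qed

section \<open>Uniform boundedness from the Baire category theorem\<close>

lemma uniform_boundedness:
  fixes T :: "'i \<Rightarrow> 'a::banach \<Rightarrow>\<^sub>L 'b::real_normed_vector"
  assumes bdd: "\<And>x. \<exists>c. \<forall>i\<in>I. norm (T i x) \<le> c"
  shows "\<exists>M. \<forall>i\<in>I. norm (T i) \<le> M"
proof -
  define F where "F n = {x. \<forall>i\<in>I. norm (T i x) \<le> real n}" for n
  have cl: "closed (F n)" for n
  proof -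
    have "F n = (\<Inter>i\<in>I. {x. norm (T i x) \<le> real n})" by (auto simp: F_def)
    then show ?thesis by (auto intro!: closed_INT closed_Collect_le continuous_intros)
  qed
  have "\<exists>n. x \<in> F n" for x
  proof -
    obtain c where "\<forall>i\<in>I. norm (T i x) \<le> c" using bdd by blast
    moreover obtain n where "c \<le> real n" using real_arch_simple by blast
    ultimately have "x \<in> F n" by (auto simp: F_def intro: order_trans)
    then show ?thesis by blast
  qed
  then have un: "(\<Union>n. F n) = UNIV" by blast
  have "\<exists>n. interior (F n) \<noteq> {}"
  proof (rule ccontr)
    assume "\<nexists>n. interior (F n) \<noteq> {}"
    then have "euclidean interior_of \<Union>(range F) = {}"
      using cl by (intro Baire_category_alt)
        (auto simp: completely_metrizable_space_euclidean)
    then show False using un by simp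
  qed
  then obtain n x where "x \<in> interior (F n)" by blast
  then obtain r where r: "r > 0" "cball x r \<subseteq> F n"
    by (meson mem_interior_cball)
  have "norm (T i) \<le> 2 * real n / r" if i: "i \<in> I" for i
  proof (rule norm_blinfun_bound)
    show "0 \<le> 2 * real n / r" using r by simp
    fix y :: 'a
    show "norm (T i y) \<le> 2 * real n / r * norm y"
    proof (cases "y = 0")
      case False
      define z where "z = (r / norm y) *\<^sub>R y"
      \<comment> \<open>\<open>z\<close> has norm \<open>r\<close>, so \<open>T i z\<close> is a
        difference of two values bounded by \<open>n\<close>; this is the factor 2 in the
        bound.\<close>
      have "x + z \<in> F n" "x \<in> F n" using r False by (auto simp: z_def dist_norm subset_iff)
      then have "norm (T i (x + z)) \<le> n" "norm (T i x) \<le> n" using i by (auto simp: F_def)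
      then have "norm (T i z) \<le> 2 * n"
        using norm_triangle_ineq4[of "T i (x + z)" "T i x"] by (simp add: blinfun.add_right)
      then show ?thesis using r False
        by (simp add: z_def blinfun.scaleR_right field_simps)
    qed simp
  qed
  then show ?thesis by blast
qed

text \<open>Uniform boundedness is applied to the evaluations \<open>J x\<close> on the dual, which
  is complete whether or not the space is. A norming functional of \<open>x\<close> shows that
  passing from \<open>x\<close> to \<open>J x\<close> does not decrease the norm.\<close>

lemma weakly_bounded_imp_bounded:
  fixes X :: "'a::real_normed_vector set"
  assumes "\<And>f :: 'a \<Rightarrow> real. bounded_linear f \<Longrightarrow> \<exists>c. \<forall>x\<in>X. \<bar>f x\<bar> \<le> c"
  shows "\<exists>c. \<forall>x\<in>X. norm x \<le> c"
proof -
  define J :: "'a \<Rightarrow> ('a \<Rightarrow>\<^sub>L real) \<Rightarrow>\<^sub>L real" where "J x = Blinfun (\<lambda>f. blinfun_apply f x)" for x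
  have J: "J x f = f x" for x f
    unfolding J_def by (simp add: bounded_linear_Blinfun_apply blinfun.bounded_linear_left)
  have "\<exists>c. \<forall>x\<in>X. norm (J x f) \<le> c" for f
    using assms[OF blinfun.bounded_linear_right[of f]] by (simp add: J)
  then obtain M where M: "\<And>x. x \<in> X \<Longrightarrow> norm (J x) \<le> M"
    using uniform_boundedness[of X J] by blast
  have "norm x \<le> M" if x: "x \<in> X" for x
  proof -
    obtain f where f: "bounded_linear f" "\<And>y. \<bar>f y\<bar> \<le> norm y" "f x = norm x"
      using norming_functional by blast
    have "norm (Blinfun f) \<le> 1"
      using f by (intro norm_blinfun_bound) (auto simp: bounded_linear_Blinfun_apply)
    moreover have "norm (J x (Blinfun f)) = norm x"
      using f by (simp add: J bounded_linear_Blinfun_apply)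
    ultimately have "norm x \<le> norm (J x) * 1"
      by (metis norm_blinfun mult_left_mono norm_ge_zero order_trans)
    then show ?thesis using M[OF x] by simp
  qed
  then show ?thesis by blast
qed

section \<open>Idempotents and fragmentability\<close>

lemma compactin_fip:
  assumes K: "compactin X K"
    and cl: "\<And>C. C \<in> \<C> \<Longrightarrow> closedin X C"
    and fip: "\<And>\<F>. finite \<F> \<Longrightarrow> \<F> \<subseteq> \<C> \<Longrightarrow> K \<inter> \<Inter>\<F> \<noteq> {}"
  shows "K \<inter> \<Inter>\<C> \<noteq> {}"
proof
  assume e: "K \<inter> \<Inter>\<C> = {}"
  have "K \<subseteq> \<Union>((\<lambda>C. topspace X - C) ` \<C>)"
    using e compactin_subset_topspace[OF K] by blast
  moreover have "openin X U" if "U \<in> (\<lambda>C. topspace X - C) ` \<C>" for U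
    using that cl by blast
  ultimately obtain \<F> where F: "finite \<F>" "\<F> \<subseteq> (\<lambda>C. topspace X - C) ` \<C>" "K \<subseteq> \<Union>\<F>"
    using K unfolding compactin_def by meson
  then obtain \<G> where "finite \<G>" "\<G> \<subseteq> \<C>" "\<F> = (\<lambda>C. topspace X - C) ` \<G>"
    using finite_subset_image by metis
  then show False using fip[of \<G>] F(3) by blast
qed

text \<open>Cluster points stand in for limits of subsequences, which a compact set in a general
  topological space need not provide.\<close>

lemma compactin_sequence_cluster:
  assumes K: "compactin X K" and x: "\<And>n :: nat. x n \<in> K"
  obtains z where "z \<in> K" "\<And>V n. openin X V \<Longrightarrow> z \<in> V \<Longrightarrow> \<exists>k\<ge>n. x k \<in> V"
proof -
  let ?C = "range (\<lambda>n. X closure_of (x ` {n..}))"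
  have top: "x n \<in> topspace X" for n using x compactin_subset_topspace[OF K] by blast
  have "K \<inter> \<Inter>?C \<noteq> {}"
  proof (rule compactin_fip[OF K])
    fix \<F> assume "finite \<F>" "\<F> \<subseteq> ?C"
    then obtain N where N: "finite N" "\<F> = (\<lambda>n. X closure_of (x ` {n..})) ` N"
      by (meson finite_subset_image)
    have "x (Max N) \<in> X closure_of (x ` {n..})" if "n \<in> N" for n
    proof -
      have "Max N \<in> {n..}" using that N by simp
      then have "x (Max N) \<in> x ` {n..}" by blast
      then show ?thesis using closure_of_subset[of "x ` {n..}" X] top by blast
    qed
    then show "K \<inter> \<Inter>\<F> \<noteq> {}" using x N by blast
  qed auto
  then obtain z where z: "z \<in> K" "\<And>n. z \<in> X closure_of (x ` {n..})" by blast
  show ?thesis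
  proof (rule that[OF z(1)])
    fix V n assume "openin X V" "z \<in> V"
    then obtain y where "y \<in> x ` {n..}" "y \<in> V" using z(2)[of n] unfolding in_closure_of by blast
    then show "\<exists>k\<ge>n. x k \<in> V" by auto
  qed
qed

text \<open>Let \<open>C\<close> be a minimal closed subsemigroup and \<open>x\<close> one of its
  points. Continuity of right multiplication makes \<open>C x\<close> a closed subsemigroup of
  \<open>C\<close>, so \<open>C x = C\<close> and some \<open>y\<close> satisfies
  \<open>y x = x\<close>. The set of all such \<open>y\<close> is again a closed subsemigroup, hence
  all of \<open>C\<close>, and it contains \<open>x\<close>.\<close>

lemma Ellis_idempotent:
  assumes H: "Hausdorff_space X" and T: "compactin X T" "T \<noteq> {}"
    and closed: "\<And>u v. u \<in> T \<Longrightarrow> v \<in> T \<Longrightarrow> m u v \<in> T"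
    and assoc: "\<And>u v w. m (m u v) w = m u (m v w)"
    and cont: "\<And>v. v \<in> T \<Longrightarrow> continuous_map X X (\<lambda>u. m u v)"
  obtains f where "f \<in> T" "m f f = f"
proof -
  define A where "A = {C. closedin X C \<and> C \<noteq> {} \<and> C \<subseteq> T \<and> (\<forall>u\<in>C. \<forall>v\<in>C. m u v \<in> C)}"
  have TA: "T \<in> A" using T closed compactin_imp_closedin[OF H T(1)] by (auto simp: A_def)
  have "\<exists>C\<in>A. \<forall>D\<in>A. D \<subseteq> C \<longrightarrow> D = C"
  proof (rule predicate_Zorn)
    show "partial_order_on A (relation_of (\<lambda>C D. D \<subseteq> C) A)"
      by (rule partial_order_on_relation_ofI) auto
  next
    fix \<C> assume C: "\<C> \<in> Chains (relation_of (\<lambda>C D. D \<subseteq> C) A)"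
    have CA: "C \<in> A" if "C \<in> \<C>" for C
      using C that unfolding Chains_def relation_of_def by auto
    have lin: "C \<subseteq> D \<or> D \<subseteq> C" if "C \<in> \<C>" "D \<in> \<C>" for C D
      using C that unfolding Chains_def relation_of_def by auto
    show "\<exists>D\<in>A. \<forall>C\<in>\<C>. D \<subseteq> C"
    proof (cases "\<C> = {}")
      case True
      then show ?thesis using TA by blast
    next
      case False
      have fin: "\<exists>D\<in>\<C>. D \<subseteq> \<Inter>\<F>" if "finite \<F>" "\<F> \<subseteq> \<C>" for \<F>
        using that
      proof (induction \<F> rule: finite_induct)
        case empty
        then show ?case using False by blast
      next
        case (insert C \<F>)
        then obtain D where D: "D \<in> \<C>" "D \<subseteq> \<Inter>\<F>" by blast
        have "C \<in> \<C>" using insert.prems by simp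
        from lin[OF this D(1)] show ?case
        proof
          assume "C \<subseteq> D"
          then show ?thesis using D \<open>C \<in> \<C>\<close> by (intro bexI[of _ C]) auto
        next
          assume "D \<subseteq> C"
          then show ?thesis using D by (intro bexI[of _ D]) auto
        qed
      qed
      have "T \<inter> \<Inter>\<C> \<noteq> {}"
      proof (rule compactin_fip[OF T(1)])
        show "closedin X C" if "C \<in> \<C>" for C using CA[OF that] by (simp add: A_def)
        fix \<F> assume "finite \<F>" "\<F> \<subseteq> \<C>"
        then obtain D where "D \<in> \<C>" "D \<subseteq> \<Inter>\<F>" using fin by blast
        then show "T \<inter> \<Inter>\<F> \<noteq> {}" using CA[of D] unfolding A_def by blast
      qed
      moreover have "closedin X (\<Inter>\<C>)"
        using CA False by (intro closedin_Inter) (simp_all add: A_def)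
      moreover have "\<Inter>\<C> \<subseteq> T" using CA False by (auto simp: A_def)
      moreover have "m u v \<in> \<Inter>\<C>" if "u \<in> \<Inter>\<C>" "v \<in> \<Inter>\<C>" for u v
        using CA that unfolding A_def by blast
      ultimately have "\<Inter>\<C> \<in> A" unfolding A_def by blast
      then show ?thesis by blast
    qed
  qed
  then obtain C where C: "C \<in> A" and min: "\<And>D. D \<in> A \<Longrightarrow> D \<subseteq> C \<Longrightarrow> D = C" by blast
  have clC: "closedin X C" and CT: "C \<subseteq> T" and mC: "\<And>u v. u \<in> C \<Longrightarrow> v \<in> C \<Longrightarrow> m u v \<in> C"
    using C by (auto simp: A_def)
  obtain x where x: "x \<in> C" using C by (auto simp: A_def)
  have xT: "x \<in> T" using x CT by blast
  have "compactin X C" using closed_compactin[OF T(1) CT clC] .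
  then have "compactin X ((\<lambda>u. m u x) ` C)" using cont[OF xT] image_compactin by blast
  then have "closedin X ((\<lambda>u. m u x) ` C)" using H compactin_imp_closedin by blast
  moreover have "m u v \<in> (\<lambda>u. m u x) ` C"
    if uv: "u \<in> (\<lambda>u. m u x) ` C" "v \<in> (\<lambda>u. m u x) ` C" for u v
  proof -
    obtain a b where "a \<in> C" "u = m a x" "b \<in> C" "v = m b x" using uv by blast
    then have "m u v = m (m (m a x) b) x" "m (m a x) b \<in> C" using assoc mC x by simp_all
    then show ?thesis by blast
  qed
  moreover have "(\<lambda>u. m u x) ` C \<subseteq> C" using mC x by blast
  ultimately have "(\<lambda>u. m u x) ` C = C" using x CT by (intro min) (auto simp: A_def)
  then obtain y where y: "y \<in> C" "m y x = x" using x by (metis imageE)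
  have xt: "x \<in> topspace X" using xT compactin_subset_topspace[OF T(1)] by blast
  let ?D = "{u \<in> C. m u x = x}"
  have "closedin X {u \<in> topspace X. m u x \<in> {x}}"
    using cont[OF xT] closedin_Hausdorff_singleton[OF H xt] by (rule closedin_continuous_map_preimage)
  moreover have "?D = C \<inter> {u \<in> topspace X. m u x \<in> {x}}"
    using closedin_subset[OF clC] by auto
  ultimately have "closedin X ?D" using clC by (simp add: closedin_Int)
  then have "?D = C" using y mC CT assoc by (intro min) (auto simp: A_def)
  then have "m x x = x" using x by blast
  then show ?thesis using that xT by blast
qed

section \<open>Countable approximation of spans and the uncountability of branches\<close>

lemma closure_add_closed:
  fixes Q :: "'a::real_normed_vector set"
  assumes add: "\<And>x y. x \<in> Q \<Longrightarrow> y \<in> Q \<Longrightarrow> x + y \<in> Q"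
    and x: "x \<in> closure Q" and y: "y \<in> closure Q"
  shows "x + y \<in> closure Q"
proof -
  obtain a b where a: "\<And>n. a n \<in> Q" "a \<longlonglongrightarrow> x" and b: "\<And>n. b n \<in> Q" "b \<longlonglongrightarrow> y"
    using x y unfolding closure_sequential by blast
  have "(\<lambda>n. a n + b n) \<longlonglongrightarrow> x + y" using a b by (intro tendsto_add)
  then show ?thesis
    unfolding closure_sequential using a b add by (intro exI[of _ "\<lambda>n. a n + b n"]) simp
qed

lemma countable_dense_in_span:
  fixes D :: "'a::real_normed_vector set"
  assumes "countable D"
  obtains Q where "countable Q" "span D \<subseteq> closure Q"
proof -
  \<comment> \<open>Finite rational combinations are coded by lists over a countable type, so their
    set is countable simply as a range.\<close>
  define S where "S l = sum_list (map (\<lambda>(q, n). of_rat q *\<^sub>R from_nat_into (insert 0 D) n) l)"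
    for l :: "(rat \<times> nat) list"
  define Q where "Q = range S"
  have cnt: "countable (insert 0 D)" using assms by simp
  have zero: "0 \<in> Q" unfolding Q_def by (rule image_eqI[of _ _ "[]"]) (auto simp: S_def)
  have single: "of_rat q *\<^sub>R d \<in> Q" if d: "d \<in> D" for q d
    unfolding Q_def
    by (rule image_eqI[of _ _ "[(q, to_nat_on (insert 0 D) d)]"])
      (use d in \<open>simp_all add: S_def from_nat_into_to_nat_on[OF cnt]\<close>)
  have add: "x + y \<in> Q" if "x \<in> Q" "y \<in> Q" for x y
  proof -
    obtain k l where "x = S k" "y = S l"
      using \<open>x \<in> Q\<close> \<open>y \<in> Q\<close> unfolding Q_def by blast
    then show ?thesis unfolding Q_def by (intro image_eqI[of _ _ "k @ l"]) (auto simp: S_def)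
  qed
  have cadd: "x + y \<in> closure Q" if "x \<in> closure Q" "y \<in> closure Q" for x y
    using closure_add_closed[OF add that] .
  have csing: "r *\<^sub>R d \<in> closure Q" if d: "d \<in> D" for r d
    unfolding closure_approachable
  proof (intro allI impI)
    fix e :: real assume e: "0 < e"
    define \<delta> where "\<delta> = e / (norm d + 1)"
    have "\<delta> > 0" using e by (simp add: \<delta>_def add_nonneg_pos)
    then obtain q where q: "r < of_rat q" "of_rat q < r + \<delta>" using of_rat_dense[of r "r + \<delta>"] by auto
    have "dist (of_rat q *\<^sub>R d) (r *\<^sub>R d) = (of_rat q - r) * norm d"
      using q by (simp add: dist_norm flip: scaleR_left_diff_distrib)
    also have "\<dots> \<le> (of_rat q - r) * (norm d + 1)" using q by (intro mult_left_mono) auto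
    also have "\<dots> < \<delta> * (norm d + 1)" using q by (intro mult_strict_right_mono) (auto simp: add_nonneg_pos)
    also have "\<dots> = e" by (simp add: \<delta>_def add_nonneg_eq_0_iff)
    finally show "\<exists>y\<in>Q. dist y (r *\<^sub>R d) < e" using single[OF d] by blast
  qed
  have "x \<in> closure Q" if "x \<in> span D" for x
    using that
  proof (induction rule: span_induct_alt)
    case base
    then show ?case using zero closure_subset by blast
  next
    case (step c x y)
    then show ?case using cadd csing by blast
  qed
  then show ?thesis using that[of Q] by (auto simp: Q_def)
qed

lemma subspace_closure:
  fixes V :: "'a::real_normed_vector set"
  assumes V: "subspace V"
  shows "subspace (closure V)"
proof (rule subspaceI)
  show "0 \<in> closure V" using subspace_0[OF V] closure_subset by blast
next
  fix x y assume "x \<in> closure V" "y \<in> closure V"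
  then show "x + y \<in> closure V" using closure_add_closed[of V x y] subspace_add[OF V] by simp
next
  fix c :: real and x assume "x \<in> closure V"
  then obtain a where a: "\<And>n. a n \<in> V" "a \<longlonglongrightarrow> x" unfolding closure_sequential by blast
  have "(\<lambda>n. c *\<^sub>R a n) \<longlonglongrightarrow> c *\<^sub>R x" using a by (intro tendsto_scaleR tendsto_const)
  then show "c *\<^sub>R x \<in> closure V"
    unfolding closure_sequential using a subspace_scale[OF V]
    by (intro exI[of _ "\<lambda>n. c *\<^sub>R a n"]) simp
qed

text \<open>Cantor's diagonal argument, with \<tau> negating at \<open>g \<sigma>\<close> the value
  of \<sigma> there.\<close>

lemma no_injection_into_countable:
  fixes h :: "(nat \<Rightarrow> bool) \<Rightarrow> 'a"
  assumes "countable Q" "range h \<subseteq> Q"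
  shows "\<not> inj h"
proof
  assume "inj h"
  then have "countable (UNIV :: (nat \<Rightarrow> bool) set)"
    using assms countable_image_inj_on countable_subset by blast
  then obtain g :: "(nat \<Rightarrow> bool) \<Rightarrow> nat" where g: "inj g" unfolding countable_def by blast
  define \<tau> where "\<tau> n \<longleftrightarrow> (\<exists>\<sigma>. g \<sigma> = n \<and> \<not> \<sigma> n)" for n
  have "(\<exists>\<sigma>. g \<sigma> = g \<tau> \<and> \<not> \<sigma> (g \<tau>)) \<longleftrightarrow> \<not> \<tau> (g \<tau>)"
    using injD[OF g] by blast
  then show False using \<tau>_def[of "g \<tau>"] by blast
qed

text \<open>Weakly compact sets are fragmented by the norm. Otherwise points of \<open>Y\<close> indexed by the nodes
  of the binary tree can be chosen such that distinct branches have cluster points at distance at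
  least \<open>c / 3\<close>; but these uncountably many cluster points lie in the closed span of countably many
  vectors.\<close>

lemma weakly_compact_fragmented:
  fixes F :: "'y \<Rightarrow> 'e::real_normed_vector"
  assumes Y: "compactin X Y" "Y \<noteq> {}"
    and cont: "\<And>f :: 'e \<Rightarrow> real. bounded_linear f \<Longrightarrow> continuous_map X euclidean (\<lambda>y. f (F y))"
    and c: "c > 0"
  obtains y U where "y \<in> Y" "openin X U" "y \<in> U" "\<And>z. z \<in> Y \<Longrightarrow> z \<in> U \<Longrightarrow> norm (F z - F y) < c"
proof (rule ccontr)
  assume "\<not> thesis"
  note fragment = that
  then have bad: "\<exists>z. z \<in> Y \<and> z \<in> U \<and> c \<le> norm (F z - F y)"
    if "y \<in> Y" "openin X U" "y \<in> U" for y U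
    using that fragment[of y U] \<open>\<not> thesis\<close> not_less by metis
  define ok where "ok p \<longleftrightarrow> fst p \<in> Y \<and> openin X (snd p) \<and> fst p \<in> snd p" for p :: "'y \<times> 'y set"
  have "\<exists>z f. ok p \<longrightarrow> z \<in> Y \<and> z \<in> snd p \<and> bounded_linear f \<and> (\<forall>x. \<bar>f x\<bar> \<le> norm x) \<and>
      c \<le> f (F (fst p)) - f (F z)" for p
  proof (cases "ok p")
    case True
    then obtain z where z: "z \<in> Y" "z \<in> snd p" "c \<le> norm (F z - F (fst p))"
      using bad unfolding ok_def by blast
    obtain f :: "'e \<Rightarrow> real" where f: "bounded_linear f" "\<And>x. \<bar>f x\<bar> \<le> norm x"
        "f (F (fst p) - F z) = norm (F (fst p) - F z)"
      using norming_functional by blast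
    have "c \<le> f (F (fst p)) - f (F z)"
      using z f bounded_linear.linear[OF f(1)] by (simp add: linear_diff norm_minus_commute)
    then show ?thesis using z f by blast
  qed blast
  then obtain Z \<phi> where Z: "\<And>p. ok p \<Longrightarrow> Z p \<in> Y" "\<And>p. ok p \<Longrightarrow> Z p \<in> snd p"
    and \<phi>: "\<And>p. ok p \<Longrightarrow> bounded_linear (\<phi> p)" "\<And>p x. ok p \<Longrightarrow> \<bar>\<phi> p x\<bar> \<le> norm x"
      "\<And>p. ok p \<Longrightarrow> c \<le> \<phi> p (F (fst p)) - \<phi> p (F (Z p))"
    by metis
  \<comment> \<open>A node is a point with an open neighbourhood. The left branch keeps the point
    and the right one moves to the far point \<open>Z p\<close>; each neighbourhood shrinks so that
    \<phi> loses at most \<open>c/3\<close> of its gap \<open>c\<close> on either side. A gap of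
    \<open>c/3\<close> survives in the limit.\<close>
  define step where "step b p =
    (if b then (fst p, snd p \<inter> {w \<in> topspace X. \<phi> p (F w) \<in> {\<phi> p (F (fst p)) - c/3<..}})
     else (Z p, snd p \<inter> {w \<in> topspace X. \<phi> p (F w) \<in> {..<\<phi> p (F (Z p)) + c/3}}))" for b p
  have top: "y \<in> topspace X" if "y \<in> Y" for y
    using that compactin_subset_topspace[OF Y(1)] by blast
  have open_pre: "openin X {w \<in> topspace X. f (F w) \<in> V}"
    if "bounded_linear f" "open V" for f :: "'e \<Rightarrow> real" and V
    using openin_continuous_map_preimage[OF cont[OF that(1)] open_openin[THEN iffD1, OF that(2)]] .
  have ok_step: "ok (step b p)" if p: "ok p" for b p
    using p Z[OF p] open_pre[OF \<phi>(1)[OF p] open_greaterThan] open_pre[OF \<phi>(1)[OF p] open_lessThan] top c unfolding ok_def step_def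
    by (auto intro!: openin_Int)
  obtain y0 where y0: "y0 \<in> Y" using Y(2) by blast
  define st where "st l = foldr step l (y0, topspace X)" for l
  have st_Cons: "st (b # l) = step b (st l)" for b l by (simp add: st_def)
  have ok_st: "ok (st l)" for l
  proof (induction l)
    case Nil
    then show ?case using y0 top by (simp add: st_def ok_def)
  qed (simp add: st_Cons ok_step)
  \<comment> \<open>Reversed because \<open>foldr\<close> puts the latest choice at the head of the
    list.\<close>
  define pre where "pre \<sigma> n = rev (map \<sigma> [0..<n])" for \<sigma> :: "nat \<Rightarrow> bool" and n
  have pre_Suc: "pre \<sigma> (Suc n) = \<sigma> n # pre \<sigma> n" for \<sigma> n by (simp add: pre_def)
  define x where "x \<sigma> n = fst (st (pre \<sigma> n))" for \<sigma> n
  have xY: "x \<sigma> n \<in> Y" for \<sigma> n using ok_st by (simp add: x_def ok_def)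
  have "snd (st (pre \<sigma> (Suc n))) \<subseteq> snd (st (pre \<sigma> n))" for \<sigma> n
    by (simp add: pre_Suc st_Cons step_def)
  then have "snd (st (pre \<sigma> k)) \<subseteq> snd (st (pre \<sigma> n))" if "n \<le> k" for \<sigma> n k
    using that by (rule lift_Suc_antimono_le)
  moreover have "x \<sigma> k \<in> snd (st (pre \<sigma> k))" for \<sigma> k using ok_st by (simp add: x_def ok_def)
  ultimately have x_in: "x \<sigma> k \<in> snd (st (pre \<sigma> n))" if "n \<le> k" for \<sigma> n k
    using that by (meson subsetD)
  have "\<exists>z. z \<in> Y \<and> (\<forall>V n. openin X V \<longrightarrow> z \<in> V \<longrightarrow> (\<exists>k\<ge>n. x \<sigma> k \<in> V))" for \<sigma>
    using compactin_sequence_cluster[OF Y(1), of "x \<sigma>"] xY by metis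
  then obtain z where zY: "\<And>\<sigma>. z \<sigma> \<in> Y"
    and z: "\<And>\<sigma> V n. openin X V \<Longrightarrow> z \<sigma> \<in> V \<Longrightarrow> \<exists>k\<ge>n. x \<sigma> k \<in> V" by metis
  have z_closed: "f (F (z \<sigma>)) \<in> C"
    if f: "bounded_linear f" and "closed C" and ev: "\<And>k. n \<le> k \<Longrightarrow> f (F (x \<sigma> k)) \<in> C"
    for f :: "'e \<Rightarrow> real" and C n \<sigma>
  proof (rule ccontr)
    assume "f (F (z \<sigma>)) \<notin> C"
    then have "z \<sigma> \<in> {w \<in> topspace X. f (F w) \<in> - C}" using top[OF zY] by simp
    then obtain k where "k \<ge> n" "x \<sigma> k \<in> {w \<in> topspace X. f (F w) \<in> - C}"
      using z[OF open_pre[OF f]] \<open>closed C\<close> by blast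
    then show False using ev by blast
  qed
  define D where "D = range (\<lambda>l. F (fst (st l)))"
  obtain Q where Q: "countable Q" "span D \<subseteq> closure Q"
    using countable_dense_in_span[of D] by (auto simp: D_def)
  have span_D: "F (z \<sigma>) \<in> closure (span D)" for \<sigma>
  proof (rule ccontr)
    assume "F (z \<sigma>) \<notin> closure (span D)"
    then obtain f :: "'e \<Rightarrow> real" where f: "bounded_linear f"
      "\<And>v. v \<in> closure (span D) \<Longrightarrow> f v = 0" "f (F (z \<sigma>)) = 1"
      using functional_vanishing_on_subspace[of "closure (span D)" "F (z \<sigma>)"]
        closed_closure subspace_closure[OF subspace_span[of D]] by blast
    have "f (F (x \<sigma> k)) \<in> {0}" for k
      using f(2)[of "F (x \<sigma> k)"] closure_subset[of "span D"] span_base[of _ D]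
      by (auto simp: D_def x_def)
    then have "f (F (z \<sigma>)) \<in> {0}" by (intro z_closed[OF f(1)]) auto
    then show False using f(3) by simp
  qed
  \<comment> \<open>Two cluster points that share an approximant would then be closer than
    \<open>2 * (c/6)\<close>, which is the separation \<open>c/3\<close>; so distinct branches get
    distinct approximants.\<close>
  have "\<exists>q\<in>Q. dist q (F (z \<sigma>)) < c / 6" for \<sigma>
  proof -
    have "closure (span D) \<subseteq> closure Q" using Q(2) by (simp add: closure_minimal)
    then have "F (z \<sigma>) \<in> closure Q" using span_D by blast
    then show ?thesis using c closure_approachable[THEN iffD1, rule_format, of "F (z \<sigma>)" Q "c / 6"] by simp
  qed
  then obtain h where h: "\<And>\<sigma>. h \<sigma> \<in> Q" "\<And>\<sigma>. dist (h \<sigma>) (F (z \<sigma>)) < c / 6" by metis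
  have sep: "c / 3 \<le> norm (F (z \<sigma>) - F (z \<tau>))"
    if eq: "\<And>m. m < n \<Longrightarrow> \<sigma> m = \<tau> m" and s: "\<sigma> n" and t: "\<not> \<tau> n" for \<sigma> \<tau> n
  proof -
    define p where "p = st (pre \<sigma> n)"
    have "pre \<tau> n = pre \<sigma> n" using eq by (simp add: pre_def)
    then have steps: "st (pre \<sigma> (Suc n)) = step True p" "st (pre \<tau> (Suc n)) = step False p"
      using s t by (simp_all add: pre_Suc st_Cons p_def)
    have p: "ok p" using ok_st by (simp add: p_def)
    have "\<phi> p (F (x \<sigma> k)) \<in> {\<phi> p (F (fst p)) - c/3..}" if "Suc n \<le> k" for k
      using x_in[OF that, of \<sigma>] steps(1) by (simp add: step_def)
    from z_closed[OF \<phi>(1)[OF p] closed_atLeast this]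
    have "\<phi> p (F (z \<sigma>)) \<in> {\<phi> p (F (fst p)) - c/3..}" .
    moreover have "\<phi> p (F (x \<tau> k)) \<in> {..\<phi> p (F (Z p)) + c/3}" if "Suc n \<le> k" for k
      using x_in[OF that, of \<tau>] steps(2) by (simp add: step_def)
    from z_closed[OF \<phi>(1)[OF p] closed_atMost this]
    have "\<phi> p (F (z \<tau>)) \<in> {..\<phi> p (F (Z p)) + c/3}" .
    ultimately have "c / 3 \<le> \<phi> p (F (z \<sigma>)) - \<phi> p (F (z \<tau>))" using \<phi>(3)[OF p] by simp
    also have "\<dots> = \<phi> p (F (z \<sigma>) - F (z \<tau>))"
      using bounded_linear.linear[OF \<phi>(1)[OF p]] by (simp add: linear_diff)
    also have "\<dots> \<le> norm (F (z \<sigma>) - F (z \<tau>))" using \<phi>(2)[OF p, of "F (z \<sigma>) - F (z \<tau>)"] by simp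
    finally show ?thesis .
  qed
  have "inj h"
  proof (rule injI, rule ccontr)
    fix \<sigma> \<tau> assume eq: "h \<sigma> = h \<tau>" and "\<sigma> \<noteq> \<tau>"
    then have ex: "\<exists>n. \<sigma> n \<noteq> \<tau> n" by blast
    define n where "n = (LEAST n. \<sigma> n \<noteq> \<tau> n)"
    have n: "\<sigma> n \<noteq> \<tau> n" "\<And>m. m < n \<Longrightarrow> \<sigma> m = \<tau> m"
      unfolding n_def using LeastI_ex[OF ex] not_less_Least by blast+
    have "c / 3 \<le> norm (F (z \<sigma>) - F (z \<tau>))"
      using sep[of n \<sigma> \<tau>] sep[of n \<tau> \<sigma>] n by (auto simp: norm_minus_commute)
    moreover have "norm (F (z \<sigma>) - F (z \<tau>)) < c / 6 + c / 6"
    proof -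
      have "dist (F (z \<sigma>)) (F (z \<tau>)) \<le> dist (h \<sigma>) (F (z \<sigma>)) + dist (h \<sigma>) (F (z \<tau>))"
        by (metis dist_commute dist_triangle)
      then show ?thesis using h(2)[of \<sigma>] h(2)[of \<tau>] eq by (simp add: dist_norm)
    qed
    ultimately show False by simp
  qed
  then show False using no_injection_into_countable[OF Q(1), of h] h(1) by blast
qed

section \<open>The weak operator topology\<close>

lemma topspace_WOT [simp]:
  "topspace weak_operator_topology = (clinear_operators :: ('e::complex_banach \<Rightarrow>\<^sub>L 'e) set)"
proof -
  have "(\<lambda>_. 0) \<in> (clinear_functionals :: ('e \<Rightarrow> complex) set)"
    by (simp add: clinear_functionals_def)
  then have "\<exists>x \<phi> U. clinear_operators = {T \<in> clinear_operators. \<phi> (blinfun_apply T x) \<in> U} \<and>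
      \<phi> \<in> (clinear_functionals :: ('e \<Rightarrow> complex) set) \<and> open U"
    by (intro exI[of _ 0] exI[of _ "\<lambda>_. 0"] exI[of _ UNIV]) auto
  then have "(clinear_operators :: ('e \<Rightarrow>\<^sub>L 'e) set) \<subseteq>
      \<Union>{{T \<in> clinear_operators. \<phi> (blinfun_apply T x) \<in> U} | x \<phi> U. \<phi> \<in> clinear_functionals \<and> open U}"
    by blast
  then show ?thesis
    unfolding weak_operator_topology_def topology_generated_by_topspace by blast
qed

lemma continuous_map_WOT_eval:
  fixes \<phi> :: "'e::complex_banach \<Rightarrow> complex"
  assumes "\<phi> \<in> clinear_functionals"
  shows "continuous_map weak_operator_topology euclidean (\<lambda>T. \<phi> (blinfun_apply T x))"
unfolding continuous_map_def
proof (intro conjI allI impI)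
  fix U :: "complex set" assume "openin euclidean U"
  then have "open U" by (simp)
  then show "openin weak_operator_topology
      {T \<in> topspace weak_operator_topology. \<phi> (blinfun_apply T x) \<in> U}"
    using assms unfolding topspace_WOT
    by (subst weak_operator_topology_def) (rule topology_generated_by_Basis, blast)
qed simp

lemma continuous_map_into_WOT:
  fixes f :: "'a \<Rightarrow> 'e::complex_banach \<Rightarrow>\<^sub>L 'e"
  assumes "\<And>y. y \<in> topspace X \<Longrightarrow> f y \<in> clinear_operators"
    and "\<And>x \<phi>. \<phi> \<in> clinear_functionals \<Longrightarrow>
      continuous_map X euclidean (\<lambda>y. \<phi> (blinfun_apply (f y) x))"
  shows "continuous_map X weak_operator_topology f"
  unfolding weak_operator_topology_def
proof (rule continuous_on_generated_topo)
  fix V :: "('e \<Rightarrow>\<^sub>L 'e) set"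
  assume "V \<in> {{T \<in> clinear_operators. \<phi> (blinfun_apply T x) \<in> U} | x \<phi> U.
      \<phi> \<in> clinear_functionals \<and> open U}"
  then obtain x \<phi> U where V: "V = {T \<in> clinear_operators. \<phi> (blinfun_apply T x) \<in> U}"
    "\<phi> \<in> clinear_functionals" "open U" by blast
  have "f -` V \<inter> topspace X = {y \<in> topspace X. \<phi> (blinfun_apply (f y) x) \<in> U}"
    using V assms(1) by auto
  then show "openin X (f -` V \<inter> topspace X)"
    using openin_continuous_map_preimage[OF assms(2)[OF V(2)]] V(3) by (simp)
next
  show "f ` topspace X \<subseteq> \<Union>{{T \<in> clinear_operators. \<phi> (blinfun_apply T x) \<in> U} | x \<phi> U.
      \<phi> \<in> clinear_functionals \<and> open U}"
    using assms(1) topspace_WOT unfolding weak_operator_topology_def topology_generated_by_topspace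
    by blast
qed

lemma clinear_functional_compose:
  "\<phi> \<in> clinear_functionals \<Longrightarrow> u \<in> clinear_operators \<Longrightarrow>
    (\<lambda>x. \<phi> (blinfun_apply u x)) \<in> clinear_functionals"
  unfolding clinear_functionals_def clinear_operators_def
  by (auto intro: bounded_linear_compose blinfun.bounded_linear_right)

lemma clinear_operators_compose:
  "u \<in> clinear_operators \<Longrightarrow> v \<in> clinear_operators \<Longrightarrow> u o\<^sub>L v \<in> clinear_operators"
  by (simp add: clinear_operators_def)

text \<open>A functional composed with \<open>u\<close> is again a complex functional, so the
  generating sets pull back to generating sets.\<close>

lemma continuous_map_WOT_left:
  "u \<in> clinear_operators \<Longrightarrow>
    continuous_map weak_operator_topology weak_operator_topology (\<lambda>T. u o\<^sub>L T)"
  by (rule continuous_map_into_WOT)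
    (simp_all add: clinear_operators_compose continuous_map_WOT_eval[OF clinear_functional_compose])

lemma continuous_map_WOT_right:
  "u \<in> clinear_operators \<Longrightarrow>
    continuous_map weak_operator_topology weak_operator_topology (\<lambda>T. T o\<^sub>L u)"
  by (rule continuous_map_into_WOT) (simp_all add: clinear_operators_compose continuous_map_WOT_eval)

text \<open>The functional is \<open>f x - \<i> f (\<i> x)\<close>. It lets everything proved with
  real functionals be used in the topologies generated by complex ones.\<close>

lemma complexify_functional:
  fixes f :: "'e::complex_banach \<Rightarrow> real"
  assumes "bounded_linear f"
  obtains \<phi> where "\<phi> \<in> clinear_functionals" "\<And>x. Re (\<phi> x) = f x"
proof -
  interpret f: bounded_linear f by (rule assms)
  define \<phi> where "\<phi> x = Complex (f x) (- f (\<i> *\<^sub>C x))" for x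
  have scR: "\<i> *\<^sub>C r *\<^sub>R x = r *\<^sub>R \<i> *\<^sub>C x" for r and x :: 'e
    by (metis mult.commute scaleC_of_real scaleC_scaleC)
  have cx: "c *\<^sub>C x = Re c *\<^sub>R x + Im c *\<^sub>R \<i> *\<^sub>C x" for c and x :: 'e
  proof -
    have "c = of_real (Re c) + of_real (Im c) * \<i>" by (simp add: complex_eq_iff)
    then show ?thesis by (metis scaleC_add_left scaleC_of_real scaleC_scaleC)
  qed
  have ii: "\<i> *\<^sub>C \<i> *\<^sub>C x = - x" for x :: 'e
    using scaleC_of_real[of "-1" x] by (simp add: scaleC_scaleC)
  obtain B where B: "\<And>x. norm (f x) \<le> norm x * B" "B \<ge> 0" using f.nonneg_bounded by blast
  have "bounded_linear \<phi>"
  proof (rule bounded_linear_intro[of _ "2 * B"])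
    fix x
    have "norm (\<phi> x) \<le> norm (f x) + norm (f (\<i> *\<^sub>C x))"
      using cmod_le[of "\<phi> x"] by (simp add: \<phi>_def)
    also have "\<dots> \<le> norm x * B + norm x * B"
      using B(1)[of x] B(1)[of "\<i> *\<^sub>C x"] by (intro add_mono) (simp_all add: norm_scaleC)
    finally show "norm (\<phi> x) \<le> norm x * (2 * B)" by (simp add: mult_ac)
  qed (simp_all add: \<phi>_def complex_eq_iff f.add f.scaleR scaleC_add_right scR)
  moreover have "\<phi> (c *\<^sub>C x) = c * \<phi> x" for c x
  proof -
    have "\<i> *\<^sub>C c *\<^sub>C x = Re c *\<^sub>R \<i> *\<^sub>C x - Im c *\<^sub>R x"
      by (subst cx) (simp add: scaleC_add_right scR ii)
    then have "f (\<i> *\<^sub>C c *\<^sub>C x) = Re c * f (\<i> *\<^sub>C x) - Im c * f x"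
      by (simp add: f.diff f.scaleR)
    moreover have "f (c *\<^sub>C x) = Re c * f x + Im c * f (\<i> *\<^sub>C x)"
      by (subst cx) (simp add: f.add f.scaleR)
    ultimately show ?thesis by (simp add: \<phi>_def complex_eq_iff)
  qed
  ultimately have "\<phi> \<in> clinear_functionals" by (simp add: clinear_functionals_def)
  moreover have "Re (\<phi> x) = f x" for x by (simp add: \<phi>_def)
  ultimately show ?thesis using that by blast
qed

lemma continuous_map_WOT_eval_real:
  fixes f :: "'e::complex_banach \<Rightarrow> real"
  assumes "bounded_linear f"
  shows "continuous_map weak_operator_topology euclidean (\<lambda>T. f (blinfun_apply T x))"
proof -
  obtain \<phi> where \<phi>: "\<phi> \<in> clinear_functionals" "\<And>x. Re (\<phi> x) = f x"
    using complexify_functional[OF assms] by blast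
  have "continuous_map weak_operator_topology euclidean (Re \<circ> (\<lambda>T. \<phi> (blinfun_apply T x)))"
    using \<phi>(1) by (intro continuous_map_compose[OF continuous_map_WOT_eval])
      (auto intro: continuous_intros)
  then show ?thesis by (simp add: o_def \<phi>(2))
qed

lemma openin_WOT_real:
  fixes f :: "'e::complex_banach \<Rightarrow> real"
  assumes "bounded_linear f" "open V"
  shows "openin weak_operator_topology {T \<in> clinear_operators. f (blinfun_apply T x) \<in> V}"
  using openin_continuous_map_preimage[OF continuous_map_WOT_eval_real[OF assms(1)], of V x] assms(2)
  by (simp)

lemma Hausdorff_WOT: "Hausdorff_space weak_operator_topology"
  unfolding Hausdorff_space_def topspace_WOT
proof (intro allI impI)
  fix S T :: "'e::complex_banach \<Rightarrow>\<^sub>L 'e"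
  assume ST: "S \<in> clinear_operators \<and> T \<in> clinear_operators \<and> S \<noteq> T"
  then obtain x where "S x \<noteq> T x" using blinfun_eqI by blast
  then obtain f :: "'e \<Rightarrow> real" where f: "bounded_linear f" "f (S x) \<noteq> f (T x)"
    using functionals_separate by blast
  obtain U V where UV: "open U" "open V" "f (S x) \<in> U" "f (T x) \<in> V" "U \<inter> V = {}"
    using hausdorff[OF f(2)] by blast
  show "\<exists>U V. openin weak_operator_topology U \<and> openin weak_operator_topology V \<and>
      S \<in> U \<and> T \<in> V \<and> disjnt U V"
    using ST UV openin_WOT_real[OF f(1), of U x] openin_WOT_real[OF f(1), of V x]
    by (intro exI[of _ "{T \<in> clinear_operators. f (blinfun_apply T x) \<in> U}"]
        exI[of _ "{T \<in> clinear_operators. f (blinfun_apply T x) \<in> V}"]) (auto simp: disjnt_def)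
qed

text \<open>Uniform boundedness enters twice: on the dual, turning weakly bounded orbits into norm
  bounded ones, and then for the operators themselves.\<close>

lemma WOT_compact_bounded:
  fixes K :: "('e::complex_banach \<Rightarrow>\<^sub>L 'e) set"
  assumes K: "compactin weak_operator_topology K"
  shows "\<exists>M. \<forall>u\<in>K. norm u \<le> M"
proof -
  have "\<exists>c. \<forall>u\<in>K. norm (blinfun_apply u x) \<le> c" for x
  proof -
    have "\<exists>c. \<forall>y\<in>(\<lambda>u. blinfun_apply u x) ` K. \<bar>f y\<bar> \<le> c" if f: "bounded_linear f" for f :: "'e \<Rightarrow> real"
    proof -
      have "compact ((\<lambda>u. f (blinfun_apply u x)) ` K)"
        using image_compactin[OF K continuous_map_WOT_eval_real[OF f]] by simp
      then have "bounded ((\<lambda>u. f (blinfun_apply u x)) ` K)" by (rule compact_imp_bounded)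
      then show ?thesis by (auto simp: bounded_iff)
    qed
    then show ?thesis using weakly_bounded_imp_bounded[of "(\<lambda>u. blinfun_apply u x) ` K"] by auto
  qed
  then show ?thesis using uniform_boundedness[of K "\<lambda>u. u"] by simp
qed

lemma blinfun_compose_assoc: "(u o\<^sub>L v) o\<^sub>L w = u o\<^sub>L (v o\<^sub>L w)"
  by (rule blinfun_eqI) simp

section \<open>The weak topology on vectors\<close>

lemma continuous_map_WOT_weak:
  fixes x :: "'e::complex_banach"
  shows "continuous_map weak_operator_topology weak_topology (\<lambda>T. blinfun_apply T x)"
  unfolding weak_topology_def
proof (rule continuous_on_generated_topo)
  fix V :: "'e set"
  assume "V \<in> {{x. \<phi> x \<in> U} | \<phi> U. \<phi> \<in> clinear_functionals \<and> open U}"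
  then obtain \<phi> U where V: "V = {x. \<phi> x \<in> U}" "\<phi> \<in> clinear_functionals" "open U" by blast
  have "(\<lambda>T. blinfun_apply T x) -` V \<inter> topspace weak_operator_topology =
      {T \<in> topspace weak_operator_topology. \<phi> (blinfun_apply T x) \<in> U}"
    using V(1) by auto
  then show "openin weak_operator_topology
      ((\<lambda>T. blinfun_apply T x) -` V \<inter> topspace weak_operator_topology)"
    using openin_continuous_map_preimage[OF continuous_map_WOT_eval[OF V(2)], of U x] V(3) by simp
next
  have "(\<lambda>_. 0) \<in> (clinear_functionals :: ('e \<Rightarrow> complex) set)"
    by (simp add: clinear_functionals_def)
  then have "\<exists>\<phi> U. UNIV = {x. \<phi> x \<in> U} \<and> \<phi> \<in> (clinear_functionals :: ('e \<Rightarrow> complex) set) \<and> open U"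
    by (intro exI[of _ "\<lambda>_. 0"] exI[of _ UNIV]) auto
  then have "UNIV \<in> {{x. \<phi> x \<in> U} | \<phi> U. \<phi> \<in> (clinear_functionals :: ('e \<Rightarrow> complex) set) \<and> open U}"
    by blast
  then show "(\<lambda>T. blinfun_apply T x) ` topspace weak_operator_topology \<subseteq>
      \<Union>{{x. \<phi> x \<in> U} | \<phi> U. \<phi> \<in> (clinear_functionals :: ('e \<Rightarrow> complex) set) \<and> open U}"
    by blast
qed

lemma openin_weak_real:
  fixes f :: "'e::complex_banach \<Rightarrow> real"
  assumes "bounded_linear f" "open V"
  shows "openin weak_topology {x. f x \<in> V}"
proof -
  obtain \<phi> where \<phi>: "\<phi> \<in> clinear_functionals" "\<And>x. Re (\<phi> x) = f x"
    using complexify_functional[OF assms(1)] by blast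
  have "open (Re -` V)" using assms(2) by (intro open_vimage continuous_intros)
  moreover have "{x. f x \<in> V} = {x. \<phi> x \<in> Re -` V}" by (simp add: \<phi>(2))
  ultimately show ?thesis
    using \<phi>(1) unfolding weak_topology_def by (intro topology_generated_by_Basis) blast
qed

section \<open>The structure of the enveloping semigroup\<close>

locale JdLG_representation =
  fixes \<pi> :: "'s::semigroup_mult \<Rightarrow> ('e::complex_banach \<Rightarrow>\<^sub>L 'e)"
  assumes rep: "representation \<pi>" and adm: "JdLG_admissible \<pi>"
begin

abbreviation WOT :: "('e \<Rightarrow>\<^sub>L 'e) topology" where "WOT \<equiv> weak_operator_topology"

abbreviation SS :: "('e \<Rightarrow>\<^sub>L 'e) set" where "SS \<equiv> enveloping_semigroup \<pi>"

lemma rep_mult: "\<pi> (s * t) = \<pi> s o\<^sub>L \<pi> t"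
  using rep by (simp add: representation_def)

lemma rep_clinear: "\<pi> s \<in> clinear_operators"
  using rep by (auto simp: representation_def)

lemma SS_compact: "compactin WOT SS"
  using adm by (simp add: JdLG_admissible_def)

lemma SS_clinear: "u \<in> SS \<Longrightarrow> u \<in> clinear_operators"
  using compactin_subset_topspace[OF SS_compact] by auto

lemma rep_in_SS: "\<pi> s \<in> SS"
  unfolding enveloping_semigroup_def
  using closure_of_subset[of "range \<pi>" WOT] rep_clinear by auto

lemma SS_closed: "closedin WOT SS"
  by (simp add: enveloping_semigroup_def)

lemma WOT_closure_image:
  assumes f: "continuous_map WOT WOT f" and C: "closedin WOT C" and A: "f ` A \<subseteq> C"
    and u: "u \<in> WOT closure_of A"
  shows "f u \<in> C"
proof -
  have "f u \<in> WOT closure_of (f ` A)" using continuous_map_image_closure_subset[OF f] u by blast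
  then show ?thesis using closure_of_minimal[OF A C] by blast
qed

text \<open>The two factors pass to the limit one after the other: first the right one with
  \<open>\<pi> s\<close> fixed on the left, then the left one with \<open>v\<close> fixed on the
  right.\<close>

lemma SS_compose: "u o\<^sub>L v \<in> SS" if u: "u \<in> SS" and v: "v \<in> SS"
proof -
  have 1: "\<pi> s o\<^sub>L w \<in> SS" if "w \<in> WOT closure_of (range \<pi>)" for s w
    using rep_in_SS
    by (intro WOT_closure_image[OF continuous_map_WOT_left[OF rep_clinear] SS_closed _ that])
      (auto simp flip: rep_mult)
  show ?thesis
  proof (rule WOT_closure_image[OF continuous_map_WOT_right[OF SS_clinear[OF v]] SS_closed])
    show "u \<in> WOT closure_of (range \<pi>)" using u by (simp add: enveloping_semigroup_def)
    show "(\<lambda>u. u o\<^sub>L v) ` range \<pi> \<subseteq> SS" using 1 v by (auto simp: enveloping_semigroup_def)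
  qed
qed

lemma SS_bounded: obtains M where "M \<ge> 0" "\<And>u. u \<in> SS \<Longrightarrow> norm u \<le> M"
proof -
  obtain M where M: "\<And>u. u \<in> SS \<Longrightarrow> norm u \<le> M" using WOT_compact_bounded[OF SS_compact] by blast
  then have "0 \<le> M" using norm_ge_zero order_trans rep_in_SS by blast
  then show ?thesis using M that by blast
qed

lemma closure_approximation:
  assumes "u \<in> WOT closure_of (\<pi> ` A)" "openin WOT U" "u \<in> U"
  obtains s where "s \<in> A" "\<pi> s \<in> U"
  using assms unfolding in_closure_of by blast

definition e :: "'e \<Rightarrow>\<^sub>L 'e" where "e = (THE u. minimal_idempotent SS u)"

lemma ex1_minimal_idempotent: "\<exists>!u. minimal_idempotent SS u"
  using adm by (simp add: JdLG_admissible_def)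

lemma e_minimal: "minimal_idempotent SS e"
  unfolding e_def by (rule theI'[OF ex1_minimal_idempotent])

lemma e_unique: "minimal_idempotent SS u \<Longrightarrow> u = e"
  by (metis e_minimal ex1_minimal_idempotent)

definition K :: "('e \<Rightarrow>\<^sub>L 'e) set" where "K = (SOME K. smallest_ideal SS K \<and> e \<in> K)"

lemma K: "smallest_ideal SS K" "e \<in> K"
  using someI_ex[of "\<lambda>K. smallest_ideal SS K \<and> e \<in> K"] e_minimal
  unfolding K_def minimal_idempotent_def by auto

lemma K_left: "u \<in> SS \<Longrightarrow> k \<in> K \<Longrightarrow> u o\<^sub>L k \<in> K"
  and K_right: "u \<in> SS \<Longrightarrow> k \<in> K \<Longrightarrow> k o\<^sub>L u \<in> K"
  and K_SS: "k \<in> K \<Longrightarrow> k \<in> SS"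
  using K(1) by (auto simp: smallest_ideal_def two_sided_ideal_def)

text \<open>The form in which uniqueness of the minimal idempotent is exploited: to identify an
  operator with \<open>e\<close>, show that it is idempotent and lies in \<open>K\<close>.\<close>

lemma K_idem: "k \<in> K \<Longrightarrow> k o\<^sub>L k = k \<Longrightarrow> k = e"
  using K(1) by (intro e_unique) (auto simp: minimal_idempotent_def)

lemma e_SS: "e \<in> SS" and ee: "e o\<^sub>L e = e"
  using K(2) K_SS e_minimal by (auto simp: minimal_idempotent_def)

lemma e_clinear: "e \<in> clinear_operators"
  using e_SS SS_clinear by blast

section \<open>Quotients, centrality of the minimal idempotent and the resulting group\<close>

lemma idempotent_in_subsemigroup:
  assumes T: "compactin WOT T" "T \<noteq> {}" "T \<subseteq> SS" and cl: "\<And>u v. u \<in> T \<Longrightarrow> v \<in> T \<Longrightarrow> u o\<^sub>L v \<in> T"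
  obtains f where "f \<in> T" "f o\<^sub>L f = f"
proof (rule Ellis_idempotent[OF Hausdorff_WOT T(1,2), of "(o\<^sub>L)"])
  show "continuous_map WOT WOT (\<lambda>u. u o\<^sub>L v)" if "v \<in> T" for v
    using that T(3) by (intro continuous_map_WOT_right SS_clinear) blast
qed (use cl that in \<open>auto simp: blinfun_compose_assoc\<close>)

text \<open>The left ideal generated by \<open>e u\<close> is a compact subsemigroup contained in
  \<open>K\<close>. Its idempotent can only be \<open>e\<close>, and so \<open>e\<close> is a left
  multiple of \<open>u\<close>. The right-hand version is the mirror image, with a right
  ideal.\<close>

lemma ex_left_quotient: "\<exists>v\<in>SS. v o\<^sub>L u = e" if u: "u \<in> SS"
proof -
  define k where "k = e o\<^sub>L u"
  have k: "k \<in> K" "k \<in> SS" using K(2) K_right u K_SS by (auto simp: k_def)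
  let ?T = "(\<lambda>w. w o\<^sub>L k) ` SS"
  have "compactin WOT ?T"
    using image_compactin[OF SS_compact continuous_map_WOT_right[OF SS_clinear[OF k(2)]]] .
  moreover have "a o\<^sub>L b \<in> ?T" if ab: "a \<in> ?T" "b \<in> ?T" for a b
  proof -
    obtain x y where "x \<in> SS" "a = x o\<^sub>L k" "y \<in> SS" "b = y o\<^sub>L k" using ab by blast
    then have "a o\<^sub>L b = (x o\<^sub>L k o\<^sub>L y) o\<^sub>L k" "x o\<^sub>L k o\<^sub>L y \<in> SS"
      using k SS_compose by (simp_all add: blinfun_compose_assoc)
    then show ?thesis by blast
  qed
  moreover have "?T \<subseteq> SS" "?T \<noteq> {}" using SS_compose k e_SS by auto
  ultimately obtain f where f: "f \<in> ?T" "f o\<^sub>L f = f" using idempotent_in_subsemigroup by metis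
  then obtain w where w: "w \<in> SS" "f = w o\<^sub>L k" by blast
  then have "f \<in> K" using K_left k by blast
  then have "f = e" using f(2) by (rule K_idem)
  then have "(w o\<^sub>L e) o\<^sub>L u = e" using w(2) by (simp add: k_def blinfun_compose_assoc)
  then show ?thesis using SS_compose w e_SS by blast
qed

lemma ex_right_quotient: "\<exists>v\<in>SS. u o\<^sub>L v = e" if u: "u \<in> SS"
proof -
  define k where "k = u o\<^sub>L e"
  have k: "k \<in> K" "k \<in> SS" using K(2) K_left u K_SS by (auto simp: k_def)
  let ?T = "(\<lambda>w. k o\<^sub>L w) ` SS"
  have "compactin WOT ?T"
    using image_compactin[OF SS_compact continuous_map_WOT_left[OF SS_clinear[OF k(2)]]] .
  moreover have "a o\<^sub>L b \<in> ?T" if ab: "a \<in> ?T" "b \<in> ?T" for a b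
  proof -
    obtain x y where "x \<in> SS" "a = k o\<^sub>L x" "y \<in> SS" "b = k o\<^sub>L y" using ab by blast
    then have "a o\<^sub>L b = k o\<^sub>L (x o\<^sub>L k o\<^sub>L y)" "x o\<^sub>L k o\<^sub>L y \<in> SS"
      using k SS_compose by (simp_all add: blinfun_compose_assoc)
    then show ?thesis by blast
  qed
  moreover have "?T \<subseteq> SS" "?T \<noteq> {}" using SS_compose k e_SS by auto
  ultimately obtain f where f: "f \<in> ?T" "f o\<^sub>L f = f" using idempotent_in_subsemigroup by metis
  then obtain w where w: "w \<in> SS" "f = k o\<^sub>L w" by blast
  then have "f \<in> K" using K_right k by blast
  then have "f = e" using f(2) by (rule K_idem)
  then have "u o\<^sub>L (e o\<^sub>L w) = e" using w(2) by (simp add: k_def blinfun_compose_assoc)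
  then show ?thesis using SS_compose w e_SS by blast
qed

text \<open>Let \<open>y\<close> be the inverse of \<open>e u e\<close> with respect to the identity
  \<open>e\<close>. Then \<open>y u\<close> and \<open>u y\<close> are idempotents in
  \<open>K\<close>, so both equal \<open>e\<close>, and \<open>e u = u y u = u e\<close>.\<close>

lemma e_central: "e o\<^sub>L u = u o\<^sub>L e" if u: "u \<in> SS"
proof -
  note [simp] = blinfun_compose_assoc
  have ee': "e o\<^sub>L (e o\<^sub>L w) = e o\<^sub>L w" for w by (metis blinfun_compose_assoc ee)
  obtain v where v: "v \<in> SS" "v o\<^sub>L (e o\<^sub>L (u o\<^sub>L e)) = e"
    using ex_left_quotient SS_compose e_SS u by metis
  obtain w where w: "w \<in> SS" "(e o\<^sub>L (u o\<^sub>L e)) o\<^sub>L w = e"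
    using ex_right_quotient SS_compose e_SS u by metis
  define y where "y = e o\<^sub>L (v o\<^sub>L e)"
  have y: "y \<in> K" "y o\<^sub>L e = y" "e o\<^sub>L y = y" "y o\<^sub>L (u o\<^sub>L e) = e"
    using K_left K_right v e_SS K(2) ee' ee by (auto simp: y_def)
  have "y = y o\<^sub>L (e o\<^sub>L (u o\<^sub>L (e o\<^sub>L w)))" using w(2) y(2) by simp
  also have "\<dots> = (y o\<^sub>L e) o\<^sub>L (u o\<^sub>L (e o\<^sub>L w))" by simp
  also have "\<dots> = (y o\<^sub>L (u o\<^sub>L e)) o\<^sub>L w" unfolding y(2) by simp
  finally have yw: "y = e o\<^sub>L w" unfolding y(4) .
  have uy: "e o\<^sub>L (u o\<^sub>L y) = e" unfolding yw using w(2) by simp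
  have "(y o\<^sub>L u) o\<^sub>L (y o\<^sub>L u) = (y o\<^sub>L (u o\<^sub>L e)) o\<^sub>L (y o\<^sub>L u)"
    using y(3) by (metis blinfun_compose_assoc)
  then have "(y o\<^sub>L u) o\<^sub>L (y o\<^sub>L u) = y o\<^sub>L u"
    unfolding y(4) using y(3) by (metis blinfun_compose_assoc)
  then have yu: "y o\<^sub>L u = e" using y(1) K_right u K_idem by blast
  have "(u o\<^sub>L y) o\<^sub>L (u o\<^sub>L y) = u o\<^sub>L y"
    using yu y(2) y(3) by (metis blinfun_compose_assoc)
  then have uy': "u o\<^sub>L y = e" using y(1) K_left u K_idem by blast
  have "e o\<^sub>L u = (u o\<^sub>L y) o\<^sub>L u" unfolding uy' ..
  also have "\<dots> = u o\<^sub>L e" using yu by simp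
  finally show ?thesis .
qed

text \<open>Hence \<open>e\<close> times the enveloping semigroup is a group with identity \<open>e\<close>.\<close>

lemma ex_inverse:
  assumes u: "u \<in> SS"
  obtains v where "v \<in> SS" "v o\<^sub>L u = e" "u o\<^sub>L v = e" "e o\<^sub>L v = v"
proof -
  obtain v w where v: "v \<in> SS" "v o\<^sub>L u = e" and w: "w \<in> SS" "u o\<^sub>L w = e"
    using ex_left_quotient ex_right_quotient u by meson
  \<comment> \<open>Both sides equal \<open>v u w\<close>: a left and a right inverse agree after
    multiplication by \<open>e\<close>.\<close>
  have eq: "e o\<^sub>L v = e o\<^sub>L w"
    by (metis blinfun_compose_assoc e_central v w)
  show ?thesis
  proof (rule that)
    show "e o\<^sub>L v \<in> SS" using SS_compose e_SS v by blast
    show "(e o\<^sub>L v) o\<^sub>L u = e" using v ee by (simp add: blinfun_compose_assoc)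
    show "u o\<^sub>L (e o\<^sub>L v) = e" unfolding eq by (metis blinfun_compose_assoc e_central ee u w(2))
    show "e o\<^sub>L (e o\<^sub>L v) = e o\<^sub>L v" by (metis blinfun_compose_assoc ee)
  qed
qed

lemma e_apply_commute: "u \<in> SS \<Longrightarrow> e (u x) = u (e x)"
  using e_central by (metis blinfun_apply_blinfun_compose)

lemma E_r_iff: "\<xi> \<in> E_r \<pi> \<longleftrightarrow> e \<xi> = \<xi>"
proof
  assume "\<xi> \<in> E_r \<pi>"
  then obtain v where "v \<in> SS" "v (e \<xi>) = \<xi>" using e_SS by (auto simp: E_r_def)
  then show "e \<xi> = \<xi>" by (metis blinfun_apply_blinfun_compose e_apply_commute ee)
next
  assume e: "e \<xi> = \<xi>"
  show "\<xi> \<in> E_r \<pi>"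
    unfolding E_r_def
  proof (intro CollectI ballI)
    fix u assume "u \<in> SS"
    then obtain v where "v \<in> SS" "v o\<^sub>L u = e" using ex_left_quotient by blast
    then show "\<exists>v\<in>SS. v (u \<xi>) = \<xi>" using e by (metis blinfun_apply_blinfun_compose)
  qed
qed

lemma E_aws_iff: "\<xi> \<in> E_aws \<pi> \<longleftrightarrow> e \<xi> = 0"
proof
  assume "\<xi> \<in> E_aws \<pi>"
  then obtain u where u: "u \<in> SS" "u \<xi> = 0" by (auto simp: E_aws_def)
  then obtain v where "v o\<^sub>L u = e" using ex_left_quotient by blast
  then have "e \<xi> = v (u \<xi>)" by (metis blinfun_apply_blinfun_compose)
  then show "e \<xi> = 0" using u by (simp add: blinfun.zero_right)
qed (use e_SS in \<open>auto simp: E_aws_def\<close>)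

text \<open>Centrality makes \<open>f e\<close> an idempotent in \<open>K\<close>. Consequently an
  idempotent found anywhere in the enveloping semigroup fixes the range of \<open>e\<close>, so
  approximating it is as good as approximating \<open>e\<close> there.\<close>

lemma idempotent_e:
  assumes f: "f \<in> SS" "f o\<^sub>L f = f"
  shows "f o\<^sub>L e = e"
proof (rule K_idem)
  show "f o\<^sub>L e \<in> K" using K_left f K(2) by blast
  have "(f o\<^sub>L e) o\<^sub>L (f o\<^sub>L e) = f o\<^sub>L ((e o\<^sub>L f) o\<^sub>L e)" by (simp add: blinfun_compose_assoc)
  also have "\<dots> = (f o\<^sub>L f) o\<^sub>L (e o\<^sub>L e)" unfolding e_central[OF f(1)] by (simp add: blinfun_compose_assoc)
  finally show "(f o\<^sub>L e) o\<^sub>L (f o\<^sub>L e) = f o\<^sub>L e" by (simp add: f ee)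
qed

text \<open>The orbit map of a reversible vector has a point of almost norm continuity by fragmentability;
  the group structure moves this point to \<open>e\<close>.\<close>

lemma reversible_strongly_continuous:
  assumes \<xi>: "e \<xi> = \<xi>" and \<epsilon>: "\<epsilon> > 0"
  obtains U where "openin WOT U" "e \<in> U" "\<And>u. u \<in> SS \<Longrightarrow> u o\<^sub>L e \<in> U \<Longrightarrow> norm (u \<xi> - \<xi>) < \<epsilon>"
proof -
  obtain M where M: "M \<ge> 0" "\<And>u. u \<in> SS \<Longrightarrow> norm u \<le> M" using SS_bounded by blast
  \<comment> \<open>The estimate near \<open>g\<close> is carried back to \<xi> by an operator of
    norm at most \<open>M\<close>; the summand 1 keeps the denominator positive.\<close>
  define c where "c = \<epsilon> / (M + 1)"
  have c: "c > 0" using \<epsilon> M by (simp add: c_def)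
  let ?Y = "(\<lambda>u. u o\<^sub>L e) ` SS"
  have Y: "compactin WOT ?Y" "?Y \<noteq> {}"
    using image_compactin[OF SS_compact continuous_map_WOT_right[OF e_clinear]] e_SS by auto
  obtain g V where g: "g \<in> ?Y" and V: "openin WOT V" "g \<in> V"
    and near: "\<And>z. z \<in> ?Y \<Longrightarrow> z \<in> V \<Longrightarrow> norm (blinfun_apply z \<xi> - g \<xi>) < c"
    using weakly_compact_fragmented[OF Y, of "\<lambda>u. blinfun_apply u \<xi>" c] c continuous_map_WOT_eval_real
    by metis
  have gSS: "g \<in> SS" and ge: "g o\<^sub>L e = g" using g SS_compose e_SS by (auto simp: blinfun_compose_assoc ee)
  obtain v where v: "v \<in> SS" "v o\<^sub>L g = e" using ex_left_quotient[OF gSS] by blast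
  define U where "U = {T \<in> clinear_operators. g o\<^sub>L T \<in> V}"
  have "openin WOT U"
    using openin_continuous_map_preimage[OF continuous_map_WOT_left[OF SS_clinear[OF gSS]] V(1)]
    by (simp add: U_def)
  moreover have "e \<in> U" using e_clinear ge V by (simp add: U_def)
  moreover have "norm (u \<xi> - \<xi>) < \<epsilon>" if u: "u \<in> SS" "u o\<^sub>L e \<in> U" for u
  proof -
    have "(g o\<^sub>L u) o\<^sub>L e \<in> ?Y" using SS_compose gSS u by blast
    moreover have "(g o\<^sub>L u) o\<^sub>L e \<in> V" using u by (simp add: U_def blinfun_compose_assoc)
    ultimately have "norm (((g o\<^sub>L u) o\<^sub>L e) \<xi> - g \<xi>) < c" by (rule near)
    then have lt: "norm (g (u \<xi>) - g \<xi>) < c" using \<xi> by simp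
    have "v (g (u \<xi>) - g \<xi>) = e (u \<xi>) - e \<xi>"
      using v(2) by (metis blinfun.diff_right blinfun_apply_blinfun_compose)
    then have "v (g (u \<xi>) - g \<xi>) = u \<xi> - \<xi>" using \<xi> e_apply_commute u by simp
    then have "norm (u \<xi> - \<xi>) \<le> norm v * norm (g (u \<xi>) - g \<xi>)" by (metis norm_blinfun)
    also have "\<dots> \<le> (M + 1) * norm (g (u \<xi>) - g \<xi>)" using M(2)[OF v(1)] by (intro mult_right_mono) auto
    also have "\<dots> < (M + 1) * c" using lt M by (intro mult_strict_left_mono) auto
    also have "\<dots> = \<epsilon>" using M by (simp add: c_def)
    finally show ?thesis .
  qed
  ultimately show ?thesis using that by blast
qed

end

section \<open>IP-sets and piecewise syndetic sets\<close>

lemma list_product_append: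
  "xs \<noteq> [] \<Longrightarrow> ys \<noteq> [] \<Longrightarrow> list_product (xs @ ys) = list_product xs * list_product ys"
proof (induction xs rule: list_product.induct)
  case (2 s)
  then show ?case by (cases ys) auto
next
  case (3 s t ss)
  then show ?case by (simp add: mult.assoc)
qed simp

definition set_product :: "(nat \<Rightarrow> 's::semigroup_mult) \<Rightarrow> nat set \<Rightarrow> 's" where
  "set_product s F = list_product (map s (sorted_list_of_set F))"

lemma set_product_singleton [simp]: "set_product s {n} = s n"
  by (simp add: set_product_def)

lemma set_product_Un:
  assumes F: "finite F" "F \<noteq> {}" and G: "finite G" "G \<noteq> {}"
    and less: "\<And>a b. a \<in> F \<Longrightarrow> b \<in> G \<Longrightarrow> a < b"
  shows "set_product s (F \<union> G) = set_product s F * set_product s G"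
proof -
  have "F \<inter> G = {}" using less by blast
  then have "sorted_list_of_set (F \<union> G) = sorted_list_of_set F @ sorted_list_of_set G"
    using F G less
    by (intro sorted_distinct_set_unique) (auto simp: sorted_append intro: less_imp_le)
  then show ?thesis using F G by (simp add: set_product_def list_product_append)
qed

lemma IP_set_iff: "IP_set A \<longleftrightarrow> (\<exists>s. \<forall>F. finite F \<and> F \<noteq> {} \<longrightarrow> set_product s F \<in> A)"
  by (simp add: IP_set_def set_product_def)

section \<open>Large sets of return times, for reversible and for almost weakly stable
  vectors\<close>

context JdLG_representation
begin

lemma openin_left: "openin WOT U \<Longrightarrow> u \<in> SS \<Longrightarrow> openin WOT {T \<in> clinear_operators. u o\<^sub>L T \<in> U}"
  using openin_continuous_map_preimage[OF continuous_map_WOT_left[OF SS_clinear]] by fastforce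

lemma openin_right: "openin WOT U \<Longrightarrow> u \<in> SS \<Longrightarrow> openin WOT {T \<in> clinear_operators. T o\<^sub>L u \<in> U}"
  using openin_continuous_map_preimage[OF continuous_map_WOT_right[OF SS_clinear]] by fastforce

lemma enveloping_approximation:
  assumes "u \<in> SS" "openin WOT U" "u \<in> U"
  obtains s where "\<pi> s \<in> U"
  using closure_approximation[of u UNIV U] assms unfolding enveloping_semigroup_def by auto

text \<open>The closures \<open>T n\<close> of the products with indices from \<open>n\<close> on
  intersect in a compact subsemigroup. An idempotent \<open>f\<close> in it satisfies
  \<open>f e = e\<close>, so some finite product \<open>t\<close> brings
  \<open>\<pi> t o\<^sub>L e\<close> into the neighbourhood of \<open>e\<close> on which the orbit
  map is norm close to \<xi>.\<close>

lemma reversible_IP_star: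
  assumes \<xi>: "e \<xi> = \<xi>" and \<epsilon>: "\<epsilon> > 0"
  shows "IP_star {s. norm (\<xi> - \<pi> s \<xi>) < \<epsilon>}"
  unfolding IP_star_def
proof (intro allI impI)
  fix B :: "'s set" assume "IP_set B"
  then obtain s where s: "\<And>F. finite F \<Longrightarrow> F \<noteq> {} \<Longrightarrow> set_product s F \<in> B"
    unfolding IP_set_iff by blast
  define P where "P n = {set_product s F | F. finite F \<and> F \<noteq> {} \<and> F \<subseteq> {n..}}" for n
  define T where "T n = WOT closure_of (\<pi> ` P n)" for n
  have PT: "\<pi> ` P n \<subseteq> T n" for n
    unfolding T_def using rep_clinear by (intro closure_of_subset) auto
  have Tc: "closedin WOT (T n)" for n by (simp add: T_def)
  have TSS: "T n \<subseteq> SS" for n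
    unfolding T_def enveloping_semigroup_def by (intro closure_of_mono) auto
  \<comment> \<open>A finite product over \<open>F\<close> may be followed only by products with
    indices beyond \<open>Max F\<close>. This is harmless because \<open>v\<close> lies in all tail
    closures; the left factor passes to the limit afterwards.\<close>
  have mult_a: "\<pi> a o\<^sub>L v \<in> T n" if a: "a \<in> P n" and v: "v \<in> (\<Inter>n. T n)" for a v n
  proof -
    obtain F where F: "a = set_product s F" "finite F" "F \<noteq> {}" "F \<subseteq> {n..}"
      using a by (auto simp: P_def)
    let ?m = "Suc (Max F)"
    have "a * b \<in> P n" if b: "b \<in> P ?m" for b
    proof -
      obtain G where G: "b = set_product s G" "finite G" "G \<noteq> {}" "G \<subseteq> {?m..}"
        using b by (auto simp: P_def)
      have "x < y" if "x \<in> F" "y \<in> G" for x y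
        using that G(4) Max_ge[OF F(2), of x] by fastforce
      then have "set_product s (F \<union> G) = a * b"
        unfolding F(1) G(1) by (intro set_product_Un F G)
      moreover have "n \<le> Max F" using Max_in[OF F(2,3)] F(4) by auto
      then have "F \<union> G \<subseteq> {n..}" using F(4) G(4) by auto
      ultimately show ?thesis using F G unfolding P_def by (metis (mono_tags, lifting) mem_Collect_eq finite_UnI sup_eq_bot_iff)
    qed
    then have "(\<lambda>T. \<pi> a o\<^sub>L T) ` \<pi> ` P ?m \<subseteq> T n" using PT[of n] by (auto simp flip: rep_mult)
    moreover have "v \<in> WOT closure_of (\<pi> ` P ?m)" using v by (auto simp: T_def)
    ultimately show ?thesis
      using WOT_closure_image[OF continuous_map_WOT_left[OF rep_clinear] Tc] by blast
  qed
  have "u o\<^sub>L v \<in> T n" if u: "u \<in> (\<Inter>n. T n)" and v: "v \<in> (\<Inter>n. T n)" for u v n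
  proof (rule WOT_closure_image[OF continuous_map_WOT_right Tc])
    show "v \<in> clinear_operators" using v TSS SS_clinear by blast
    show "(\<lambda>T. T o\<^sub>L v) ` \<pi> ` P n \<subseteq> T n" using mult_a v by blast
    show "u \<in> WOT closure_of (\<pi> ` P n)" using u by (auto simp: T_def)
  qed
  then have "u o\<^sub>L v \<in> (\<Inter>n. T n)" if "u \<in> (\<Inter>n. T n)" "v \<in> (\<Inter>n. T n)" for u v
    using that by blast
  moreover have "compactin WOT (\<Inter>n. T n)"
  proof (rule closed_compactin[OF SS_compact])
    show "(\<Inter>n. T n) \<subseteq> SS" using TSS by blast
    show "closedin WOT (\<Inter>n. T n)" using Tc by blast
  qed
  moreover obtain z where z: "z \<in> SS"
    "\<And>V n. openin WOT V \<Longrightarrow> z \<in> V \<Longrightarrow> \<exists>k\<ge>n. \<pi> (s k) \<in> V"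
    using compactin_sequence_cluster[OF SS_compact, of "\<lambda>n. \<pi> (s n)"] rep_in_SS by metis
  have "z \<in> T n" for n
    unfolding T_def in_closure_of
  proof (intro conjI allI impI)
    show "z \<in> topspace WOT" using z SS_clinear by simp
    fix V assume "z \<in> V \<and> openin WOT V"
    then obtain k where k: "k \<ge> n" "\<pi> (s k) \<in> V" using z(2) by blast
    have "s k \<in> P n" unfolding P_def using k(1) by (intro CollectI exI[of _ "{k}"]) simp
    then show "\<exists>y. y \<in> \<pi> ` P n \<and> y \<in> V" using k(2) by blast
  qed
  then have "(\<Inter>n. T n) \<noteq> {}" by blast
  moreover have "(\<Inter>n. T n) \<subseteq> SS" using TSS by blast
  ultimately obtain f where f: "f \<in> (\<Inter>n. T n)" "f o\<^sub>L f = f"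
    using idempotent_in_subsemigroup by metis
  have "f \<in> SS" using f TSS by blast
  then have fe: "f o\<^sub>L e = e" using f(2) by (rule idempotent_e)
  obtain U where U: "openin WOT U" "e \<in> U"
    and near: "\<And>u. u \<in> SS \<Longrightarrow> u o\<^sub>L e \<in> U \<Longrightarrow> norm (u \<xi> - \<xi>) < \<epsilon>"
    using reversible_strongly_continuous[OF \<xi> \<epsilon>] by blast
  have "f \<in> WOT closure_of (\<pi> ` P 0)" using f(1) by (auto simp: T_def)
  moreover have "f \<in> {T \<in> clinear_operators. T o\<^sub>L e \<in> U}"
    using fe U \<open>f \<in> SS\<close> SS_clinear by auto
  ultimately obtain t where t: "t \<in> P 0" "\<pi> t o\<^sub>L e \<in> U"
    using closure_approximation[OF _ openin_right[OF U(1) e_SS]] by blast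
  have "t \<in> B" using t(1) s by (auto simp: P_def)
  moreover have "norm (\<xi> - \<pi> t \<xi>) < \<epsilon>" using near[OF rep_in_SS t(2)] by (simp add: norm_minus_commute)
  ultimately show "{s. norm (\<xi> - \<pi> s \<xi>) < \<epsilon>} \<inter> B \<noteq> {}" by blast
qed

text \<open>The list holds the chosen elements newest first, so its head has the largest index and
  is multiplied on the right.\<close>

fun finite_products :: "'s list \<Rightarrow> 's set" where
  "finite_products [] = {}"
| "finite_products (t # l) = insert t (finite_products l \<union> (\<lambda>a. a * t) ` finite_products l)"

lemma finite_finite_products: "finite (finite_products l)"
  by (induction l) auto

text \<open>The sequence is chosen greedily: all products formed so far lie in an open set
  \<open>W\<close> around \<open>e\<close>, and the next element is taken with
  \<open>\<pi> t\<close> so close to \<open>e\<close> that appending it does not leave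
  \<open>W\<close>.\<close>

lemma IP_set_neighborhood:
  assumes U: "openin WOT U" "e \<in> U"
  shows "IP_set {s. \<pi> s \<in> U}"
proof -
  \<comment> \<open>The second condition makes \<open>W\<close> stable under right multiplication by
    \<open>e\<close>. So \<open>e\<close> itself is always an admissible limit for the next choice,
    as in Galvin's proof of Hindman's theorem.\<close>
  define W where "W = U \<inter> {T \<in> clinear_operators. T o\<^sub>L e \<in> U}"
  have W: "openin WOT W" "e \<in> W"
    using U openin_right[OF U(1) e_SS] e_clinear ee by (auto simp: W_def)
  have We: "u o\<^sub>L e \<in> W" if "u \<in> W" for u
    using that clinear_operators_compose e_clinear by (auto simp: W_def blinfun_compose_assoc ee)
  define good where "good l \<longleftrightarrow> (\<forall>a\<in>finite_products l. \<pi> a \<in> W)" for l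
  have "\<exists>t. good (t # l)" if l: "good l" for l
  proof -
    define V where "V = W \<inter> ((\<Inter>a\<in>finite_products l. {T \<in> clinear_operators. \<pi> a o\<^sub>L T \<in> W})
      \<inter> topspace WOT)"
    have "openin WOT V"
      unfolding V_def using W(1) openin_left[OF W(1) rep_in_SS] finite_finite_products
      by (intro openin_Int openin_INT) auto
    moreover have "e \<in> V" using W(2) We l e_clinear by (auto simp: V_def good_def)
    ultimately obtain t where "\<pi> t \<in> V" using enveloping_approximation[OF e_SS] by blast
    then have "good (t # l)" using l by (auto simp: V_def good_def rep_mult)
    then show ?thesis ..
  qed
  then obtain nxt where nxt: "\<And>l. good l \<Longrightarrow> good (nxt l # l)" by metis
  define hist where "hist = rec_nat [] (\<lambda>_ l. nxt l # l)"
  have hist: "hist 0 = []" "hist (Suc n) = nxt (hist n) # hist n" for n by (simp_all add: hist_def)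
  have good: "good (hist n)" for n
    by (induction n) (simp_all add: hist nxt, simp add: good_def)
  define s where "s n = nxt (hist n)" for n
  have prods: "set_product s F \<in> finite_products (hist n)"
    if "F \<noteq> {}" "F \<subseteq> {..<n}" for F n
    using that
  proof (induction n arbitrary: F)
    case (Suc n)
    define G where "G = F - {n}"
    have G: "G \<subseteq> {..<n}" using Suc.prems by (auto simp: G_def less_Suc_eq)
    consider "n \<notin> F" | "F = {n}" | "n \<in> F" "G \<noteq> {}" using G_def by blast
    then show ?case
    proof cases
      case 1
      then show ?thesis using Suc.IH[of F] Suc.prems G by (simp add: G_def hist)
    next
      case 2
      then show ?thesis by (simp add: hist s_def)
    next
      case 3
      have "set_product s (G \<union> {n}) = set_product s G * set_product s {n}"
        using G 3 finite_subset[OF G] by (intro set_product_Un) auto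
      moreover have "F = G \<union> {n}" using 3 by (auto simp: G_def)
      ultimately have "set_product s F = set_product s G * nxt (hist n)" by (simp add: s_def)
      then show ?thesis using Suc.IH[OF 3(2) G] unfolding hist(2) by simp
    qed
  qed simp
  have "set_product s F \<in> {s. \<pi> s \<in> U}" if F: "finite F" "F \<noteq> {}" for F
  proof -
    have "F \<subseteq> {..<Suc (Max F)}" using F(1) by (auto simp: less_Suc_eq_le)
    then have "set_product s F \<in> finite_products (hist (Suc (Max F)))" by (rule prods[OF F(2)])
    then show ?thesis using good by (auto simp: good_def W_def)
  qed
  then show ?thesis unfolding IP_set_iff by blast
qed

text \<open>The set where \<open>f (\<pi> s \<xi>)\<close> is near \<open>f (e \<xi>)\<close> is an
  IP-set, so it meets the set where \<open>\<pi> s \<xi>\<close> is near \<xi> in norm. At a common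
  point \<open>f (e \<xi>)\<close> and \<open>f \<xi>\<close> are close.\<close>

lemma IP_star_imp_reversible:
  assumes IP: "\<And>\<epsilon>. \<epsilon> > 0 \<Longrightarrow> IP_star {s. norm (\<xi> - \<pi> s \<xi>) < \<epsilon>}"
  shows "e \<xi> = \<xi>"
proof (rule functionals_separate)
  fix f :: "'e \<Rightarrow> real" assume f: "bounded_linear f"
  then interpret f: bounded_linear f .
  obtain B where B: "B > 0" "\<And>x. norm (f x) \<le> norm x * B" using f.pos_bounded by blast
  have "\<bar>f (e \<xi>) - f \<xi>\<bar> \<le> 0 + \<delta>" if \<delta>: "\<delta> > 0" for \<delta>
  proof -
    let ?U = "{T \<in> clinear_operators. f (blinfun_apply T \<xi>) \<in> ball (f (e \<xi>)) (\<delta>/2)}"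
    have "IP_set {s. \<pi> s \<in> ?U}"
      using \<delta> e_clinear by (intro IP_set_neighborhood openin_WOT_real f) auto
    moreover have "IP_star {s. norm (\<xi> - \<pi> s \<xi>) < \<delta> / (2 * B)}" using \<delta> B by (intro IP) simp
    ultimately obtain s where s: "\<pi> s \<in> ?U" "norm (\<xi> - \<pi> s \<xi>) < \<delta> / (2 * B)"
      unfolding IP_star_def by blast
    have "\<bar>f \<xi> - f (\<pi> s \<xi>)\<bar> \<le> norm (\<xi> - \<pi> s \<xi>) * B" using B(2)[of "\<xi> - \<pi> s \<xi>"] by (simp add: f.diff)
    also have "\<dots> \<le> \<delta> / 2" using s(2) B(1) by (simp add: field_simps)
    finally have "\<bar>f \<xi> - f (\<pi> s \<xi>)\<bar> \<le> \<delta> / 2" .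
    moreover have "\<bar>f (e \<xi>) - f (\<pi> s \<xi>)\<bar> < \<delta> / 2" using s(1) by (simp add: dist_real_def)
    ultimately show ?thesis by linarith
  qed
  then have "\<bar>f (e \<xi>) - f \<xi>\<bar> \<le> 0" by (rule field_le_epsilon)
  then show "f (e \<xi>) = f \<xi>" by simp
qed

lemma aws_thickly_syndetic:
  assumes \<xi>: "e \<xi> = 0" and U: "openin weak_topology U" "0 \<in> U"
  shows "thickly_syndetic {s. \<pi> s \<xi> \<in> U}"
  unfolding thickly_syndetic_def
proof (intro allI impI)
  fix B :: "'s set" assume "piecewise_syndetic B"
  then obtain H where H: "finite H \<and> H \<noteq> {} \<and> (\<forall>\<F>. finite \<F> \<and>
      \<F> \<subseteq> range (\<lambda>y. left_quotient y (\<Union>h\<in>H. left_quotient h B)) \<longrightarrow> \<Inter>\<F> \<noteq> {})"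
    unfolding piecewise_syndetic_def ..
  then have fip: "\<And>\<F>. finite \<F> \<Longrightarrow>
      \<F> \<subseteq> range (\<lambda>y. left_quotient y (\<Union>h\<in>H. left_quotient h B)) \<Longrightarrow> \<Inter>\<F> \<noteq> {}"
    by simp
  define T where "T = WOT closure_of (\<pi> ` B)"
  have T: "closedin WOT T" by (simp add: T_def)
  have BT: "\<pi> ` B \<subseteq> T" unfolding T_def using rep_clinear by (intro closure_of_subset) auto
  define C where "C y = (\<Union>h\<in>H. {u \<in> topspace WOT. \<pi> (h * y) o\<^sub>L u \<in> T})" for y
  have "SS \<inter> \<Inter>(range C) \<noteq> {}"
  proof (rule compactin_fip[OF SS_compact])
    fix D assume "D \<in> range C"
    then show "closedin WOT D"
      unfolding C_def using H T
      by (auto intro!: closedin_Union closedin_continuous_map_preimage[OF continuous_map_WOT_left] rep_clinear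
          simp del: topspace_WOT)
  next
    fix \<F> assume "finite \<F>" "\<F> \<subseteq> range C"
    then obtain Y where Y: "finite Y" "\<F> = C ` Y" by (meson finite_subset_image)
    let ?q = "\<lambda>y. left_quotient y (\<Union>h\<in>H. left_quotient h B)"
    have "\<Inter>(?q ` Y) \<noteq> {}" using Y(1) by (intro fip) auto
    then obtain x where x: "\<And>y. y \<in> Y \<Longrightarrow> \<exists>h\<in>H. h * (y * x) \<in> B"
      by (auto simp: left_quotient_def)
    have "\<pi> x \<in> C y" if y: "y \<in> Y" for y
    proof -
      obtain h where h: "h \<in> H" "h * (y * x) \<in> B" using x[OF y] by blast
      then have "\<pi> (h * y) o\<^sub>L \<pi> x \<in> T" using BT by (auto simp: mult.assoc simp flip: rep_mult)
      then show ?thesis using h(1) rep_clinear by (auto simp: C_def)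
    qed
    then show "SS \<inter> \<Inter>\<F> \<noteq> {}" using rep_in_SS Y(2) by blast
  qed
  then obtain u where u: "u \<in> SS" "\<And>y. u \<in> C y" by blast
  \<comment> \<open>Finiteness of \<open>H\<close> keeps this union closed, so the statement about
    each \<open>\<pi> y\<close> extends to all \<open>w\<close> in \<open>SS\<close>, although
    \<open>h\<close> may vary with \<open>w\<close>.\<close>
  define D where "D = (\<Union>h\<in>H. {w \<in> topspace WOT. (\<pi> h o\<^sub>L w) o\<^sub>L u \<in> T})"
  have "closedin WOT D"
  proof -
    have "closedin WOT {w \<in> topspace WOT. (\<pi> h o\<^sub>L w) o\<^sub>L u \<in> T}" for h
      using continuous_map_compose[OF continuous_map_WOT_left[OF rep_clinear[of h]]
          continuous_map_WOT_right[OF SS_clinear[OF u(1)]]] T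
      by (intro closedin_continuous_map_preimage) (auto simp: o_def)
    then show ?thesis unfolding D_def using H by (intro closedin_Union) auto
  qed
  moreover have "range \<pi> \<subseteq> D"
    using u(2) rep_clinear unfolding C_def D_def by (force simp: rep_mult)
  ultimately have SSD: "SS \<subseteq> D" unfolding enveloping_semigroup_def by (intro closure_of_minimal)
  obtain w where w: "w \<in> SS" "w o\<^sub>L u = e" using ex_left_quotient[OF u(1)] by blast
  then obtain h where h: "\<pi> h o\<^sub>L e \<in> T" using SSD unfolding D_def by (auto simp: blinfun_compose_assoc)
  have "openin WOT {T \<in> topspace WOT. blinfun_apply T \<xi> \<in> U}"
    by (rule openin_continuous_map_preimage[OF continuous_map_WOT_weak U(1)])
  moreover have "\<pi> h o\<^sub>L e \<in> {T \<in> topspace WOT. blinfun_apply T \<xi> \<in> U}"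
    using U(2) \<xi> rep_clinear e_clinear by (simp add: clinear_operators_compose blinfun.zero_right)
  ultimately obtain s where "s \<in> B" "\<pi> s \<xi> \<in> U" using closure_approximation h unfolding T_def by blast
  then show "{s. \<pi> s \<xi> \<in> U} \<inter> B \<noteq> {}" by blast
qed

text \<open>Every \<open>g\<close> in the compact group has a left inverse that is approximated by
  some \<open>\<pi> h\<close>, so finitely many of the sets \<open>?N h\<close> cover the group;
  these \<open>h\<close> form \<open>H\<close>. Given finitely many \<open>y\<close>, a single
  \<open>\<pi> x\<close> close enough to \<open>e\<close> then works for all of them.\<close>

lemma piecewise_syndetic_neighborhood:
  assumes U: "openin WOT U" "e \<in> U"
  shows "piecewise_syndetic {s. \<pi> s \<in> U}"
proof -
  let ?Y = "(\<lambda>u. u o\<^sub>L e) ` SS"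
  let ?N = "\<lambda>h. {g \<in> clinear_operators. \<pi> h o\<^sub>L g \<in> U}"
  have Y: "compactin WOT ?Y"
    using image_compactin[OF SS_compact continuous_map_WOT_right[OF e_clinear]] .
  have "?Y \<subseteq> \<Union>(range ?N)"
  proof
    fix g assume "g \<in> ?Y"
    then have g: "g \<in> SS" using SS_compose e_SS by blast
    then obtain v where v: "v \<in> SS" "v o\<^sub>L g = e" using ex_left_quotient by blast
    have "v \<in> {T \<in> clinear_operators. T o\<^sub>L g \<in> U}" using v U(2) SS_clinear by simp
    then obtain h where "\<pi> h o\<^sub>L g \<in> U" using enveloping_approximation[OF v(1) openin_right[OF U(1) g]] by blast
    then show "g \<in> \<Union>(range ?N)" using SS_clinear[OF g] by blast
  qed
  moreover have "\<And>V. V \<in> range ?N \<Longrightarrow> openin WOT V" using openin_left[OF U(1) rep_in_SS] by blast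
  ultimately obtain \<V> where V: "finite \<V>" "\<V> \<subseteq> range ?N" "?Y \<subseteq> \<Union>\<V>"
    using Y unfolding compactin_def by meson
  obtain H where "finite H" "\<V> = ?N ` H" using finite_subset_image[OF V(1,2)] by blast
  then have H: "finite H" "?Y \<subseteq> \<Union>(?N ` H)" using V(3) by simp_all
  have "H \<noteq> {}" using H(2) e_SS by blast
  have fip: "\<Inter>\<F> \<noteq> {}" if "finite \<F>"
    "\<F> \<subseteq> range (\<lambda>y. left_quotient y (\<Union>h\<in>H. left_quotient h {s. \<pi> s \<in> U}))" for \<F>
  proof -
    obtain Y0 where Y0: "finite Y0" "\<F> = (\<lambda>y. left_quotient y (\<Union>h\<in>H. left_quotient h {s. \<pi> s \<in> U})) ` Y0"
      using \<open>finite \<F>\<close> \<open>\<F> \<subseteq> _\<close> by (meson finite_subset_image)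
    \<comment> \<open>The covering is applied to the group element
      \<open>\<pi> y o\<^sub>L e\<close>.\<close>
    have "\<exists>h\<in>H. \<pi> (h * y) o\<^sub>L e \<in> U" for y
      using H(2) rep_in_SS by (force simp: rep_mult blinfun_compose_assoc)
    then obtain h where h: "\<And>y. h y \<in> H" "\<And>y. \<pi> (h y * y) o\<^sub>L e \<in> U" by metis
    have "openin WOT ((\<Inter>y\<in>Y0. ?N (h y * y)) \<inter> topspace WOT)"
      using Y0(1) openin_left[OF U(1) rep_in_SS] by (intro openin_INT) auto
    moreover have "e \<in> (\<Inter>y\<in>Y0. ?N (h y * y)) \<inter> topspace WOT" using h(2) e_clinear by auto
    ultimately obtain x where "\<pi> x \<in> (\<Inter>y\<in>Y0. ?N (h y * y)) \<inter> topspace WOT"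
      using enveloping_approximation[OF e_SS] by blast
    then have "h y * (y * x) \<in> {s. \<pi> s \<in> U}" if "y \<in> Y0" for y
      using that by (auto simp: rep_mult blinfun_compose_assoc)
    then have "x \<in> \<Inter>\<F>" using h(1) Y0(2) by (auto simp: left_quotient_def)
    then show ?thesis by blast
  qed
  show ?thesis
    unfolding piecewise_syndetic_def using H(1) \<open>H \<noteq> {}\<close> fip by (intro exI[of _ H]) blast
qed

lemma thickly_syndetic_imp_aws:
  assumes thick: "\<And>U. openin weak_topology U \<Longrightarrow> 0 \<in> U \<Longrightarrow> thickly_syndetic {s. \<pi> s \<xi> \<in> U}"
  shows "e \<xi> = 0"
proof (rule functionals_separate)
  fix f :: "'e \<Rightarrow> real" assume f: "bounded_linear f"
  then interpret f: bounded_linear f .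
  have "\<bar>f (e \<xi>)\<bar> \<le> 0 + \<delta>" if \<delta>: "\<delta> > 0" for \<delta>
  proof -
    let ?U = "{T \<in> clinear_operators. f (blinfun_apply T \<xi>) \<in> ball (f (e \<xi>)) (\<delta>/2)}"
    have "piecewise_syndetic {s. \<pi> s \<in> ?U}"
      using \<delta> e_clinear by (intro piecewise_syndetic_neighborhood openin_WOT_real f) auto
    moreover have "thickly_syndetic {s. \<pi> s \<xi> \<in> {x. f x \<in> ball 0 (\<delta>/2)}}"
      using \<delta> by (intro thick openin_weak_real f) (auto simp: f.zero)
    ultimately obtain s where "\<pi> s \<in> ?U" "f (\<pi> s \<xi>) \<in> ball 0 (\<delta>/2)"
      unfolding thickly_syndetic_def by blast
    then have "\<bar>f (e \<xi>) - f (\<pi> s \<xi>)\<bar> < \<delta> / 2" "\<bar>f (\<pi> s \<xi>)\<bar> < \<delta> / 2"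
      by (simp_all add: dist_real_def)
    then show ?thesis by linarith
  qed
  then have "\<bar>f (e \<xi>)\<bar> \<le> 0" by (rule field_le_epsilon)
  then show "f (e \<xi>) = f 0" by (simp add: f.zero)
qed

end

section \<open>Ultrafilters and difference products\<close>

text \<open>Finer filters are smaller, so Zorn's lemma is used downwards. A minimal proper filter
  decides every \<open>P\<close>: adjoining \<open>P\<close> either yields a proper filter, hence
  the same one, or shows that the negation already holds eventually.\<close>

lemma ultrafilter_refines:
  assumes "F \<noteq> bot"
  obtains p where "ultrafilter p" "p \<le> F"
proof -
  define A where "A = {p. p \<noteq> bot \<and> p \<le> F}"
  have "\<exists>p\<in>A. \<forall>q\<in>A. q \<le> p \<longrightarrow> q = p"
  proof (rule predicate_Zorn)
    show "partial_order_on A (relation_of (\<lambda>p q. q \<le> p) A)"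
      by (rule partial_order_on_relation_ofI) auto
  next
    fix C assume C: "C \<in> Chains (relation_of (\<lambda>p q. q \<le> p) A)"
    have CA: "p \<noteq> bot" "p \<le> F" if "p \<in> C" for p
      using C that unfolding Chains_def relation_of_def A_def by auto
    have lin: "p \<le> q \<or> q \<le> p" if "p \<in> C" "q \<in> C" for p q
      using C that unfolding Chains_def relation_of_def by auto
    show "\<exists>u\<in>A. \<forall>p\<in>C. u \<le> p"
    proof (cases "C = {}")
      case True
      then show ?thesis using assms by (auto simp: A_def)
    next
      case False
      have "\<exists>x\<in>C. x \<le> inf p q" if pq: "p \<in> C" "q \<in> C" for p q
        using lin[OF pq]
      proof
        assume "p \<le> q"
        then show ?thesis using pq(1) by (intro bexI[of _ p]) simp_all
      next
        assume "q \<le> p"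
        then show ?thesis using pq(2) by (intro bexI[of _ q]) simp_all
      qed
      then have "eventually P (Inf C) \<longleftrightarrow> (\<exists>p\<in>C. eventually P p)" for P
        using False by (intro eventually_Inf_base)
      then have "Inf C \<noteq> bot" using CA(1) by (auto simp: trivial_limit_def)
      moreover have "Inf C \<le> F" using False CA(2) Inf_lower2 by blast
      ultimately show ?thesis by (auto simp: A_def Inf_lower intro!: bexI[of _ "Inf C"])
    qed
  qed
  then obtain p where p: "p \<noteq> bot" "p \<le> F" and min: "\<And>q. q \<in> A \<Longrightarrow> q \<le> p \<Longrightarrow> q = p"
    unfolding A_def by blast
  have "eventually P p" if "\<not> eventually (\<lambda>x. \<not> P x) p" for P
  proof -
    have "inf p (principal {x. P x}) \<noteq> bot"
      using that by (simp add: trivial_limit_def eventually_inf_principal)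
    then have "inf p (principal {x. P x}) = p"
      using p(2) by (intro min) (auto simp: A_def intro: le_infI1)
    moreover have "eventually P (inf p (principal {x. P x}))" by (simp add: eventually_inf_principal)
    ultimately show ?thesis by simp
  qed
  then have "ultrafilter p" using p(1) by (auto simp: ultrafilter_def)
  then show ?thesis using that p(2) by blast
qed

lemma ultrafilter_ex: "ultrafilter p \<Longrightarrow> eventually P p \<Longrightarrow> \<exists>x. P x"
  unfolding ultrafilter_def using eventually_happens by blast

lemma ultrafilter_not: "ultrafilter p \<Longrightarrow> \<not> eventually P p \<Longrightarrow> eventually (\<lambda>x. \<not> P x) p"
  by (auto simp: ultrafilter_def)

lemma ultrafilter_filtermap: "ultrafilter p \<Longrightarrow> ultrafilter (filtermap f p)"
  by (auto simp: ultrafilter_def filtermap_bot_iff eventually_filtermap)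

lemma ultrafilter_principal: "ultrafilter (principal {x})"
  by (auto simp: ultrafilter_def principal_eq_bot_iff eventually_principal)

lemma ultrafilter_ultrafilter_mult:
  assumes q: "ultrafilter q" and p: "ultrafilter p"
  shows "ultrafilter (ultrafilter_mult G q p)"
  unfolding ultrafilter_def
proof (intro conjI allI)
  have "\<not> eventually (\<lambda>_. False) p" "\<not> eventually (\<lambda>_. False) q"
    using p q ultrafilter_ex by blast+
  then show "ultrafilter_mult G q p \<noteq> bot"
    by (simp add: trivial_limit_def eventually_ultrafilter_mult)
next
  fix P
  show "eventually P (ultrafilter_mult G q p) \<or> eventually (\<lambda>x. \<not> P x) (ultrafilter_mult G q p)"
  proof (rule disjCI)
    assume "\<not> eventually (\<lambda>x. \<not> P x) (ultrafilter_mult G q p)"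
    then have "\<forall>\<^sub>F g in q. \<not> (\<forall>\<^sub>F x in p. \<not> P (g \<otimes>\<^bsub>G\<^esub> x))"
      unfolding eventually_ultrafilter_mult by (rule ultrafilter_not[OF q])
    then show "eventually P (ultrafilter_mult G q p)"
      unfolding eventually_ultrafilter_mult
      by (rule eventually_mono) (use ultrafilter_not[OF p] in force)
  qed
qed

lemma ultrafilter_difference_product:
  "(\<And>p. p \<in> set ps \<Longrightarrow> ultrafilter p) \<Longrightarrow> ultrafilter (difference_product G ps)"
  by (induction ps)
    (auto simp: ultrafilter_inv_def intro!: ultrafilter_ultrafilter_mult ultrafilter_filtermap ultrafilter_principal)

text \<open>Injective translations of a finite set are bijective, so the semigroup is a group. This
  settles the case in which there are no nonprincipal ultrafilters.\<close>

lemma finite_cancellative_left_inverse: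
  assumes fin: "finite (UNIV :: 's::semigroup_mult set)"
    and canc: "cancellative TYPE('s::semigroup_mult)"
  obtains c :: "'s::semigroup_mult" where "\<And>s. c * s = s" "\<And>s. s * c = s" "\<And>s. \<exists>t. t * s = c"
proof -
  have cl: "x = y" if "a * x = a * y" for a x y :: 's
    using canc that unfolding cancellative_def by blast
  have cr: "x = y" if "x * a = y * a" for a x y :: 's
    using canc that unfolding cancellative_def by blast
  have surj_l: "surj (\<lambda>x. a * x)" and surj_r: "surj (\<lambda>x. x * a)" for a :: 's
    by (rule finite_UNIV_inj_surj[OF fin], rule injI, erule cl)
      (rule finite_UNIV_inj_surj[OF fin], rule injI, erule cr)
  fix a :: 's
  obtain c where c: "a * c = a" using surj_l[of a] by (metis surjD)
  have l: "c * s = s" for s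
    by (rule cl[of a]) (simp add: c flip: mult.assoc)
  have r: "s * c = s" for s
    by (rule cr[of _ s]) (simp add: l mult.assoc)
  show ?thesis using that[of c] l r surj_r by (metis surjD)
qed

section \<open>Limits along ultrafilters and difference products in the group of quotients\<close>

context JdLG_representation
begin

lemma SS_bounded_apply:
  obtains M where "M > 0" "\<And>u x. u \<in> SS \<Longrightarrow> norm (blinfun_apply u x) \<le> M * norm x"
proof -
  obtain M where M: "M \<ge> 0" "\<And>u. u \<in> SS \<Longrightarrow> norm u \<le> M" using SS_bounded by blast
  have "norm (blinfun_apply u x) \<le> (M + 1) * norm x" if "u \<in> SS" for u x
  proof -
    have "norm (blinfun_apply u x) \<le> norm u * norm x" by (rule norm_blinfun)
    also have "\<dots> \<le> (M + 1) * norm x" using M(2)[OF that] by (intro mult_right_mono) auto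
    finally show ?thesis .
  qed
  then show ?thesis using that[of "M + 1"] M(1) by simp
qed

text \<open>The relation \<open>extends G \<iota> g a\<close> says that \<open>a\<close> is the value at \<open>g\<close> of the homomorphism from the
  group of quotients to the group of operators \<open>e \<circ> u\<close> that extends \<open>s \<mapsto> e \<circ> \<pi> s\<close>.\<close>

definition extends :: "('g, 'm) monoid_scheme \<Rightarrow> ('s \<Rightarrow> 'g) \<Rightarrow> 'g \<Rightarrow> ('e \<Rightarrow>\<^sub>L 'e) \<Rightarrow> bool" where
  "extends G \<iota> g a \<longleftrightarrow> a \<in> SS \<and> e o\<^sub>L a = a \<and>
     (\<exists>s t. g \<otimes>\<^bsub>G\<^esub> \<iota> t = \<iota> s \<and> \<pi> s o\<^sub>L e = a o\<^sub>L \<pi> t)"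

text \<open>Without a limit, each point of \<open>SS\<close> would have a neighbourhood that
  \<open>p\<close> avoids. Finitely many of these cover \<open>SS\<close>, and \<open>p\<close>
  would avoid all of \<open>\<iota>\<close>'s range.\<close>

lemma ultrafilter_limit:
  assumes p: "p \<in> ultrafilters_on (range \<iota>)"
  obtains u where "u \<in> SS" "\<And>U. openin WOT U \<Longrightarrow> u \<in> U \<Longrightarrow> \<forall>\<^sub>F x in p. x \<in> \<iota> ` {s. \<pi> s \<in> U}"
proof (rule ccontr)
  assume "\<not> thesis"
  note limit = that
  have no: "\<exists>U. openin WOT U \<and> u \<in> U \<and> \<not> (\<forall>\<^sub>F x in p. x \<in> \<iota> ` {s. \<pi> s \<in> U})" if "u \<in> SS" for u
  proof (rule ccontr)
    assume "\<nexists>U. openin WOT U \<and> u \<in> U \<and> \<not> (\<forall>\<^sub>F x in p. x \<in> \<iota> ` {s. \<pi> s \<in> U})"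
    then have thesis by (intro limit[OF that]) simp
    then show False using \<open>\<not> thesis\<close> by contradiction
  qed
  have uf: "ultrafilter p" and rng: "\<forall>\<^sub>F x in p. x \<in> range \<iota>"
    using p by (auto simp: ultrafilters_on_def)
  let ?\<U> = "{U. openin WOT U \<and> \<not> (\<forall>\<^sub>F x in p. x \<in> \<iota> ` {s. \<pi> s \<in> U})}"
  have "SS \<subseteq> \<Union>?\<U>" using no by blast
  then obtain \<V> where V: "finite \<V>" "\<V> \<subseteq> ?\<U>" "SS \<subseteq> \<Union>\<V>"
    using SS_compact[unfolded compactin_def, THEN conjunct2, rule_format, of ?\<U>] by auto
  have "\<forall>\<^sub>F x in p. \<forall>U\<in>\<V>. x \<notin> \<iota> ` {s. \<pi> s \<in> U}"
    using V(1,2) ultrafilter_not[OF uf] by (intro eventually_ball_finite) auto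
  then have "\<forall>\<^sub>F x in p. False"
    using rng
  proof eventually_elim
    case (elim x)
    then obtain s where "x = \<iota> s" by blast
    moreover obtain U where "U \<in> \<V>" "\<pi> s \<in> U" using V(3) rep_in_SS by blast
    ultimately show False using elim(1) by blast
  qed
  then show False using ultrafilter_ex[OF uf] by blast
qed

text \<open>If \<open>u\<close> is the weak limit and \<open>v\<close> its inverse, then
  \<open>v o\<^sub>L \<pi> s\<close> tends to \<open>e\<close>, where the orbit map is norm
  continuous. Applying \<open>u\<close> carries this back, so \<eta> is \<open>u \<xi>\<close>; the
  cost is the factor \<open>M\<close>.\<close>

lemma reversible_norm_limit:
  assumes p: "p \<in> ultrafilters_on (range \<iota>)" and \<xi>: "e \<xi> = \<xi>"
  obtains \<eta> where "\<And>\<delta>. \<delta> > 0 \<Longrightarrow> \<forall>\<^sub>F x in p. x \<in> \<iota> ` {s. norm (\<pi> s \<xi> - \<eta>) < \<delta>}"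
proof -
  obtain u where u: "u \<in> SS"
    and lim: "\<And>U. openin WOT U \<Longrightarrow> u \<in> U \<Longrightarrow> \<forall>\<^sub>F x in p. x \<in> \<iota> ` {s. \<pi> s \<in> U}"
    using ultrafilter_limit[OF p] by blast
  obtain v where v: "v \<in> SS" "v o\<^sub>L u = e" "u o\<^sub>L v = e" using ex_inverse[OF u] by blast
  obtain M where M: "M > 0" "\<And>u x. u \<in> SS \<Longrightarrow> norm (blinfun_apply u x) \<le> M * norm x"
    using SS_bounded_apply by blast
  have "\<forall>\<^sub>F x in p. x \<in> \<iota> ` {s. norm (\<pi> s \<xi> - u \<xi>) < \<delta>}" if \<delta>: "\<delta> > 0" for \<delta>
  proof -
    have "\<delta> / M > 0" using \<delta> M(1) by simp
    then obtain U where U: "openin WOT U" "e \<in> U"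
      and near: "\<And>u. u \<in> SS \<Longrightarrow> u o\<^sub>L e \<in> U \<Longrightarrow> norm (u \<xi> - \<xi>) < \<delta> / M"
      using reversible_strongly_continuous[OF \<xi>] by blast
    let ?U = "{T \<in> clinear_operators. v o\<^sub>L T \<in> {T \<in> clinear_operators. T o\<^sub>L e \<in> U}}"
    have "openin WOT ?U" using openin_left[OF openin_right[OF U(1) e_SS] v(1)] .
    moreover have "u \<in> ?U" using u v U(2) ee SS_clinear e_clinear by simp
    ultimately have ev: "\<forall>\<^sub>F x in p. x \<in> \<iota> ` {s. \<pi> s \<in> ?U}" by (rule lim)
    have "norm (\<pi> s \<xi> - u \<xi>) < \<delta>" if s: "\<pi> s \<in> ?U" for s
    proof -
      have "norm ((v o\<^sub>L \<pi> s) \<xi> - \<xi>) < \<delta> / M" using s v rep_in_SS SS_compose by (intro near) auto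
      then have "M * norm (v (\<pi> s \<xi>) - \<xi>) < \<delta>" using M(1) by (simp add: field_simps)
      moreover have "u (v (\<pi> s \<xi>) - \<xi>) = \<pi> s \<xi> - u \<xi>"
        using v(3) \<xi> e_apply_commute[OF rep_in_SS]
        by (metis blinfun.diff_right blinfun_apply_blinfun_compose)
      ultimately show ?thesis using M(2)[OF u, of "v (\<pi> s \<xi>) - \<xi>"] by simp
    qed
    then show ?thesis by (intro eventually_mono[OF ev]) auto
  qed
  then show ?thesis using that by blast
qed

text \<open>Quotients \<open>s\<^sup>-\<^sup>1 t\<close> with \<open>\<pi> s \<xi>\<close> and
  \<open>\<pi> t \<xi>\<close> close to the same norm limit move \<xi> little, and the factors
  \<open>p\<^sup>-\<^sup>1 p\<close> live on them. Moving \<xi> little survives products because the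
  operators are uniformly bounded, and on elements of S it is the desired recurrence.\<close>

lemma reversible_Delta_star:
  fixes G :: "'g monoid"
  assumes rev: "left_reversible TYPE('s)" and quot: "group_of_right_quotients G \<iota>"
    and \<xi>: "e \<xi> = \<xi>" and \<epsilon>: "\<epsilon> > 0"
  shows "Delta_star G \<iota> l {s. norm (\<xi> - \<pi> s \<xi>) < \<epsilon>}"
proof -
  interpret G: group G using quot by (simp add: group_of_right_quotients_def)
  have \<iota>_carrier [simp]: "\<iota> s \<in> carrier G" for s using quot by (auto simp: group_of_right_quotients_def)
  have \<iota>_mult: "\<iota> (s * t) = \<iota> s \<otimes>\<^bsub>G\<^esub> \<iota> t" for s t using quot by (simp add: group_of_right_quotients_def)
  have \<iota>_inj: "\<iota> s = \<iota> t \<Longrightarrow> s = t" for s t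
    using quot by (auto simp: group_of_right_quotients_def inj_def)
  have common: "\<exists>x y. s * x = t * y" for s t :: 's
    using rev unfolding left_reversible_def by (metis Int_emptyI imageE)
  have ext_mult: "extends G \<iota> (g \<otimes>\<^bsub>G\<^esub> h) (a o\<^sub>L b)"
    if g: "g \<in> carrier G" "extends G \<iota> g a" and h: "h \<in> carrier G" "extends G \<iota> h b" for g h a b
  proof -
    obtain s t s' t' where st: "h \<otimes>\<^bsub>G\<^esub> \<iota> t = \<iota> s" "\<pi> s o\<^sub>L e = b o\<^sub>L \<pi> t"
      and st': "g \<otimes>\<^bsub>G\<^esub> \<iota> t' = \<iota> s'" "\<pi> s' o\<^sub>L e = a o\<^sub>L \<pi> t'"
      using g h unfolding extends_def by blast
    \<comment> \<open>A common right multiple matches the numerator of \<open>h\<close> with the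
      denominator of \<open>g\<close>, so that the two fractions can be multiplied.\<close>
    obtain x y where xy: "s * x = t' * y" using common by blast
    have ab: "a \<in> SS" "b \<in> SS" "e o\<^sub>L a = a" using g h by (auto simp: extends_def)
    have "(g \<otimes>\<^bsub>G\<^esub> h) \<otimes>\<^bsub>G\<^esub> \<iota> (t * x) = g \<otimes>\<^bsub>G\<^esub> ((h \<otimes>\<^bsub>G\<^esub> \<iota> t) \<otimes>\<^bsub>G\<^esub> \<iota> x)"
      using g h by (simp add: \<iota>_mult G.m_assoc)
    also have "\<dots> = g \<otimes>\<^bsub>G\<^esub> \<iota> (t' * y)" unfolding st(1) xy[symmetric] \<iota>_mult ..
    also have "\<dots> = \<iota> (s' * y)" using g by (simp add: \<iota>_mult st'(1) flip: G.m_assoc)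
    finally have "(g \<otimes>\<^bsub>G\<^esub> h) \<otimes>\<^bsub>G\<^esub> \<iota> (t * x) = \<iota> (s' * y)" .
    moreover have "(a o\<^sub>L b) o\<^sub>L \<pi> (t * x) = a o\<^sub>L ((b o\<^sub>L \<pi> t) o\<^sub>L \<pi> x)"
      by (simp add: rep_mult blinfun_compose_assoc)
    then have "(a o\<^sub>L b) o\<^sub>L \<pi> (t * x) = a o\<^sub>L (\<pi> s o\<^sub>L (e o\<^sub>L \<pi> x))"
      by (simp add: blinfun_compose_assoc flip: st(2))
    then have "(a o\<^sub>L b) o\<^sub>L \<pi> (t * x) = a o\<^sub>L (\<pi> (s * x) o\<^sub>L e)"
      by (simp add: e_central[OF rep_in_SS] rep_mult blinfun_compose_assoc)
    then have "(a o\<^sub>L b) o\<^sub>L \<pi> (t * x) = (a o\<^sub>L \<pi> t') o\<^sub>L (\<pi> y o\<^sub>L e)"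
      by (simp add: xy rep_mult blinfun_compose_assoc)
    then have "(a o\<^sub>L b) o\<^sub>L \<pi> (t * x) = \<pi> s' o\<^sub>L ((e o\<^sub>L \<pi> y) o\<^sub>L e)"
      by (simp add: blinfun_compose_assoc flip: st'(2))
    then have "\<pi> (s' * y) o\<^sub>L e = (a o\<^sub>L b) o\<^sub>L \<pi> (t * x)"
      by (simp add: e_central[OF rep_in_SS] rep_mult blinfun_compose_assoc ee)
    ultimately show ?thesis
      unfolding extends_def using ab SS_compose by (metis blinfun_compose_assoc)
  qed
  have ext_diff: "extends G \<iota> (inv\<^bsub>G\<^esub> \<iota> s \<otimes>\<^bsub>G\<^esub> \<iota> t) (v o\<^sub>L \<pi> t)"
    if v: "v \<in> SS" "v o\<^sub>L \<pi> s = e" "e o\<^sub>L v = v" for s t v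
  proof -
    obtain x y where xy: "s * x = t * y" using common by blast
    have "(inv\<^bsub>G\<^esub> \<iota> s \<otimes>\<^bsub>G\<^esub> \<iota> t) \<otimes>\<^bsub>G\<^esub> \<iota> y = inv\<^bsub>G\<^esub> \<iota> s \<otimes>\<^bsub>G\<^esub> \<iota> (s * x)"
      by (simp add: xy \<iota>_mult G.m_assoc)
    also have "\<dots> = \<iota> x" by (simp add: \<iota>_mult flip: G.m_assoc)
    finally have "(inv\<^bsub>G\<^esub> \<iota> s \<otimes>\<^bsub>G\<^esub> \<iota> t) \<otimes>\<^bsub>G\<^esub> \<iota> y = \<iota> x" .
    moreover have "(v o\<^sub>L \<pi> t) o\<^sub>L \<pi> y = (v o\<^sub>L \<pi> s) o\<^sub>L \<pi> x"
      by (metis blinfun_compose_assoc rep_mult xy)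
    then have "\<pi> x o\<^sub>L e = (v o\<^sub>L \<pi> t) o\<^sub>L \<pi> y" by (simp add: v(2) e_central[OF rep_in_SS])
    moreover have "e o\<^sub>L (v o\<^sub>L \<pi> t) = v o\<^sub>L \<pi> t" using v(3) by (metis blinfun_compose_assoc)
    ultimately show ?thesis unfolding extends_def using v(1) SS_compose rep_in_SS by blast
  qed
  \<comment> \<open>\<open>extends\<close> is only a relation. Single-valuedness is proved just
    where it matters, at the elements of S.\<close>
  have ext_\<iota>: "a = \<pi> r o\<^sub>L e" if ra: "extends G \<iota> (\<iota> r) a" for r a
  proof -
    obtain s t where st: "\<iota> r \<otimes>\<^bsub>G\<^esub> \<iota> t = \<iota> s" "\<pi> s o\<^sub>L e = a o\<^sub>L \<pi> t" and a: "a \<in> SS" "e o\<^sub>L a = a"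
      using ra unfolding extends_def by blast
    have s: "s = r * t" using st(1) \<iota>_inj by (simp flip: \<iota>_mult)
    obtain v where v: "v \<in> SS" "\<pi> t o\<^sub>L v = e" "e o\<^sub>L v = v" using ex_inverse[OF rep_in_SS] by blast
    have "a = a o\<^sub>L (\<pi> t o\<^sub>L v)" using a e_central[OF a(1)] by (simp add: v(2))
    also have "\<dots> = (\<pi> s o\<^sub>L e) o\<^sub>L v" by (simp add: st(2) blinfun_compose_assoc)
    also have "\<dots> = \<pi> r o\<^sub>L (\<pi> t o\<^sub>L (e o\<^sub>L v))" by (simp add: s rep_mult blinfun_compose_assoc)
    also have "\<dots> = \<pi> r o\<^sub>L e" unfolding v(2,3) ..
    finally show ?thesis .
  qed
  obtain M where M: "M > 0" "\<And>u x. u \<in> SS \<Longrightarrow> norm (blinfun_apply u x) \<le> M * norm x"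
    using SS_bounded_apply by blast
  define near where "near \<delta> g \<longleftrightarrow> g \<in> carrier G \<and> (\<exists>a. extends G \<iota> g a \<and> norm (a \<xi> - \<xi>) < \<delta>)" for \<delta> g
  have near_diff: "\<forall>\<^sub>F g in ultrafilter_mult G (ultrafilter_inv G p) p. near \<delta> g"
    if p: "p \<in> ultrafilters_on (range \<iota>)" and \<delta>: "\<delta> > 0" for p \<delta>
  proof -
    obtain \<eta> where \<eta>: "\<And>\<delta>. \<delta> > 0 \<Longrightarrow> \<forall>\<^sub>F x in p. x \<in> \<iota> ` {s. norm (\<pi> s \<xi> - \<eta>) < \<delta>}"
      using reversible_norm_limit[OF p \<xi>] by blast
    \<comment> \<open>Half for each leg of the triangle through \<eta>, and \<open>M\<close> for the
      operator \<open>v\<close> that inverts \<open>\<pi> s\<close>.\<close>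
    define \<gamma> where "\<gamma> = \<delta> / (2 * M)"
    have ev: "\<forall>\<^sub>F x in p. x \<in> \<iota> ` {s. norm (\<pi> s \<xi> - \<eta>) < \<gamma>}" using \<delta> M(1) by (intro \<eta>) (simp add: \<gamma>_def)
    have "near \<delta> (inv\<^bsub>G\<^esub> \<iota> s \<otimes>\<^bsub>G\<^esub> \<iota> t)"
      if s: "norm (\<pi> s \<xi> - \<eta>) < \<gamma>" and t: "norm (\<pi> t \<xi> - \<eta>) < \<gamma>" for s t
    proof -
      obtain v where v: "v \<in> SS" "v o\<^sub>L \<pi> s = e" "e o\<^sub>L v = v" using ex_inverse[OF rep_in_SS] by blast
      have "(v o\<^sub>L \<pi> t) \<xi> - \<xi> = v (\<pi> t \<xi> - \<pi> s \<xi>)"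
        using v(2) \<xi> by (metis blinfun.diff_right blinfun_apply_blinfun_compose)
      then have "norm ((v o\<^sub>L \<pi> t) \<xi> - \<xi>) \<le> M * norm (\<pi> t \<xi> - \<pi> s \<xi>)" using M(2)[OF v(1)] by simp
      also have "\<dots> < M * (\<gamma> + \<gamma>)"
        using M(1) s t norm_diff_triangle_less[of "\<pi> t \<xi>" \<eta> \<gamma> "\<pi> s \<xi>" \<gamma>]
        by (intro mult_strict_left_mono) (simp_all add: norm_minus_commute)
      also have "\<dots> = \<delta>" using M(1) by (simp add: \<gamma>_def)
      finally show ?thesis using ext_diff[OF v, of t] unfolding near_def by (intro conjI exI[of _ "v o\<^sub>L \<pi> t"]) simp_all
    qed
    then have "\<forall>\<^sub>F x in p. \<forall>\<^sub>F y in p. near \<delta> (inv\<^bsub>G\<^esub> x \<otimes>\<^bsub>G\<^esub> y)"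
      by (intro eventually_mono[OF ev]) (auto intro!: eventually_mono[OF ev])
    then show ?thesis
      by (simp add: eventually_ultrafilter_mult ultrafilter_inv_def eventually_filtermap)
  qed
  have near_mult: "\<forall>\<^sub>F g in ultrafilter_mult G q p. near \<delta> g"
    if q: "\<And>\<delta>. \<delta> > 0 \<Longrightarrow> \<forall>\<^sub>F g in q. near \<delta> g" and p: "\<And>\<delta>. \<delta> > 0 \<Longrightarrow> \<forall>\<^sub>F g in p. near \<delta> g"
      and \<delta>: "\<delta> > 0" for q p \<delta>
  proof -
    have evq: "\<forall>\<^sub>F g in q. near (\<delta>/2) g" and evp: "\<forall>\<^sub>F h in p. near (\<delta>/(2*M)) h"
      using \<delta> M(1) q p by simp_all
    have "near \<delta> (g \<otimes>\<^bsub>G\<^esub> h)" if g: "near (\<delta>/2) g" and h: "near (\<delta>/(2*M)) h" for g h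
    proof -
      obtain a b where a: "extends G \<iota> g a" "norm (a \<xi> - \<xi>) < \<delta>/2"
        and b: "extends G \<iota> h b" "norm (b \<xi> - \<xi>) < \<delta>/(2*M)"
        using g h unfolding near_def by blast
      have "a \<in> SS" using a(1) by (simp add: extends_def)
      then have "norm (a (b \<xi> - \<xi>)) \<le> M * norm (b \<xi> - \<xi>)" by (rule M(2))
      also have "\<dots> \<le> \<delta>/2" using b(2) M(1) by (simp add: field_simps)
      finally have "norm (a (b \<xi> - \<xi>)) + norm (a \<xi> - \<xi>) < \<delta>" using a(2) by simp
      moreover have "(a o\<^sub>L b) \<xi> - \<xi> = a (b \<xi> - \<xi>) + (a \<xi> - \<xi>)" by (simp add: blinfun.diff_right)
      ultimately have "norm ((a o\<^sub>L b) \<xi> - \<xi>) < \<delta>" using norm_triangle_ineq by (metis le_less_trans)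
      moreover have "extends G \<iota> (g \<otimes>\<^bsub>G\<^esub> h) (a o\<^sub>L b)"
        using g h a(1) b(1) by (intro ext_mult) (auto simp: near_def)
      ultimately show ?thesis using g h unfolding near_def by blast
    qed
    then show ?thesis
      unfolding eventually_ultrafilter_mult
      by (intro eventually_mono[OF evq]) (auto intro!: eventually_mono[OF evp])
  qed
  have near_one: "near \<delta> \<one>\<^bsub>G\<^esub>" if "\<delta> > 0" for \<delta>
  proof -
    have "\<one>\<^bsub>G\<^esub> \<otimes>\<^bsub>G\<^esub> \<iota> s = \<iota> s" "\<pi> s o\<^sub>L e = e o\<^sub>L \<pi> s" for s using e_central[OF rep_in_SS] by simp_all
    then have "extends G \<iota> \<one>\<^bsub>G\<^esub> e" unfolding extends_def using e_SS ee by blast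
    then show ?thesis using \<xi> that by (auto simp: near_def)
  qed
  have near_product: "\<forall>\<^sub>F g in difference_product G ps. near \<delta> g"
    if "set ps \<subseteq> ultrafilters_on (range \<iota>)" "\<delta> > 0" for ps \<delta>
    using that
  proof (induction ps arbitrary: \<delta>)
    case Nil
    then show ?case by (simp add: eventually_principal near_one)
  next
    case (Cons p ps)
    then show ?case
      unfolding difference_product.simps by (intro near_mult near_diff Cons.IH) simp_all
  qed
  show ?thesis
    unfolding Delta_star_def
  proof (intro allI impI, elim conjE)
    fix ps
    assume ps: "set ps \<subseteq> nonprincipal_ultrafilters_on (range \<iota>)"
      and q: "difference_product G ps \<in> ultrafilters_on (range \<iota>)"
    have "\<forall>\<^sub>F g in difference_product G ps. near \<epsilon> g"
      using ps \<epsilon> by (intro near_product) (auto simp: nonprincipal_ultrafilters_on_def)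
    moreover have "\<forall>\<^sub>F g in difference_product G ps. g \<in> range \<iota>"
      using q by (simp add: ultrafilters_on_def)
    ultimately show "\<forall>\<^sub>F g in difference_product G ps. g \<in> \<iota> ` {s. norm (\<xi> - \<pi> s \<xi>) < \<epsilon>}"
    proof eventually_elim
      case (elim g)
      then obtain s a where s: "g = \<iota> s" and a: "extends G \<iota> (\<iota> s) a" "norm (a \<xi> - \<xi>) < \<epsilon>"
        unfolding near_def by blast
      have "norm (\<xi> - \<pi> s \<xi>) < \<epsilon>" using a(2) \<xi> unfolding ext_\<iota>[OF a(1)] by (simp add: norm_minus_commute)
      then show ?case using s by blast
    qed
  qed
qed

text \<open>A finite set of operators is closed, so \<open>e\<close> is some \<open>\<pi> s\<close>.
  As S is a group, this operator is invertible, and an invertible idempotent is the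
  identity.\<close>

lemma e_eq_id_of_finite:
  assumes fin: "finite (UNIV :: 's set)" and canc: "cancellative TYPE('s)"
  shows "e = id_blinfun"
proof -
  obtain c :: 's where c: "\<And>s. c * s = s" "\<And>s. s * c = s" "\<And>s. \<exists>t. t * s = c"
    using finite_cancellative_left_inverse[OF fin canc] by metis
  have \<pi>c: "\<pi> c = id_blinfun" using rep c(1,2) unfolding representation_def by metis
  have "closedin WOT (range \<pi>)"
    using fin rep_clinear by (intro compactin_imp_closedin Hausdorff_WOT finite_imp_compactin) auto
  then have "SS = range \<pi>" by (simp add: enveloping_semigroup_def closure_of_closedin)
  then obtain s where s: "e = \<pi> s" using e_SS by auto
  obtain t where "t * s = c" using c(3) by blast
  then have "id_blinfun = \<pi> t o\<^sub>L e" using \<pi>c by (simp add: s flip: rep_mult)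
  moreover have "id_blinfun o\<^sub>L e = e" by (rule blinfun_eqI) simp
  ultimately have "e = (\<pi> t o\<^sub>L e) o\<^sub>L e" by simp
  also have "\<dots> = \<pi> t o\<^sub>L e" by (simp add: blinfun_compose_assoc ee)
  also have "\<dots> = id_blinfun" using \<open>id_blinfun = \<pi> t o\<^sub>L e\<close> ..
  finally show ?thesis .
qed

text \<open>Take \<open>p = r' r\<close>, where \<open>r'\<close> is nonprincipal and contains all right ideals \<open>a S\<close>, and where \<open>r\<close>
  converges to \<open>e\<close>. Since \<open>a\<^sup>-\<^sup>1 r'\<close> lives on \<open>S\<close> for each \<open>a\<close>, the product \<open>p\<^sup>-\<^sup>1p \<cdots> p\<^sup>-\<^sup>1p\<close> lives on \<open>S\<close> and
  has the form \<open>q' r\<close> with \<open>q'\<close> on \<open>S\<close>. So some \<open>\<pi>\<^sub>x \<pi>\<^sub>y \<xi>\<close> is close to \<open>\<xi>\<close> for \<open>r\<close>-most \<open>y\<close>, and hence so is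
  \<open>\<pi>\<^sub>x e \<xi>\<close>, which lies in the range of \<open>e\<close>.\<close>

lemma Delta_star_imp_reversible:
  fixes G :: "'g monoid"
  assumes canc: "cancellative TYPE('s)" and rev: "left_reversible TYPE('s)"
    and quot: "group_of_right_quotients G \<iota>" and l: "l \<ge> 1"
    and \<Delta>: "\<And>\<epsilon>. \<epsilon> > 0 \<Longrightarrow> Delta_star G \<iota> l {s. norm (\<xi> - \<pi> s \<xi>) < \<epsilon>}"
  shows "e \<xi> = \<xi>"
proof (cases "finite (UNIV :: 's set)")
  case True
  then show ?thesis using e_eq_id_of_finite[OF True canc] by simp
next
  case inf: False
  interpret G: group G using quot by (simp add: group_of_right_quotients_def)
  have \<iota>_carrier [simp]: "\<iota> s \<in> carrier G" for s using quot by (auto simp: group_of_right_quotients_def)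
  have \<iota>_mult: "\<iota> (s * t) = \<iota> s \<otimes>\<^bsub>G\<^esub> \<iota> t" for s t using quot by (simp add: group_of_right_quotients_def)
  have \<iota>_inj: "\<iota> s = \<iota> t \<Longrightarrow> s = t" for s t
    using quot by (auto simp: group_of_right_quotients_def inj_def)
  have common: "\<exists>x y. s * x = t * y" for s t :: 's
    using rev unfolding left_reversible_def by (metis Int_emptyI imageE)
  have cl: "x = y" if "a * x = a * y" for a x y :: 's
    using canc that unfolding cancellative_def by blast
  have cr: "x = y" if "x * a = y * a" for a x y :: 's
    using canc that unfolding cancellative_def by blast
  \<comment> \<open>These index the right ideals \<open>z S\<close> with finitely many points
    removed. Left reversibility makes them a filter base, and they are nonempty because left
    cancellation makes \<open>z S\<close> infinite.\<close>
  define I where "I = {(z :: 's, F :: 's set). finite F}"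
  define X where "X = (\<lambda>(z :: 's, F). range (\<lambda>x. z * x) - F)"
  define r\<^sub>0 where "r\<^sub>0 = (INF i\<in>I. principal (X i))"
  have r\<^sub>0: "eventually P r\<^sub>0 \<longleftrightarrow> (\<exists>i\<in>I. eventually P (principal (X i)))" for P
    unfolding r\<^sub>0_def
  proof (rule eventually_INF_base)
    show "I \<noteq> {}" by (auto simp: I_def)
    fix i j assume ij: "i \<in> I" "j \<in> I"
    obtain z F w F' where i: "i = (z, F)" and j: "j = (w, F')" by (cases i, cases j) auto
    obtain x y where xy: "z * x = w * y" using common by blast
    have "X (z * x, F \<union> F') \<subseteq> X i"
      by (auto simp: X_def i mult.assoc)
    moreover have "X (w * y, F \<union> F') \<subseteq> X j"
      by (auto simp: X_def j mult.assoc)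
    moreover have "(z * x, F \<union> F') \<in> I" using ij by (simp add: I_def i j)
    ultimately show "\<exists>k\<in>I. principal (X k) \<le> inf (principal (X i)) (principal (X j))"
      unfolding xy by (intro bexI[of _ "(w * y, F \<union> F')"]) auto
  qed
  have "X i \<noteq> {}" if i: "i \<in> I" for i
  proof -
    obtain z F where zF: "i = (z, F)" "finite F" using i by (auto simp: I_def)
    have "inj (\<lambda>x. z * x)" using cl by (intro injI)
    then have "infinite (range (\<lambda>x. z * x))" using inf finite_imageD by blast
    then show ?thesis using zF(2) by (auto simp: X_def zF(1) dest: finite_subset)
  qed
  then have "r\<^sub>0 \<noteq> bot" by (simp add: trivial_limit_def r\<^sub>0 eventually_principal)
  then obtain r' where r': "ultrafilter r'" "r' \<le> r\<^sub>0" using ultrafilter_refines by blast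
  have r'X: "\<forall>\<^sub>F x in r'. x \<in> X i" if "i \<in> I" for i
    using that by (intro filter_leD[OF r'(2)]) (auto simp: r\<^sub>0 eventually_principal)
  have r'_ideal: "\<forall>\<^sub>F x in r'. x \<in> range (\<lambda>x. a * x)" for a
    using r'X[of "(a, {})"] by (simp add: X_def I_def)
  have r'_free: "\<forall>\<^sub>F x in r'. x \<noteq> a" for a
    by (rule eventually_mono[OF r'X[of "(a, {a})"]]) (auto simp: X_def I_def)
  define \<N> where "\<N> = {U. openin WOT U \<and> e \<in> U}"
  define r\<^sub>1 where "r\<^sub>1 = (INF U\<in>\<N>. principal {s. \<pi> s \<in> U})"
  have r\<^sub>1: "eventually P r\<^sub>1 \<longleftrightarrow> (\<exists>U\<in>\<N>. eventually P (principal {s. \<pi> s \<in> U}))" for P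
    unfolding r\<^sub>1_def
  proof (rule eventually_INF_base)
    show "\<N> \<noteq> {}" using openin_topspace[of WOT] e_clinear unfolding \<N>_def by auto
    fix U V assume "U \<in> \<N>" "V \<in> \<N>"
    then show "\<exists>W\<in>\<N>. principal {s. \<pi> s \<in> W} \<le> inf (principal {s. \<pi> s \<in> U}) (principal {s. \<pi> s \<in> V})"
      by (intro bexI[of _ "U \<inter> V"]) (auto simp: \<N>_def)
  qed
  have "r\<^sub>1 \<noteq> bot"
    using enveloping_approximation[OF e_SS] by (auto simp: trivial_limit_def r\<^sub>1 eventually_principal \<N>_def)
  then obtain r where r: "ultrafilter r" "r \<le> r\<^sub>1" using ultrafilter_refines by blast
  have r_lim: "\<forall>\<^sub>F y in r. \<pi> y \<in> U" if "openin WOT U" "e \<in> U" for U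
    using that by (intro filter_leD[OF r(2)]) (auto simp: r\<^sub>1 eventually_principal \<N>_def)
  define p where "p = ultrafilter_mult G (filtermap \<iota> r') (filtermap \<iota> r)"
  have ev_p: "eventually P p \<longleftrightarrow> (\<forall>\<^sub>F x in r'. \<forall>\<^sub>F y in r. P (\<iota> x \<otimes>\<^bsub>G\<^esub> \<iota> y))" for P
    by (simp add: p_def eventually_ultrafilter_mult eventually_filtermap)
  have up: "ultrafilter p"
    unfolding p_def by (intro ultrafilter_ultrafilter_mult ultrafilter_filtermap r r')
  have p_rng: "\<forall>\<^sub>F g in p. g \<in> range \<iota>" unfolding ev_p by (simp flip: \<iota>_mult)
  \<comment> \<open>Were \<open>p\<close> principal, two distinct \<open>a\<close> and
    \<open>b\<close> would satisfy \<open>a * y = b * y\<close> for a common \<open>y\<close>, since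
    \<open>r'\<close> does not concentrate at one point.\<close>
  have "p \<noteq> principal {g}" for g
  proof
    assume "p = principal {g}"
    then have "\<forall>\<^sub>F x in p. x = g" by (simp add: eventually_principal)
    then have ev: "\<forall>\<^sub>F x in r'. \<forall>\<^sub>F y in r. \<iota> x \<otimes>\<^bsub>G\<^esub> \<iota> y = g" by (simp add: ev_p)
    obtain a where a: "\<forall>\<^sub>F y in r. \<iota> a \<otimes>\<^bsub>G\<^esub> \<iota> y = g" using ultrafilter_ex[OF r'(1) ev] by blast
    obtain b where b: "b \<noteq> a" "\<forall>\<^sub>F y in r. \<iota> b \<otimes>\<^bsub>G\<^esub> \<iota> y = g"
      using ultrafilter_ex[OF r'(1) eventually_conj[OF r'_free[of a] ev]] by blast
    obtain y where "\<iota> a \<otimes>\<^bsub>G\<^esub> \<iota> y = g" "\<iota> b \<otimes>\<^bsub>G\<^esub> \<iota> y = g"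
      using ultrafilter_ex[OF r(1) eventually_conj[OF a b(2)]] by blast
    then have "a * y = b * y" by (intro \<iota>_inj) (simp add: \<iota>_mult)
    then show False using cr b(1) by blast
  qed
  then have p: "p \<in> nonprincipal_ultrafilters_on (range \<iota>)"
    using up p_rng by (simp add: nonprincipal_ultrafilters_on_def ultrafilters_on_def)
  \<comment> \<open>Only this trace of a factorisation \<open>q' r\<close> with \<open>q'\<close> on
    S is needed, and unlike an explicit \<open>q'\<close> it passes directly through the products
    below.\<close>
  define tail where "tail Q \<longleftrightarrow> (\<forall>\<^sub>F g in Q. g \<in> range \<iota>) \<and>
    (\<forall>P. (\<forall>\<^sub>F g in Q. P g) \<longrightarrow> (\<exists>x. \<forall>\<^sub>F y in r. P (\<iota> x \<otimes>\<^bsub>G\<^esub> \<iota> y)))" for Q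
  define d where "d = ultrafilter_mult G (ultrafilter_inv G p) p"
  have ev_d: "eventually P d \<longleftrightarrow> (\<forall>\<^sub>F g in p. \<forall>\<^sub>F h in p. P (inv\<^bsub>G\<^esub> g \<otimes>\<^bsub>G\<^esub> h))" for P
    by (simp add: d_def eventually_ultrafilter_mult ultrafilter_inv_def eventually_filtermap)
  have shift: "inv\<^bsub>G\<^esub> \<iota> a \<otimes>\<^bsub>G\<^esub> (\<iota> (a * x) \<otimes>\<^bsub>G\<^esub> \<iota> y) = \<iota> x \<otimes>\<^bsub>G\<^esub> \<iota> y" for a x y
    by (simp add: \<iota>_mult G.m_assoc G.inv_solve_left')
  have tail_d: "tail d"
    unfolding tail_def
  proof (intro conjI allI impI)
    have "\<forall>\<^sub>F h in p. inv\<^bsub>G\<^esub> \<iota> a \<otimes>\<^bsub>G\<^esub> h \<in> range \<iota>" for a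
      unfolding ev_p
    proof (rule eventually_mono[OF r'_ideal[of a]])
      fix x assume "x \<in> range (\<lambda>x. a * x)"
      then obtain x' where "x = a * x'" by blast
      then have "inv\<^bsub>G\<^esub> \<iota> a \<otimes>\<^bsub>G\<^esub> (\<iota> x \<otimes>\<^bsub>G\<^esub> \<iota> y) = \<iota> (x' * y)" for y
        using shift[of a x' y] by (simp add: \<iota>_mult[of x' y])
      then show "\<forall>\<^sub>F y in r. inv\<^bsub>G\<^esub> \<iota> a \<otimes>\<^bsub>G\<^esub> (\<iota> x \<otimes>\<^bsub>G\<^esub> \<iota> y) \<in> range \<iota>" by simp
    qed
    then show "\<forall>\<^sub>F g in d. g \<in> range \<iota>" unfolding ev_d
      by - (rule eventually_mono[OF p_rng], elim rangeE, simp only:)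
    fix P assume "\<forall>\<^sub>F g in d. P g"
    then have "\<forall>\<^sub>F g in p. g \<in> range \<iota> \<and> (\<forall>\<^sub>F h in p. P (inv\<^bsub>G\<^esub> g \<otimes>\<^bsub>G\<^esub> h))"
      unfolding ev_d by (intro eventually_conj p_rng)
    then obtain a where "\<forall>\<^sub>F h in p. P (inv\<^bsub>G\<^esub> \<iota> a \<otimes>\<^bsub>G\<^esub> h)" using ultrafilter_ex[OF up] by blast
    then have "\<forall>\<^sub>F x in r'. x \<in> range (\<lambda>x. a * x) \<and> (\<forall>\<^sub>F y in r. P (inv\<^bsub>G\<^esub> \<iota> a \<otimes>\<^bsub>G\<^esub> (\<iota> x \<otimes>\<^bsub>G\<^esub> \<iota> y)))"
      unfolding ev_p by (intro eventually_conj r'_ideal)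
    then obtain x where "\<forall>\<^sub>F y in r. P (inv\<^bsub>G\<^esub> \<iota> a \<otimes>\<^bsub>G\<^esub> (\<iota> (a * x) \<otimes>\<^bsub>G\<^esub> \<iota> y))"
      using ultrafilter_ex[OF r'(1)] by blast
    then show "\<exists>x. \<forall>\<^sub>F y in r. P (\<iota> x \<otimes>\<^bsub>G\<^esub> \<iota> y)" unfolding shift by blast
  qed
  have tail_mult: "tail (ultrafilter_mult G d Q)" if Q: "tail Q" for Q
    unfolding tail_def eventually_ultrafilter_mult
  proof (intro conjI allI impI)
    have d_rng: "\<forall>\<^sub>F g in d. g \<in> range \<iota>" and Q_rng: "\<forall>\<^sub>F h in Q. h \<in> range \<iota>"
      using tail_d Q by (auto simp: tail_def)
    have "\<iota> a \<otimes>\<^bsub>G\<^esub> \<iota> b \<in> range \<iota>" for a b by (simp flip: \<iota>_mult)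
    then show "\<forall>\<^sub>F g in d. \<forall>\<^sub>F h in Q. g \<otimes>\<^bsub>G\<^esub> h \<in> range \<iota>"
      by (intro eventually_mono[OF d_rng]) (auto intro!: eventually_mono[OF Q_rng])
    fix P assume ev: "\<forall>\<^sub>F g in d. \<forall>\<^sub>F h in Q. P (g \<otimes>\<^bsub>G\<^esub> h)"
    have "ultrafilter d"
      unfolding d_def ultrafilter_inv_def
      by (intro ultrafilter_ultrafilter_mult ultrafilter_filtermap up)
    then obtain a where "\<forall>\<^sub>F h in Q. P (\<iota> a \<otimes>\<^bsub>G\<^esub> h)"
      using ultrafilter_ex[OF _ eventually_conj[OF d_rng ev]] by blast
    then obtain x where "\<forall>\<^sub>F y in r. P (\<iota> a \<otimes>\<^bsub>G\<^esub> (\<iota> x \<otimes>\<^bsub>G\<^esub> \<iota> y))" using Q unfolding tail_def by blast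
    then have "\<forall>\<^sub>F y in r. P (\<iota> (a * x) \<otimes>\<^bsub>G\<^esub> \<iota> y)" by (simp add: \<iota>_mult G.m_assoc)
    then show "\<exists>x. \<forall>\<^sub>F y in r. P (\<iota> x \<otimes>\<^bsub>G\<^esub> \<iota> y)" by blast
  qed
  \<comment> \<open>\<open>difference_product\<close> ends in the identity ultrafilter, which is
    absorbed here.\<close>
  have one: "ultrafilter_mult G d (principal {\<one>\<^bsub>G\<^esub>}) = d"
  proof (rule filter_eqI)
    fix P
    have "\<forall>\<^sub>F g in d. g \<otimes>\<^bsub>G\<^esub> \<one>\<^bsub>G\<^esub> = g"
      using tail_d unfolding tail_def by (auto elim!: eventually_mono)
    then have "(\<forall>\<^sub>F g in d. P (g \<otimes>\<^bsub>G\<^esub> \<one>\<^bsub>G\<^esub>)) \<longleftrightarrow> (\<forall>\<^sub>F g in d. P g)"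
      by (intro eventually_cong) (auto elim!: eventually_mono)
    then show "eventually P (ultrafilter_mult G d (principal {\<one>\<^bsub>G\<^esub>})) \<longleftrightarrow> eventually P d"
      by (simp add: eventually_ultrafilter_mult eventually_principal)
  qed
  define q where "q = difference_product G (replicate l p)"
  \<comment> \<open>The induction starts at one factor, since it is the first \<open>d\<close> that
    supplies the tail \<open>r\<close>; this is where \<open>l \<ge> 1\<close> enters.\<close>
  have "tail (difference_product G (replicate (Suc n) p))" for n
  proof (induction n)
    case 0
    then show ?case using tail_d one by (simp add: d_def)
  next
    case (Suc n)
    then show ?case using tail_mult by (subst replicate_Suc, subst difference_product.simps) (simp only: d_def)
  qed
  then have tail_q: "tail q" using l unfolding q_def by (metis Suc_le_D One_nat_def)
  have "ultrafilter q" unfolding q_def using up by (intro ultrafilter_difference_product) auto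
  then have q_on: "q \<in> ultrafilters_on (range \<iota>)" using tail_q by (simp add: ultrafilters_on_def tail_def)
  obtain M where M: "M > 0" "\<And>u x. u \<in> SS \<Longrightarrow> norm (blinfun_apply u x) \<le> M * norm x"
    using SS_bounded_apply by blast
  have bound: "norm (\<xi> - e \<xi>) \<le> 0 + \<delta>" if \<delta>: "\<delta> > 0" for \<delta>
  proof -
    define \<epsilon> where "\<epsilon> = \<delta> / (1 + M)"
    have \<epsilon>: "\<epsilon> > 0" using \<delta> M(1) by (simp add: \<epsilon>_def)
    have "\<forall>\<^sub>F g in q. g \<in> \<iota> ` {s. norm (\<xi> - \<pi> s \<xi>) < \<epsilon>}"
      using \<Delta>[OF \<epsilon>] p q_on unfolding Delta_star_def q_def
      by (metis (no_types, lifting) length_replicate set_replicate_conv_if empty_subsetI insert_subset)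
    then obtain x where "\<forall>\<^sub>F y in r. \<iota> (x * y) \<in> \<iota> ` {s. norm (\<xi> - \<pi> s \<xi>) < \<epsilon>}"
      using tail_q unfolding tail_def \<iota>_mult by blast
    then have x: "\<forall>\<^sub>F y in r. norm (\<xi> - \<pi> (x * y) \<xi>) < \<epsilon>"
      by (rule eventually_mono) (use \<iota>_inj in blast)
    define a where "a = \<xi> - \<pi> x (e \<xi>)"
    \<comment> \<open>The norm is weakly lower semicontinuous: a functional norming \<open>a\<close>
      transfers the bound for \<open>\<xi> - \<pi> (x * y) \<xi>\<close> to the weak limit along
      \<open>r\<close>.\<close>
    have "norm a \<le> \<epsilon>"
    proof (rule field_le_epsilon)
      fix \<gamma> :: real assume \<gamma>: "\<gamma> > 0"
      obtain f :: "'e \<Rightarrow> real" where f: "bounded_linear f" "\<And>x. \<bar>f x\<bar> \<le> norm x" "f a = norm a"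
        using norming_functional by blast
      interpret f: bounded_linear f by (rule f(1))
      let ?U = "{T \<in> clinear_operators. f (\<pi> x (blinfun_apply T \<xi>)) \<in> ball (f (\<pi> x (e \<xi>))) \<gamma>}"
      have "openin WOT ?U"
        by (rule openin_WOT_real) (auto intro: bounded_linear_compose[OF f(1)] blinfun.bounded_linear_right)
      then have "\<forall>\<^sub>F y in r. \<pi> y \<in> ?U" using \<gamma> e_clinear by (intro r_lim) auto
      then obtain y where y: "norm (\<xi> - \<pi> (x * y) \<xi>) < \<epsilon>" "\<pi> y \<in> ?U"
        using ultrafilter_ex[OF r(1) eventually_conj[OF x]] by blast
      have "f a = f (\<xi> - \<pi> (x * y) \<xi>) + (f (\<pi> x (\<pi> y \<xi>)) - f (\<pi> x (e \<xi>)))"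
        by (simp add: a_def f.diff rep_mult)
      moreover have "f (\<xi> - \<pi> (x * y) \<xi>) < \<epsilon>" using y(1) f(2)[of "\<xi> - \<pi> (x * y) \<xi>"] by linarith
      moreover have "\<bar>f (\<pi> x (e \<xi>)) - f (\<pi> x (\<pi> y \<xi>))\<bar> < \<gamma>" using y(2) by (simp add: dist_real_def)
      ultimately show "norm a \<le> \<epsilon> + \<gamma>" using f(3) by linarith
    qed
    \<comment> \<open>\<open>\<pi> x (e \<xi>)\<close> is fixed by \<open>e\<close>, so it cancels
      in \<open>a - e a\<close>. What remains is \<open>\<xi> - e \<xi>\<close>, and this explains
      the factor \<open>1 + M\<close>.\<close>
    have "e (e \<xi>) = e \<xi>" by (metis blinfun_apply_blinfun_compose ee)
    then have "\<xi> - e \<xi> = a - e a"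
      using e_apply_commute[OF rep_in_SS, of x "e \<xi>"] by (simp add: a_def blinfun.diff_right)
    then have "norm (\<xi> - e \<xi>) \<le> norm a + M * norm a"
      using norm_triangle_ineq4[of a "e a"] M(2)[OF e_SS, of a] by simp
    also have "\<dots> \<le> \<epsilon> + M * \<epsilon>" using \<open>norm a \<le> \<epsilon>\<close> M(1) by (intro add_mono mult_left_mono) auto
    also have "\<dots> = (1 + M) * \<epsilon>" by (simp add: algebra_simps)
    also have "\<dots> = \<delta>" using M(1) by (simp add: \<epsilon>_def)
    finally show ?thesis by simp
  qed
  have "norm (\<xi> - e \<xi>) \<le> 0" using bound by (rule field_le_epsilon)
  then show ?thesis by simp
qed

end

theorem theorem5p3:
  fixes \<pi> :: "'s::semigroup_mult \<Rightarrow> ('e::complex_banach \<Rightarrow>\<^sub>L 'e)" and \<xi> :: 'e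
  assumes "representation \<pi>" and "JdLG_admissible \<pi>"
  shows "(\<xi> \<in> E_r \<pi> \<longleftrightarrow> (\<forall>\<epsilon>>0. IP_star {s. norm (\<xi> - \<pi> s \<xi>) < \<epsilon>})) \<and>
    (\<xi> \<in> E_aws \<pi> \<longleftrightarrow>
       (\<forall>U. openin weak_topology U \<and> 0 \<in> U \<longrightarrow> thickly_syndetic {s. \<pi> s \<xi> \<in> U})) \<and>
    (cancellative TYPE('s) \<and> left_reversible TYPE('s) \<longrightarrow>
       (\<forall>(G :: 'g monoid) \<iota> l. group_of_right_quotients G (\<iota> :: 's \<Rightarrow> 'g) \<and> l \<ge> 1 \<longrightarrow>
          (\<xi> \<in> E_r \<pi> \<longleftrightarrow> (\<forall>\<epsilon>>0. Delta_star G \<iota> l {s. norm (\<xi> - \<pi> s \<xi>) < \<epsilon>}))))"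
proof -
  interpret JdLG_representation \<pi> using assms by unfold_locales
  have "(\<xi> \<in> E_r \<pi>) = (\<forall>\<epsilon>>0. IP_star {s. norm (\<xi> - \<pi> s \<xi>) < \<epsilon>})"
    unfolding E_r_iff using reversible_IP_star IP_star_imp_reversible by blast
  moreover have "(\<xi> \<in> E_aws \<pi>) =
      (\<forall>U. openin weak_topology U \<and> 0 \<in> U \<longrightarrow> thickly_syndetic {s. \<pi> s \<xi> \<in> U})"
    unfolding E_aws_iff using aws_thickly_syndetic thickly_syndetic_imp_aws by blast
  moreover have "(\<xi> \<in> E_r \<pi>) = (\<forall>\<epsilon>>0. Delta_star G \<iota> l {s. norm (\<xi> - \<pi> s \<xi>) < \<epsilon>})"
    if "cancellative TYPE('s)" "left_reversible TYPE('s)" "group_of_right_quotients G \<iota>" "l \<ge> 1"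
    for G :: "'g monoid" and \<iota> l
    unfolding E_r_iff
    using reversible_Delta_star[OF that(2,3)] Delta_star_imp_reversible[OF that] by blast
  ultimately show ?thesis by blast
qed

end
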